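(* Let $p\geq3$ and $k\geq1$ be integers. There exists $c>0$ such that for every $\lambda>c$, $$\lim_{N\to\infty}\frac1N m_N=m_*(\lambda)\quad\text{almost surely},\qquad \lim_{N\to\infty}\frac1N L_N=-\frac{\lambda m_*(\lambda)^k}{k}-\sqrt{p\left(1-m_*(\lambda)^2\right)}\quad\text{almost surely}.$$
   Context: Let $S^{N-1}(\sqrt N)=\{\sigma\in\mathbb{R}^N:\sum\sigma_i^2=N\}$, fix $\mathbf v_0\in S^{N-1}(\sqrt N)$, let $(J_{i_1,\dots,i_p})$ be i.i.d. standard Gaussians and $$H_N(\sigma)=N^{-(p-1)/2}\sum_{1\le i_1,\dots,i_p\le N}J_{i_1,\dots,i_p}\sigma_{i_1}\cdots\sigma_{i_p}-\frac{\lambda N}{k}\left(\frac{\sigma\cdot\mathbf v_0}{N}\right)^k.$$ $L_N=\min_{\sigma\in S^{N-1}(\sqrt N)}H_N(\sigma)$ is the ground state energy and $m_N=\left(\arg\min_{\sigma\in S^{N-1}(\sqrt N)}H_N(\sigma)\right)\cdot\mathbf v_0$. $m_*(\lambda)$ is the largest solution $m\in(0,1]$ of $\lambda m^k/\sqrt p=m^2/\sqrt{1-m^2}$.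
   Formalization: For even k the sign of m_N is not determined (H_N is even in σ if p is even; for odd p, m_N has a symmetric law under J→−J), so the formal claim is |m_N|/N→m_*(λ) for even k and m_N/N→m_*(λ) for odd k, for every choice of minimizers. *)

theory Defs
  imports "HOL-Probability.Probability"
begin

text \<open>Vectors in R^N are represented as functions nat => real supported on {..<N}
  (coordinates 0..N-1).\<close>

definition sphereN :: "nat \<Rightarrow> (nat \<Rightarrow> real) set" where
  "sphereN N = {\<sigma>. (\<forall>i\<ge>N. \<sigma> i = 0) \<and> (\<Sum>i<N. (\<sigma> i)\<^sup>2) = real N}"

definition dotN :: "nat \<Rightarrow> (nat \<Rightarrow> real) \<Rightarrow> (nat \<Rightarrow> real) \<Rightarrow> real" where
  "dotN N \<sigma> v = (\<Sum>i<N. \<sigma> i * v i)"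

definition tidx :: "nat \<Rightarrow> nat \<Rightarrow> nat list set" where
  "tidx p N = {is. length is = p \<and> set is \<subseteq> {..<N}}"

definition Ham :: "nat \<Rightarrow> nat \<Rightarrow> real \<Rightarrow> nat \<Rightarrow> (nat \<Rightarrow> real) \<Rightarrow> (nat list \<Rightarrow> real)
                    \<Rightarrow> (nat \<Rightarrow> real) \<Rightarrow> real" where
  "Ham p k lam N v0 J \<sigma> =
     real N powr (- (real p - 1) / 2) * (\<Sum>is\<in>tidx p N. J is * prod_list (map \<sigma> is))
     - lam * real N / real k * (dotN N \<sigma> v0 / real N) ^ k"

definition ground :: "nat \<Rightarrow> nat \<Rightarrow> real \<Rightarrow> nat \<Rightarrow> (nat \<Rightarrow> real) \<Rightarrow> (nat list \<Rightarrow> real) \<Rightarrow> real" where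
  "ground p k lam N v0 J = (INF \<sigma>\<in>sphereN N. Ham p k lam N v0 J \<sigma>)"

text \<open>m_*(lambda): largest solution m in (0,1] of lambda m^k / sqrt p = m^2 / sqrt(1-m^2).
  m = 1 is never a solution (the right-hand side is infinite there), so we range over (0,1).\<close>
definition mstar :: "nat \<Rightarrow> nat \<Rightarrow> real \<Rightarrow> real" where
  "mstar p k lam = (GREATEST m. 0 < m \<and> m < 1 \<and>
       lam * m ^ k / sqrt (real p) = m\<^sup>2 / sqrt (1 - m\<^sup>2))"

end

theory Submission
  imports Defs
begin

text \<open>Normalise to unit vectors and maximise -H. When lam is large, on the event that the noise tensor
  has operator norm of order sqrt N, the maximum over a hemisphere is attained near v with quadratic
  growth. The p-spin field X is interpolated to the linear field sqrt p (g . u) in finitely many steps: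
  split off an independent increment sqrt h X' of X and let u* maximise the rest. Adding sqrt h X' moves
  the maximiser by O(sqrt h), so only the tangential gradient of X' at u* matters, up to O(h^(3/2)).
  Conditionally on the rest, this gradient together with an independent radial normal is exactly sqrt p
  times a standard Gaussian vector, so the increment may be replaced by a linear one. The total error
  over 1/h steps is O(sqrt h), outside an event of exponentially small probability. The maximum of the
  linear field is explicit and tends to max_m (sqrt (p (1 - m^2)) + lam m^k / k), which is attained at
  m_*(lam). Borel-Cantelli gives the almost sure limit, and the overlap follows by differentiating the
  limiting energy, which is concave in lam.\<close>

section \<open>Gaussian vectors\<close>

text \<open>Comparing increment variances, 1 - t^p \<le> p (1 - t), bounds the p-spin supremum by
  the linear one from above only; the interpolation is what gives both directions. The factor sqrt p
  is forced: along a unit tangent direction the derivative of the field has p times the variance of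
  its value. Write \<eta> = sqrt h. One step has three errors of order \<eta>^3: the slack of the
  near-maximiser, the second-order remainder of the increment over a displacement O(\<eta>), and the
  values at u* of the increment and of the radial normal. The last two are evaluated at one fixed
  point and so are below \<eta>^2 with overwhelming probability. The threshold on lam is fixed once
  for the whole path, because s^2 + r^2 \<le> 1 bounds the second-order constant of every
  intermediate field. Each step compares the laws of the suprema, in both directions, so the
  concentration of the explicit linear end carries over to the p-spin end. The number of steps
  depends on the precision but not on N, so the error probabilities remain summable.\<close>

abbreviation (input) std_normal :: "real measure" where
  "std_normal \<equiv> std_normal_distribution"

text \<open>Reweighting \<open>M\<close> by \<open>W / expectation W\<close> gives a probability
  under which \<open>Z\<close> has the standard normal characteristic function, so Levy uniqueness
  applies. The weight carries what is known about other coordinates, and the factorisation is one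
  step towards independence.\<close>

lemma (in prob_space) weighted_std_normalI:
  fixes W Z :: "'a \<Rightarrow> real"
  assumes [measurable]: "W \<in> borel_measurable M" "Z \<in> borel_measurable M" "E \<in> sets borel"
    and W: "\<And>x. 0 \<le> W x" "\<And>x. W x \<le> B"
    and char: "\<And>t. (CLINT x|M. complex_of_real (W x) * iexp (t * Z x)) =
                 complex_of_real (expectation W) * exp (- (t\<^sup>2) / 2)"
  shows "expectation (\<lambda>x. W x * indicator E (Z x)) = expectation W * measure std_normal E"
proof -
  have intW: "integrable M W"
    by (rule integrable_const_bound[where B=B]) (use W in auto)
  have EW: "0 \<le> expectation W" by (simp add: W)
  show ?thesis
  proof (cases "expectation W = 0")
    case True
    then have "AE x in M. W x = 0"
      using integral_nonneg_eq_0_iff_AE[OF intW] W by auto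
    then have "expectation (\<lambda>x. W x * indicator E (Z x)) = expectation (\<lambda>x. 0)"
      by (intro integral_cong_AE) auto
    with True show ?thesis by simp
  next
    case False
    define c where "c = expectation W"
    have c: "c > 0" using EW False by (simp add: c_def)
    define N where "N = density M (\<lambda>x. ennreal (W x / c))"
    have meas_N[measurable]: "Z \<in> borel_measurable N" by (simp add: N_def)
    have "emeasure N (space N) = 1"
    proof -
      have "emeasure N (space N) = (\<integral>\<^sup>+x. ennreal (W x / c) \<partial>M)"
        by (simp add: N_def emeasure_density cong: nn_integral_cong)
      also have "\<dots> = ennreal (expectation (\<lambda>x. W x / c))"
        using c W intW by (intro nn_integral_eq_integral) auto
      finally show ?thesis using c by (simp add: c_def[symmetric])
    qed
    then interpret N: prob_space N by (rule prob_spaceI)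
    have rd: "real_distribution (distr N borel Z)"
      by (rule N.real_distribution_distr) simp
    have "char (distr N borel Z) = char std_normal"
    proof
      fix t
      have "char (distr N borel Z) t = (CLINT x|N. iexp (t * Z x))"
        by (simp add: char_def integral_distr)
      also have "\<dots> = (CLINT x|M. (W x / c) *\<^sub>R iexp (t * Z x))"
        unfolding N_def using c W by (subst integral_density) auto
      also have "\<dots> = (CLINT x|M. complex_of_real (W x) * iexp (t * Z x) / c)"
        by (intro Bochner_Integration.integral_cong) (auto simp: scaleR_conv_of_real)
      also have "\<dots> = exp (- (t\<^sup>2) / 2)"
        unfolding integral_divide_zero char using c by (simp add: c_def[symmetric])
      finally show "char (distr N borel Z) t = char std_normal t"
        by (simp add: char_std_normal_distribution)
    qed
    then have eq: "distr N borel Z = std_normal"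
      using Levy_uniqueness[OF rd real_dist_normal_dist] by simp
    have "measure std_normal E = measure N (Z -` E \<inter> space N)"
      unfolding eq[symmetric] by (subst measure_distr) auto
    also have "\<dots> = (\<integral>x. indicator (Z -` E \<inter> space N) x \<partial>N)"
      by simp
    also have "\<dots> = (\<integral>x. (W x / c) *\<^sub>R indicator (Z -` E \<inter> space M) x \<partial>M)"
      unfolding N_def space_density using c W by (subst integral_density) auto
    also have "\<dots> = (\<integral>x. W x * indicator E (Z x) / c \<partial>M)"
      by (intro Bochner_Integration.integral_cong) (auto simp: indicator_def)
    finally show ?thesis using c by (simp add: c_def[symmetric] field_simps)
  qed
qed

text \<open>Independence is extracted from the joint characteristic function by uniqueness in one
  dimension. \<open>B1\<close> holds the coordinates already turned into events, \<open>B2\<close>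
  those still in the exponent. The induction moves one coordinate from the exponent to the events;
  empty \<open>B2\<close> gives the product law.\<close>

lemma (in prob_space) iid_std_normal_prob:
  fixes Z :: "'i \<Rightarrow> 'a \<Rightarrow> real"
  assumes Z[measurable]: "\<And>j. j \<in> B \<Longrightarrow> Z j \<in> borel_measurable M" and "finite B"
    and char: "\<And>t. (CLINT x|M. iexp (\<Sum>j\<in>B. t j * Z j x)) = exp (- (\<Sum>j\<in>B. (t j)\<^sup>2) / 2)"
    and "B1 \<subseteq> B" "B2 \<subseteq> B" "B1 \<inter> B2 = {}"
    and E[measurable]: "\<And>j. j \<in> B1 \<Longrightarrow> E j \<in> sets borel"
  shows "(CLINT x|M. complex_of_real (\<Prod>j\<in>B1. indicator (E j) (Z j x)) * iexp (\<Sum>j\<in>B2. t j * Z j x))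
    = (\<Prod>j\<in>B1. measure std_normal (E j)) * exp (- (\<Sum>j\<in>B2. (t j)\<^sup>2) / 2)"
proof -
  have "finite B1" using assms finite_subset by auto
  from this assms(4-) show ?thesis
  proof (induction B1 arbitrary: B2 t)
    case empty
    then have "finite B2" using \<open>finite B\<close> finite_subset by auto
    \<comment> \<open>Frequency 0 outside \<open>B2\<close> reduces to the hypothesis on all of
      \<open>B\<close>.\<close>
    define s where "s j = (if j \<in> B2 then t j else 0)" for j
    have 1: "(\<Sum>j\<in>B2. t j * Z j x) = (\<Sum>j\<in>B. s j * Z j x)" for x
      using empty \<open>finite B\<close> unfolding s_def
      by (intro sum.mono_neutral_cong_left) auto
    have 2: "(\<Sum>j\<in>B2. (t j)\<^sup>2) = (\<Sum>j\<in>B. (s j)\<^sup>2)"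
      using empty \<open>finite B\<close> unfolding s_def
      by (intro sum.mono_neutral_cong_left) auto
    show ?case unfolding 1 2 using char[of s] by simp
  next
    case (insert i B1)
    have finB2: "finite B2" using insert \<open>finite B\<close> finite_subset by auto
    have iB: "i \<in> B" "i \<notin> B2" using insert by auto
    define I where "I x = (\<Prod>j\<in>B1. indicator (E j) (Z j x) :: real)" for x
    define \<theta> where "\<theta> x = (\<Sum>j\<in>B2. t j * Z j x)" for x
    define P where "P = (\<Prod>j\<in>B1. measure std_normal (E j))"
    define e where "e = exp (- (\<Sum>j\<in>B2. (t j)\<^sup>2) / 2)"
    have [measurable]: "Z i \<in> borel_measurable M" "E i \<in> sets borel"
      using iB insert by auto
    have \<theta>m[measurable]: "\<theta> \<in> borel_measurable M"
      unfolding \<theta>_def using insert by (intro borel_measurable_sum borel_measurable_times) auto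
    have Im[measurable]: "I \<in> borel_measurable M"
      unfolding I_def
    proof (intro borel_measurable_prod)
      fix j assume "j \<in> B1"
      then have [measurable]: "Z j \<in> borel_measurable M" "E j \<in> sets borel"
        using insert.prems by auto
      show "(\<lambda>x. indicator (E j) (Z j x) :: real) \<in> borel_measurable M"
        by measurable
    qed
    have I01: "0 \<le> I x" "I x \<le> 1" for x
      unfolding I_def by (auto intro!: prod_nonneg prod_le_1)
    have IH: "(CLINT x|M. complex_of_real (I x) * iexp (\<Sum>j\<in>B'. t' j * Z j x)) =
        P * exp (- (\<Sum>j\<in>B'. (t' j)\<^sup>2) / 2)" if "B' \<subseteq> B" "B1 \<inter> B' = {}" for B' t'
      using insert.IH[of B' t'] insert.prems that by (auto simp: I_def P_def)
    \<comment> \<open>The sign \<epsilon> flips the phase of \<open>B2\<close> alone. Both signs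
      give the same value because the Gaussian exponent is even, so averaging yields the cosine with
      the full value (\<open>C1\<close>) and the sine with value 0 (\<open>S1\<close>).\<close>
    have A1: "(CLINT x|M. complex_of_real (I x) * iexp (\<epsilon> * \<theta> x + s * Z i x)) = P * e * exp (- (s\<^sup>2) / 2)"
      if "\<epsilon> = 1 \<or> \<epsilon> = -1" for s \<epsilon> :: real
    proof -
      have "(\<Sum>j\<in>insert i B2. (if j = i then s else \<epsilon> * t j) * Z j x) = \<epsilon> * \<theta> x + s * Z i x" for x
        using iB finB2 unfolding \<theta>_def
        by (auto simp: sum_distrib_left mult.assoc intro!: sum.cong)
      moreover have "(\<Sum>j\<in>insert i B2. (if j = i then s else \<epsilon> * t j)\<^sup>2) = s\<^sup>2 + (\<Sum>j\<in>B2. (t j)\<^sup>2)"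
        using iB finB2 that
        by (auto simp: power_mult_distrib intro!: sum.cong)
      moreover have "exp (- (s\<^sup>2 + (\<Sum>j\<in>B2. (t j)\<^sup>2)) / 2) = e * exp (- (s\<^sup>2) / 2)"
        unfolding e_def exp_add[symmetric] by (simp add: field_simps)
      ultimately show ?thesis
        using IH[of "insert i B2" "\<lambda>j. if j = i then s else \<epsilon> * t j"] insert.prems insert.hyps iB
        by simp
    qed
    have A0: "(CLINT x|M. complex_of_real (I x) * iexp (s * Z i x)) = P * exp (- (s\<^sup>2) / 2)" for s :: real
      using IH[of "{i}" "\<lambda>_. s"] insert iB by auto
    have int: "integrable M (\<lambda>x. complex_of_real (I x) * iexp (g x))" if [measurable]: "g \<in> borel_measurable M" for g
      by (rule integrable_const_bound[where B=1]) (use I01 in \<open>auto simp: norm_mult\<close>)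
    have intr: "integrable M (\<lambda>x. I x * g x)" if [measurable]: "g \<in> borel_measurable M" "\<And>x. \<bar>g x\<bar> \<le> 1" for g
      by (rule integrable_const_bound[where B=1]) (use I01 that in \<open>auto simp: abs_mult intro!: mult_le_one\<close>)
    have cosI: "complex_of_real (I x * cos (\<theta> x)) * iexp (s * Z i x) =
        (complex_of_real (I x) * iexp (1 * \<theta> x + s * Z i x) + complex_of_real (I x) * iexp ((-1) * \<theta> x + s * Z i x)) / 2" for x s
    proof -
      have "complex_of_real (cos (\<theta> x)) = (iexp (\<theta> x) + iexp (- \<theta> x)) / 2"
        by (simp add: cos_exp_eq cos_of_real[symmetric])
      moreover have "iexp (1 * \<theta> x + s * Z i x) = iexp (\<theta> x) * iexp (s * Z i x)"
        "iexp ((-1) * \<theta> x + s * Z i x) = iexp (- \<theta> x) * iexp (s * Z i x)"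
        unfolding exp_add[symmetric] by (simp_all add: algebra_simps)
      moreover have "A * ((p + q) / 2) * e = (A * (p * e) + A * (q * e)) / 2" for A p q e :: complex
        by (simp add: field_simps)
      ultimately show ?thesis by (simp only: of_real_mult)
    qed
    have sinI: "complex_of_real (I x * sin (\<theta> x)) * iexp (s * Z i x) =
        (complex_of_real (I x) * iexp (1 * \<theta> x + s * Z i x) - complex_of_real (I x) * iexp ((-1) * \<theta> x + s * Z i x)) / (2 * \<i>)" for x s
    proof -
      have "complex_of_real (sin (\<theta> x)) = (iexp (\<theta> x) - iexp (- \<theta> x)) / (2 * \<i>)"
        by (simp add: sin_exp_eq sin_of_real[symmetric])
      moreover have "iexp (1 * \<theta> x + s * Z i x) = iexp (\<theta> x) * iexp (s * Z i x)"
        "iexp ((-1) * \<theta> x + s * Z i x) = iexp (- \<theta> x) * iexp (s * Z i x)"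
        unfolding exp_add[symmetric] by (simp_all add: algebra_simps)
      moreover have "A * ((p - q) / (2 * \<i>)) * e = (A * (p * e) - A * (q * e)) / (2 * \<i>)" for A p q e :: complex
        by (simp add: field_simps)
      ultimately show ?thesis by (simp only: of_real_mult)
    qed
    have C1: "(CLINT x|M. complex_of_real (I x * cos (\<theta> x)) * iexp (s * Z i x)) = P * e * exp (- (s\<^sup>2) / 2)" for s
    proof -
      have "(CLINT x|M. complex_of_real (I x) * iexp (1 * \<theta> x + s * Z i x) + complex_of_real (I x) * iexp ((-1) * \<theta> x + s * Z i x))
        = complex_of_real (P * e * exp (- (s\<^sup>2) / 2)) + complex_of_real (P * e * exp (- (s\<^sup>2) / 2))"
        (is "?L = _")
      proof -
        have "?L = (CLINT x|M. complex_of_real (I x) * iexp (1 * \<theta> x + s * Z i x)) +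
            (CLINT x|M. complex_of_real (I x) * iexp ((-1) * \<theta> x + s * Z i x))"
          by (rule Bochner_Integration.integral_add[OF int int]) measurable
        then show ?thesis
          unfolding A1[OF disjI1[OF refl]] A1[OF disjI2[OF refl]] .
      qed
      then show ?thesis unfolding cosI integral_divide_zero by simp
    qed
    have S1: "(CLINT x|M. complex_of_real (I x * sin (\<theta> x)) * iexp (s * Z i x)) = 0" for s
    proof -
      have "(CLINT x|M. complex_of_real (I x) * iexp (1 * \<theta> x + s * Z i x) - complex_of_real (I x) * iexp ((-1) * \<theta> x + s * Z i x))
        = complex_of_real (P * e * exp (- (s\<^sup>2) / 2)) - complex_of_real (P * e * exp (- (s\<^sup>2) / 2))"
        (is "?L = _")
      proof -
        have "?L = (CLINT x|M. complex_of_real (I x) * iexp (1 * \<theta> x + s * Z i x)) -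
            (CLINT x|M. complex_of_real (I x) * iexp ((-1) * \<theta> x + s * Z i x))"
          by (rule Bochner_Integration.integral_diff[OF int int]) measurable
        then show ?thesis
          unfolding A1[OF disjI1[OF refl]] A1[OF disjI2[OF refl]] .
      qed
      then show ?thesis unfolding sinI integral_divide_zero by simp
    qed
    have toR: "expectation g = Re (CLINT x|M. complex_of_real (g x) * iexp (0 * Z i x))" for g
      by simp
    have R: "expectation I = P" "expectation (\<lambda>x. I x * cos (\<theta> x)) = P * e" "expectation (\<lambda>x. I x * sin (\<theta> x)) = 0"
      unfolding toR A0 C1 S1 by simp_all
    have iE: "integrable M (\<lambda>x. complex_of_real (I x * g x) * iexp (s * Z i x))"
      if [measurable]: "g \<in> borel_measurable M" "\<And>x. \<bar>g x\<bar> \<le> 1" for g s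
      by (rule integrable_const_bound[where B=1]) (use I01 that in \<open>auto simp: norm_mult abs_mult intro!: mult_le_one\<close>)
    note [simp] = abs_cos_le_one abs_sin_le_one
    \<comment> \<open>\<open>weighted_std_normalI\<close> asks for a nonnegative weight. Cosine and
      sine therefore enter through \<open>I + I * g\<close> with |g| \<le> 1, and the part
      \<open>I\<close> is subtracted afterwards.\<close>
    have w: "expectation (\<lambda>x. (I x + I x * g x) * indicator (E i) (Z i x)) = (P + expectation (\<lambda>x. I x * g x)) * measure std_normal (E i)"
      if [measurable]: "g \<in> borel_measurable M" and g: "\<And>x. \<bar>g x\<bar> \<le> 1"
       and ch: "\<And>s. (CLINT x|M. complex_of_real (I x * g x) * iexp (s * Z i x)) = expectation (\<lambda>x. I x * g x) * exp (- (s\<^sup>2) / 2)"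
       for g
    proof -
      have gb: "- 1 \<le> g x" "g x \<le> 1" for x using g[of x] by auto
      have EE: "expectation (\<lambda>x. I x + I x * g x) = P + expectation (\<lambda>x. I x * g x)"
        using intr[of "\<lambda>_. 1"] intr[of g] g R by simp
      have "expectation (\<lambda>x. (I x + I x * g x) * indicator (E i) (Z i x)) = expectation (\<lambda>x. I x + I x * g x) * measure std_normal (E i)"
      proof (rule weighted_std_normalI[where B=2])
        fix x
        have "I x + I x * g x = I x * (1 + g x)" by (simp add: algebra_simps)
        moreover have "0 \<le> I x * (1 + g x)" using I01[of x] gb[of x] by simp
        moreover have "I x * (1 + g x) \<le> 1 * 2" using I01[of x] gb[of x] by (intro mult_mono) auto
        ultimately show "0 \<le> I x + I x * g x" "I x + I x * g x \<le> 2" by auto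
      next
        fix s
        have "(CLINT x|M. complex_of_real (I x + I x * g x) * iexp (s * Z i x)) =
          (CLINT x|M. complex_of_real (I x) * iexp (s * Z i x) + complex_of_real (I x * g x) * iexp (s * Z i x))"
          by (intro Bochner_Integration.integral_cong) (auto simp: algebra_simps)
        also have "\<dots> = complex_of_real (P * exp (- (s\<^sup>2) / 2)) + complex_of_real (expectation (\<lambda>x. I x * g x) * exp (- (s\<^sup>2) / 2))"
          unfolding A0[symmetric] ch[symmetric]
          by (rule Bochner_Integration.integral_add[OF int iE]) (use g in measurable)
        finally show "(CLINT x|M. complex_of_real (I x + I x * g x) * iexp (s * Z i x)) =
           complex_of_real (expectation (\<lambda>x. I x + I x * g x)) * exp (- (s\<^sup>2) / 2)"
          by (simp add: EE algebra_simps)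
      qed auto
      then show ?thesis by (simp add: EE)
    qed
    define \<mu> where "\<mu> = measure std_normal (E i)"
    let ?J = "\<lambda>x. indicator (E i) (Z i x) :: real"
    have w0: "expectation (\<lambda>x. I x * ?J x) = P * \<mu>"
      using w[of "\<lambda>_. 0"] by (simp add: \<mu>_def)
    have iJ: "integrable M (\<lambda>x. I x * g x * ?J x)" if [measurable]: "g \<in> borel_measurable M" "\<And>x. \<bar>g x\<bar> \<le> 1" for g
      using intr[of "\<lambda>x. g x * ?J x"] that by (simp add: mult.assoc abs_mult indicator_def)
    have sub: "expectation (\<lambda>x. I x * g x * ?J x) = expectation (\<lambda>x. (I x + I x * g x) * ?J x) - P * \<mu>"
      if "g \<in> borel_measurable M" "\<And>x. \<bar>g x\<bar> \<le> 1" for g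
      using iJ[of g] iJ[of "\<lambda>_. 1"] that w0 by (simp add: algebra_simps)
    have wc: "expectation (\<lambda>x. I x * cos (\<theta> x) * ?J x) = P * e * \<mu>"
      using w[of "\<lambda>x. cos (\<theta> x)"] C1 R by (subst sub) (auto simp: \<mu>_def algebra_simps)
    have ws: "expectation (\<lambda>x. I x * sin (\<theta> x) * ?J x) = 0"
      using w[of "\<lambda>x. sin (\<theta> x)"] S1 R by (subst sub) (auto simp: \<mu>_def algebra_simps)
    have "(CLINT x|M. complex_of_real (\<Prod>j\<in>insert i B1. indicator (E j) (Z j x)) * iexp (\<Sum>j\<in>B2. t j * Z j x))
      = (CLINT x|M. complex_of_real (I x * cos (\<theta> x) * ?J x) + \<i> * complex_of_real (I x * sin (\<theta> x) * ?J x))"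
      using insert by (intro Bochner_Integration.integral_cong)
        (auto simp: I_def \<theta>_def[symmetric] cis_conv_exp[symmetric] complex_eq_iff)
    also have "\<dots> = P * e * \<mu>"
      using iJ[of "\<lambda>x. cos (\<theta> x)"] iJ[of "\<lambda>x. sin (\<theta> x)"]
      by (subst Bochner_Integration.integral_add) (auto simp: wc ws simp del: of_real_mult)
    finally show ?case using insert by (simp add: P_def e_def \<mu>_def)
  qed
qed

section \<open>Standard Gaussian vectors and their linear images\<close>

definition gaussian :: "'i set \<Rightarrow> ('i \<Rightarrow> real) measure" where
  "gaussian A = PiM A (\<lambda>_. std_normal)"

lemma sets_gaussian [measurable_cong]: "sets (gaussian A) = sets (PiM A (\<lambda>_. borel))"
  unfolding gaussian_def by (intro sets_PiM_cong) auto

lemma prob_space_gaussian: "prob_space (gaussian A)"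
  unfolding gaussian_def by (intro prob_space_PiM prob_space_normal_density) auto

text \<open>Boxes are tested with every coordinate of \<open>B\<close> in the event part of
  \<open>iid_std_normal_prob\<close>; equality on boxes fixes the product measure.\<close>

lemma (in prob_space) distr_eq_gaussianI:
  fixes Z :: "'i \<Rightarrow> 'a \<Rightarrow> real"
  assumes Z[measurable]: "\<And>j. j \<in> B \<Longrightarrow> Z j \<in> borel_measurable M" and B: "finite B"
    and char: "\<And>t. (CLINT x|M. iexp (\<Sum>j\<in>B. t j * Z j x)) = exp (- (\<Sum>j\<in>B. (t j)\<^sup>2) / 2)"
  shows "distr M (gaussian B) (\<lambda>x. \<lambda>j\<in>B. Z j x) = gaussian B"
  unfolding gaussian_def
proof -
  interpret N: prob_space std_normal by (rule prob_space_normal_density) simp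
  interpret P: product_prob_space "\<lambda>_. std_normal" B
    by unfold_locales
  show "distr M (Pi\<^sub>M B (\<lambda>_. std_normal)) (\<lambda>x. \<lambda>j\<in>B. Z j x) = Pi\<^sub>M B (\<lambda>_. std_normal)"
  proof (rule P.PiM_eqI)
    fix E assume E: "\<And>i. i \<in> B \<Longrightarrow> E i \<in> sets std_normal"
    then have E'[measurable]: "\<And>i. i \<in> B \<Longrightarrow> E i \<in> sets borel" by simp
    have m: "(\<lambda>x. \<lambda>j\<in>B. Z j x) \<in> measurable M (Pi\<^sub>M B (\<lambda>_. std_normal))"
      by (intro measurable_restrict) auto
    define A where "A = (\<lambda>x. \<lambda>j\<in>B. Z j x) -` Pi\<^sub>E B E \<inter> space M"
    have AM: "A \<in> sets M"
      unfolding A_def using m E B by (intro measurable_sets[OF m] sets_PiM_I_finite) auto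
    have A: "indicator A x = (\<Prod>j\<in>B. indicator (E j) (Z j x) :: real)" if "x \<in> space M" for x
      using that B by (auto simp: A_def indicator_def PiE_iff prod_zero_iff)
    have "complex_of_real (prob A) = (CLINT x|M. complex_of_real (indicator A x))"
      using AM by (simp add: measure_def)
    also have "\<dots> = (CLINT x|M. complex_of_real (\<Prod>j\<in>B. indicator (E j) (Z j x)) * iexp (\<Sum>j\<in>{}. 0 * Z j x))"
      by (intro Bochner_Integration.integral_cong) (auto simp: A)
    also have "\<dots> = (\<Prod>j\<in>B. measure std_normal (E j))"
      by (subst iid_std_normal_prob[OF Z B char]) auto
    finally have "prob A = (\<Prod>j\<in>B. measure std_normal (E j))"
      using of_real_eq_iff by blast
    then show "emeasure (distr M (Pi\<^sub>M B (\<lambda>_. std_normal)) (\<lambda>x. \<lambda>j\<in>B. Z j x)) (Pi\<^sub>E B E) = (\<Prod>i\<in>B. emeasure std_normal (E i))"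
      using E B m by (subst emeasure_distr)
       (auto simp: A_def[symmetric] emeasure_eq_measure N.emeasure_eq_measure prod_ennreal intro!: sets_PiM_I_finite)
  qed (use B in auto)
qed

lemma char_gaussian:
  assumes "finite A"
  shows "(CLINT x|gaussian A. iexp (\<Sum>i\<in>A. c i * x i)) = exp (- (\<Sum>i\<in>A. (c i)\<^sup>2) / 2)"
proof -
  interpret N: prob_space std_normal by (rule prob_space_normal_density) simp
  interpret P: product_prob_space "\<lambda>_. std_normal" A
    by unfold_locales
  have 1: "iexp (\<Sum>i\<in>A. c i * x i) = (\<Prod>i\<in>A. iexp (c i * x i))" for x
    using assms by (simp add: exp_sum sum_distrib_left)
  have 2: "(CLINT y|std_normal. iexp (r * y)) = exp (- (r\<^sup>2) / 2)" for r
    using char_std_normal_distribution by (simp add: char_def fun_eq_iff)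
  have "(CLINT x|gaussian A. (\<Prod>i\<in>A. iexp (c i * x i))) = (\<Prod>i\<in>A. CLINT y|std_normal. iexp (c i * y))"
    unfolding gaussian_def
    by (rule P.product_integral_prod[OF assms]) (auto intro!: N.integrable_const_bound[where B=1])
  also have "\<dots> = exp (- (\<Sum>i\<in>A. (c i)\<^sup>2) / 2)"
    unfolding 2 using assms by (simp add: exp_sum[symmetric] sum_negf sum_divide_distrib exp_of_real[symmetric] del: exp_of_real)
  finally show ?thesis unfolding 1 .
qed

text \<open>Orthonormal rows preserve the quadratic form in the characteristic function. The
  two-block shape serves the later uses: a field with a fresh increment, and a tensor with one
  radial normal.\<close>

lemma gaussian_pair_linear:
  fixes A :: "'i set" and C :: "'k set" and B :: "'j set"
  assumes fin: "finite A" "finite C" "finite B"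
    and orth: "\<And>j l. j \<in> B \<Longrightarrow> l \<in> B \<Longrightarrow>
      (\<Sum>i\<in>A. L j i * L l i) + (\<Sum>c\<in>C. R j c * R l c) = (if j = l then 1 else 0)"
  shows "distr (gaussian A \<Otimes>\<^sub>M gaussian C) (gaussian B)
    (\<lambda>x. \<lambda>j\<in>B. (\<Sum>i\<in>A. L j i * fst x i) + (\<Sum>c\<in>C. R j c * snd x c)) = gaussian B"
proof -
  interpret A: prob_space "gaussian A" by (rule prob_space_gaussian)
  interpret C: prob_space "gaussian C" by (rule prob_space_gaussian)
  interpret pair_prob_space "gaussian A" "gaussian C" ..
  have mA: "(\<lambda>x. fst x i) \<in> borel_measurable (gaussian A \<Otimes>\<^sub>M gaussian C)" if "i \<in> A" for i
  proof -
    have [measurable]: "(\<lambda>x. x i) \<in> borel_measurable (gaussian A)"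
      unfolding measurable_cong_sets[OF sets_gaussian refl] using that by measurable
    show ?thesis by measurable
  qed
  have mC: "(\<lambda>x. snd x i) \<in> borel_measurable (gaussian A \<Otimes>\<^sub>M gaussian C)" if "i \<in> C" for i
  proof -
    have [measurable]: "(\<lambda>x. x i) \<in> borel_measurable (gaussian C)"
      unfolding measurable_cong_sets[OF sets_gaussian refl] using that by measurable
    show ?thesis by measurable
  qed
  have m: "(\<lambda>x. (\<Sum>i\<in>A. L' i * fst x i) + (\<Sum>c\<in>C. R' c * snd x c)) \<in> borel_measurable (gaussian A \<Otimes>\<^sub>M gaussian C)" for L' R'
    using mA mC by (intro borel_measurable_add borel_measurable_sum borel_measurable_times) auto
  show ?thesis
  proof (rule distr_eq_gaussianI)
    fix t :: "'j \<Rightarrow> real"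
    define a where "a i = (\<Sum>j\<in>B. t j * L j i)" for i
    define c where "c k = (\<Sum>j\<in>B. t j * R j k)" for k
    have eq: "(\<Sum>j\<in>B. t j * ((\<Sum>i\<in>A. L j i * fst x i) + (\<Sum>c\<in>C. R j c * snd x c)))
       = (\<Sum>i\<in>A. a i * fst x i) + (\<Sum>k\<in>C. c k * snd x k)" for x
    proof -
      have "(\<Sum>j\<in>B. t j * (\<Sum>i\<in>A. L j i * fst x i)) = (\<Sum>i\<in>A. a i * fst x i)"
        unfolding a_def sum_distrib_left sum_distrib_right by (subst sum.swap) (simp add: mult.assoc)
      moreover have "(\<Sum>j\<in>B. t j * (\<Sum>i\<in>C. R j i * snd x i)) = (\<Sum>i\<in>C. c i * snd x i)"
        unfolding c_def sum_distrib_left sum_distrib_right by (subst sum.swap) (simp add: mult.assoc)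
      ultimately show ?thesis by (simp add: distrib_left sum.distrib)
    qed
    have sq: "(\<Sum>i\<in>A. (a i)\<^sup>2) + (\<Sum>k\<in>C. (c k)\<^sup>2) = (\<Sum>j\<in>B. (t j)\<^sup>2)"
    proof -
      have "(\<Sum>i\<in>A. (a i)\<^sup>2) = (\<Sum>i\<in>A. \<Sum>j\<in>B. \<Sum>l\<in>B. t j * t l * (L j i * L l i))"
        unfolding a_def power2_eq_square sum_product by (simp add: mult_ac)
      also have "\<dots> = (\<Sum>j\<in>B. \<Sum>l\<in>B. t j * t l * (\<Sum>i\<in>A. L j i * L l i))"
        unfolding sum_distrib_left by (subst sum.swap, intro sum.cong refl, rule sum.swap)
      finally have 1: "(\<Sum>i\<in>A. (a i)\<^sup>2) = (\<Sum>j\<in>B. \<Sum>l\<in>B. t j * t l * (\<Sum>i\<in>A. L j i * L l i))" .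
      have "(\<Sum>i\<in>C. (c i)\<^sup>2) = (\<Sum>i\<in>C. \<Sum>j\<in>B. \<Sum>l\<in>B. t j * t l * (R j i * R l i))"
        unfolding c_def power2_eq_square sum_product by (simp add: mult_ac)
      also have "\<dots> = (\<Sum>j\<in>B. \<Sum>l\<in>B. t j * t l * (\<Sum>i\<in>C. R j i * R l i))"
        unfolding sum_distrib_left by (subst sum.swap, intro sum.cong refl, rule sum.swap)
      finally have 2: "(\<Sum>i\<in>C. (c i)\<^sup>2) = (\<Sum>j\<in>B. \<Sum>l\<in>B. t j * t l * (\<Sum>i\<in>C. R j i * R l i))" .
      have "(\<Sum>i\<in>A. (a i)\<^sup>2) + (\<Sum>k\<in>C. (c k)\<^sup>2) =
         (\<Sum>j\<in>B. \<Sum>l\<in>B. t j * t l * ((\<Sum>i\<in>A. L j i * L l i) + (\<Sum>i\<in>C. R j i * R l i)))"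
        unfolding 1 2 by (simp add: sum.distrib distrib_left)
      also have "\<dots> = (\<Sum>j\<in>B. \<Sum>l\<in>B. if j = l then t j * t l else 0)"
        by (intro sum.cong refl) (simp add: orth)
      also have "\<dots> = (\<Sum>j\<in>B. (t j)\<^sup>2)"
        using fin by (simp add: sum.delta power2_eq_square)
      finally show ?thesis .
    qed
    let ?f = "\<lambda>x y. iexp ((\<Sum>i\<in>A. a i * x i) + (\<Sum>k\<in>C. c k * y k))"
    have "integrable (gaussian A \<Otimes>\<^sub>M gaussian C) (\<lambda>x. iexp ((\<Sum>i\<in>A. a i * fst x i) + (\<Sum>k\<in>C. c k * snd x k)))"
    proof (rule integrable_const_bound[where B=1])
      note [measurable] = m[of a c]
      show "(\<lambda>x. iexp ((\<Sum>i\<in>A. a i * fst x i) + (\<Sum>k\<in>C. c k * snd x k))) \<in> borel_measurable (gaussian A \<Otimes>\<^sub>M gaussian C)"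
        by measurable
    qed simp
    then have "(CLINT x|gaussian A \<Otimes>\<^sub>M gaussian C. iexp ((\<Sum>i\<in>A. a i * fst x i) + (\<Sum>k\<in>C. c k * snd x k)))
      = (CLINT x|gaussian A. CLINT y|gaussian C. ?f x y)"
      by (subst integral_fst'[symmetric]) (auto simp: case_prod_beta)
    also have "\<dots> = (CLINT x|gaussian A. CLINT y|gaussian C. iexp (\<Sum>i\<in>A. a i * x i) * iexp (\<Sum>k\<in>C. c k * y k))"
      by (simp add: exp_add distrib_left)
    also have "\<dots> = exp (- (\<Sum>i\<in>A. (a i)\<^sup>2) / 2) * exp (- (\<Sum>k\<in>C. (c k)\<^sup>2) / 2)"
      by (simp only: integral_mult_right_zero integral_mult_left_zero char_gaussian[OF fin(1)] char_gaussian[OF fin(2)] of_real_mult)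
    also have "\<dots> = complex_of_real (exp (- (\<Sum>j\<in>B. (t j)\<^sup>2) / 2))"
      unfolding sq[symmetric] exp_add[symmetric] by (simp add: add_divide_distrib)
    finally show "(CLINT x|gaussian A \<Otimes>\<^sub>M gaussian C. iexp (\<Sum>j\<in>B. t j * ((\<Sum>i\<in>A. L j i * fst x i) + (\<Sum>c\<in>C. R j c * snd x c))))
      = complex_of_real (exp (- (\<Sum>j\<in>B. (t j)\<^sup>2) / 2))"
      unfolding eq .
  qed (use m fin in auto)
qed

lemma gaussian_uminus:
  assumes "finite A"
  shows "distr (gaussian A) (gaussian A) (\<lambda>x. \<lambda>j\<in>A. - x j) = gaussian A"
proof -
  interpret prob_space "gaussian A" by (rule prob_space_gaussian)
  have "(CLINT x|gaussian A. iexp (\<Sum>j\<in>A. t j * (- x j))) = complex_of_real (exp (- (\<Sum>j\<in>A. (t j)\<^sup>2) / 2))" for t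
    using char_gaussian[OF assms, of "\<lambda>j. - t j"] by simp
  then show ?thesis
    using assms by (intro distr_eq_gaussianI) (auto simp: measurable_cong_sets[OF sets_gaussian refl])
qed

section \<open>Exponential moments and tail bounds\<close>

lemma std_normal_exp_moment:
  "integrable std_normal (\<lambda>y. exp (r * y))" "(\<integral>y. exp (r * y) \<partial>std_normal) = exp (r\<^sup>2 / 2)"
proof -
  have eq: "std_normal_density y * exp (r * y) = exp (r\<^sup>2 / 2) * normal_density r 1 y" for y
    by (simp add: normal_density_def exp_add[symmetric] power2_eq_square field_simps)
  show "integrable std_normal (\<lambda>y. exp (r * y))"
    by (subst integrable_density) (auto simp: eq)
  show "(\<integral>y. exp (r * y) \<partial>std_normal) = exp (r\<^sup>2 / 2)"
    by (subst integral_density) (auto simp: eq integral_normal_density)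
qed

lemma std_normal_exp_square_moment:
  fixes s :: real
  assumes "s < 1 / 2"
  shows "integrable std_normal (\<lambda>y. exp (s * y\<^sup>2))"
    "(\<integral>y. exp (s * y\<^sup>2) \<partial>std_normal) = 1 / sqrt (1 - 2 * s)"
proof -
  \<comment> \<open>Multiplying the standard density by exp(s y^2) leaves \<sigma> times the density
    of a centred normal with this standard deviation.\<close>
  define \<sigma> where "\<sigma> = 1 / sqrt (1 - 2 * s)"
  have \<sigma>: "\<sigma> > 0" "\<sigma>\<^sup>2 = 1 / (1 - 2 * s)" using assms by (auto simp: \<sigma>_def power_divide)
  have eq: "std_normal_density y * exp (s * y\<^sup>2) = \<sigma> * normal_density 0 \<sigma> y" for y
  proof -
    have "- (y\<^sup>2) / 2 + s * y\<^sup>2 = - (y\<^sup>2) / (2 * \<sigma>\<^sup>2)"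
      unfolding \<sigma> using assms by (simp add: field_simps)
    moreover have "1 / sqrt (2 * pi) = \<sigma> * (1 / sqrt (2 * pi * \<sigma>\<^sup>2))"
      using \<sigma>(1) by (simp add: real_sqrt_mult)
    moreover have "std_normal_density y * exp (s * y\<^sup>2) = 1 / sqrt (2 * pi) * exp (- (y\<^sup>2) / 2 + s * y\<^sup>2)"
      unfolding exp_add by (simp add: std_normal_density_def)
    ultimately show ?thesis
      by (simp only: normal_density_def diff_0_right mult.assoc)
  qed
  show "integrable std_normal (\<lambda>y. exp (s * y\<^sup>2))"
    using \<sigma> by (subst integrable_density) (auto simp: eq)
  show "(\<integral>y. exp (s * y\<^sup>2) \<partial>std_normal) = 1 / sqrt (1 - 2 * s)"
    using \<sigma>(1) by (subst integral_density) (auto simp: eq integral_normal_density \<sigma>_def)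
qed

lemma gaussian_prod_expectation:
  assumes "finite A" "\<And>i. i \<in> A \<Longrightarrow> integrable std_normal (f i :: real \<Rightarrow> real)"
  shows "integrable (gaussian A) (\<lambda>x. \<Prod>i\<in>A. f i (x i))"
    "(\<integral>x. (\<Prod>i\<in>A. f i (x i)) \<partial>gaussian A) = (\<Prod>i\<in>A. \<integral>y. f i y \<partial>std_normal)"
proof -
  interpret N: prob_space std_normal by (rule prob_space_normal_density) simp
  interpret P: product_prob_space "\<lambda>_. std_normal" A
    by unfold_locales
  show "integrable (gaussian A) (\<lambda>x. \<Prod>i\<in>A. f i (x i))"
    unfolding gaussian_def by (rule P.product_integrable_prod) (use assms in auto)
  show "(\<integral>x. (\<Prod>i\<in>A. f i (x i)) \<partial>gaussian A) = (\<Prod>i\<in>A. \<integral>y. f i y \<partial>std_normal)"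
    unfolding gaussian_def by (rule P.product_integral_prod) (use assms in auto)
qed

lemma measurable_gaussian_component [measurable]:
  "i \<in> A \<Longrightarrow> (\<lambda>x. x i) \<in> borel_measurable (gaussian A)"
  unfolding measurable_cong_sets[OF sets_gaussian refl] by (rule measurable_component_singleton)

lemma (in prob_space) exp_Markov:
  fixes X :: "'a \<Rightarrow> real"
  assumes "integrable M (\<lambda>x. exp (X x))"
    and [measurable]: "X \<in> borel_measurable M"
  shows "prob {x \<in> space M. a \<le> X x} \<le> expectation (\<lambda>x. exp (X x)) / exp a"
proof -
  have "prob {x \<in> space M. exp a \<le> exp (X x)} \<le> expectation (\<lambda>x. exp (X x)) / exp a"
    using assms(1) by (intro integral_Markov_inequality_measure[where A="space M"]) simp_all
  then show ?thesis by simp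
qed

lemma gaussian_linear_upper_tail:
  assumes A: "finite A" and c: "(\<Sum>i\<in>A. (c i)\<^sup>2) \<le> v" "0 < v" and "0 \<le> t"
  shows "measure (gaussian A) {x \<in> space (gaussian A). t \<le> (\<Sum>i\<in>A. c i * x i)} \<le> exp (- (t\<^sup>2) / (2 * v))"
proof -
  interpret prob_space "gaussian A" by (rule prob_space_gaussian)
  \<comment> \<open>The Chernoff parameter that minimises \<theta>^2 v / 2 - \<theta> t.\<close>
  define \<theta> where "\<theta> = t / v"
  have e: "exp (\<theta> * (\<Sum>i\<in>A. c i * x i)) = (\<Prod>i\<in>A. exp ((\<theta> * c i) * x i))" for x
    using A by (simp add: exp_sum[symmetric] sum_distrib_left mult.assoc)
  have [measurable]: "(\<lambda>x. \<theta> * (\<Sum>i\<in>A. c i * x i)) \<in> borel_measurable (gaussian A)"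
    by (intro borel_measurable_times borel_measurable_sum) auto
  have "(\<integral>x. exp (\<theta> * (\<Sum>i\<in>A. c i * x i)) \<partial>gaussian A) = (\<Prod>i\<in>A. exp ((\<theta> * c i)\<^sup>2 / 2))"
    unfolding e using std_normal_exp_moment A by (subst gaussian_prod_expectation(2)) auto
  also have "\<dots> = exp (\<theta>\<^sup>2 * (\<Sum>i\<in>A. (c i)\<^sup>2) / 2)"
    using A by (simp add: exp_sum[symmetric] power_mult_distrib sum_distrib_left sum_divide_distrib)
  also have "\<dots> \<le> exp (\<theta>\<^sup>2 * v / 2)"
    using c by (auto intro!: mult_left_mono)
  finally have m: "(\<integral>x. exp (\<theta> * (\<Sum>i\<in>A. c i * x i)) \<partial>gaussian A) \<le> exp (\<theta>\<^sup>2 * v / 2)" .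
  have "measure (gaussian A) {x \<in> space (gaussian A). t \<le> (\<Sum>i\<in>A. c i * x i)}
     \<le> measure (gaussian A) {x \<in> space (gaussian A). \<theta> * t \<le> \<theta> * (\<Sum>i\<in>A. c i * x i)}"
    using assms by (intro finite_measure_mono) (auto simp: \<theta>_def intro!: mult_left_mono divide_right_mono)
  also have "\<dots> \<le> (\<integral>x. exp (\<theta> * (\<Sum>i\<in>A. c i * x i)) \<partial>gaussian A) / exp (\<theta> * t)"
    by (rule exp_Markov) (auto simp: e intro!: gaussian_prod_expectation std_normal_exp_moment A)
  also have "\<dots> \<le> exp (\<theta>\<^sup>2 * v / 2) / exp (\<theta> * t)"
    using m by (intro divide_right_mono) auto
  also have "\<dots> = exp (- (t\<^sup>2) / (2 * v))"
  proof -
    have "\<theta>\<^sup>2 * v / 2 - \<theta> * t = - (t\<^sup>2) / (2 * v)"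
      using c by (simp add: \<theta>_def power2_eq_square field_simps)
    then show ?thesis by (simp only: exp_diff[symmetric])
  qed
  finally show ?thesis .
qed

lemma gaussian_linear_tail:
  assumes A: "finite A" and c: "(\<Sum>i\<in>A. (c i)\<^sup>2) \<le> v" "0 < v" and "0 \<le> t"
  shows "measure (gaussian A) {x \<in> space (gaussian A). t \<le> \<bar>\<Sum>i\<in>A. c i * x i\<bar>} \<le> 2 * exp (- (t\<^sup>2) / (2 * v))"
proof -
  interpret prob_space "gaussian A" by (rule prob_space_gaussian)
  have [measurable]: "(\<lambda>x. (\<Sum>i\<in>A. d i * x i)) \<in> borel_measurable (gaussian A)" for d
    by (intro borel_measurable_times borel_measurable_sum) auto
  have "measure (gaussian A) {x \<in> space (gaussian A). t \<le> \<bar>\<Sum>i\<in>A. c i * x i\<bar>}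
    \<le> measure (gaussian A) ({x \<in> space (gaussian A). t \<le> (\<Sum>i\<in>A. c i * x i)} \<union> {x \<in> space (gaussian A). t \<le> (\<Sum>i\<in>A. (- c i) * x i)})"
    by (intro finite_measure_mono) (auto simp: sum_negf)
  also have "\<dots> \<le> measure (gaussian A) {x \<in> space (gaussian A). t \<le> (\<Sum>i\<in>A. c i * x i)}
     + measure (gaussian A) {x \<in> space (gaussian A). t \<le> (\<Sum>i\<in>A. (- c i) * x i)}"
    by (rule measure_Un_le) measurable
  also have "\<dots> \<le> exp (- (t\<^sup>2) / (2 * v)) + exp (- (t\<^sup>2) / (2 * v))"
    using assms by (intro add_mono gaussian_linear_upper_tail) auto
  finally show ?thesis by simp
qed

text \<open>Chernoff's bound for both signs \<epsilon>. What matters is that \<rho> depends on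
  \<delta> only, so the bound is geometric in the dimension.\<close>

lemma gaussian_square_tail:
  fixes \<delta> :: real
  assumes "0 < \<delta>"
  shows "\<exists>\<rho>. 0 \<le> \<rho> \<and> \<rho> < 1 \<and> (\<forall>A :: 'i set. finite A \<longrightarrow>
    measure (gaussian A) {x \<in> space (gaussian A). \<delta> * card A \<le> \<bar>(\<Sum>i\<in>A. (x i)\<^sup>2) - card A\<bar>} \<le> 2 * \<rho> ^ card A)"
proof -
  have one: "\<exists>\<rho>. 0 \<le> \<rho> \<and> \<rho> < 1 \<and> (\<forall>A :: 'i set. finite A \<longrightarrow>
    measure (gaussian A) {x \<in> space (gaussian A). \<delta> * card A \<le> \<epsilon> * ((\<Sum>i\<in>A. (x i)\<^sup>2) - card A)} \<le> \<rho> ^ card A)"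
    if \<epsilon>: "\<epsilon> = 1 \<or> \<epsilon> = -1" for \<epsilon> :: real
  proof -
    \<comment> \<open>The Chernoff factor of a single coordinate. It equals 1 at 0 and has slope
      -\<delta> there, hence drops below 1 for small positive s.\<close>
    define \<phi> where "\<phi> s = exp (- s * (\<epsilon> + \<delta>)) / sqrt (1 - 2 * (\<epsilon> * s))" for s :: real
    have "(\<phi> has_real_derivative - \<delta>) (at 0)"
      unfolding \<phi>_def by (auto intro!: derivative_eq_intros simp: divide_simps)
    then obtain d where d: "d > 0" "\<And>h. 0 < h \<Longrightarrow> h < d \<Longrightarrow> \<phi> (0 + h) < \<phi> 0"
      using has_real_derivative_neg_dec_right[of \<phi> "-\<delta>" 0 UNIV] assms by auto
    \<comment> \<open>The cap 1/4 keeps \<epsilon> s below 1/2, where the exponential moment of the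
      square is finite.\<close>
    define s where "s = min (d / 2) (1 / 4)"
    have s: "0 < s" "s < d" "s < 1 / 2" using d by (auto simp: s_def)
    have es: "\<epsilon> * s < 1 / 2" using \<epsilon> s by auto
    have "\<phi> s < 1" using d(2)[of s] s by (simp add: \<phi>_def)
    moreover have "0 \<le> \<phi> s" using es by (simp add: \<phi>_def)
    moreover have "measure (gaussian A) {x \<in> space (gaussian A). \<delta> * card A \<le> \<epsilon> * ((\<Sum>i\<in>A. (x i)\<^sup>2) - card A)} \<le> \<phi> s ^ card A"
      if A: "finite A" for A :: "'i set"
    proof -
      interpret prob_space "gaussian A" by (rule prob_space_gaussian)
      have e: "exp ((s * \<epsilon>) * (\<Sum>i\<in>A. (x i)\<^sup>2)) = (\<Prod>i\<in>A. exp ((\<epsilon> * s) * (x i)\<^sup>2))" for x :: "'i \<Rightarrow> real"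
        using A by (simp add: exp_sum[symmetric] sum_distrib_left mult.assoc mult.commute)
      have [measurable]: "(\<lambda>x. (s * \<epsilon>) * (\<Sum>i\<in>A. (x i)\<^sup>2)) \<in> borel_measurable (gaussian A)"
        by (intro borel_measurable_times borel_measurable_sum borel_measurable_power) auto
      have m: "(\<integral>x. exp ((s * \<epsilon>) * (\<Sum>i\<in>A. (x i)\<^sup>2)) \<partial>gaussian A) = (1 / sqrt (1 - 2 * (\<epsilon> * s))) ^ card A"
        unfolding e using std_normal_exp_square_moment[OF es] A by (subst gaussian_prod_expectation(2)) auto
      have "measure (gaussian A) {x \<in> space (gaussian A). \<delta> * card A \<le> \<epsilon> * ((\<Sum>i\<in>A. (x i)\<^sup>2) - card A)}
        \<le> measure (gaussian A) {x \<in> space (gaussian A). s * (\<epsilon> + \<delta>) * card A \<le> (s * \<epsilon>) * (\<Sum>i\<in>A. (x i)\<^sup>2)}"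
      proof (intro finite_measure_mono)
        have "s * (\<epsilon> + \<delta>) * card A \<le> (s * \<epsilon>) * (\<Sum>i\<in>A. (x i)\<^sup>2)"
          if "\<delta> * card A \<le> \<epsilon> * ((\<Sum>i\<in>A. (x i)\<^sup>2) - card A)" for x :: "'i \<Rightarrow> real"
        proof -
          have "s * (\<delta> * card A) \<le> s * (\<epsilon> * ((\<Sum>i\<in>A. (x i)\<^sup>2) - card A))"
            using that s by (intro mult_left_mono) auto
          then show ?thesis by (simp add: algebra_simps)
        qed
        then show "{x \<in> space (gaussian A). \<delta> * card A \<le> \<epsilon> * ((\<Sum>i\<in>A. (x i)\<^sup>2) - card A)}
          \<subseteq> {x \<in> space (gaussian A). s * (\<epsilon> + \<delta>) * card A \<le> (s * \<epsilon>) * (\<Sum>i\<in>A. (x i)\<^sup>2)}" by auto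
      qed measurable
      also have "\<dots> \<le> (\<integral>x. exp ((s * \<epsilon>) * (\<Sum>i\<in>A. (x i)\<^sup>2)) \<partial>gaussian A) / exp (s * (\<epsilon> + \<delta>) * card A)"
        by (rule exp_Markov) (auto simp: e intro!: gaussian_prod_expectation std_normal_exp_square_moment es A)
      also have "\<dots> = \<phi> s ^ card A"
        unfolding m \<phi>_def power_divide
        by (simp add: exp_of_nat2_mult[symmetric] exp_minus divide_simps)
      finally show ?thesis .
    qed
    ultimately show ?thesis by blast
  qed
  obtain \<rho>1 where 1: "0 \<le> \<rho>1" "\<rho>1 < 1" "\<And>A :: 'i set. finite A \<Longrightarrow>
    measure (gaussian A) {x \<in> space (gaussian A). \<delta> * card A \<le> 1 * ((\<Sum>i\<in>A. (x i)\<^sup>2) - card A)} \<le> \<rho>1 ^ card A"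
    using one[of 1] by blast
  obtain \<rho>2 where 2: "0 \<le> \<rho>2" "\<rho>2 < 1" "\<And>A :: 'i set. finite A \<Longrightarrow>
    measure (gaussian A) {x \<in> space (gaussian A). \<delta> * card A \<le> (- 1) * ((\<Sum>i\<in>A. (x i)\<^sup>2) - card A)} \<le> \<rho>2 ^ card A"
    using one[of "-1"] by blast
  have "measure (gaussian A) {x \<in> space (gaussian A). \<delta> * card A \<le> \<bar>(\<Sum>i\<in>A. (x i)\<^sup>2) - card A\<bar>} \<le> 2 * max \<rho>1 \<rho>2 ^ card A"
    if A: "finite A" for A :: "'i set"
  proof -
    interpret prob_space "gaussian A" by (rule prob_space_gaussian)
    have [measurable]: "(\<lambda>x. (\<Sum>i\<in>A. (x i)\<^sup>2)) \<in> borel_measurable (gaussian A)"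
      by (intro borel_measurable_sum borel_measurable_power) auto
    have "measure (gaussian A) {x \<in> space (gaussian A). \<delta> * card A \<le> \<bar>(\<Sum>i\<in>A. (x i)\<^sup>2) - card A\<bar>}
      \<le> measure (gaussian A) ({x \<in> space (gaussian A). \<delta> * card A \<le> 1 * ((\<Sum>i\<in>A. (x i)\<^sup>2) - card A)}
         \<union> {x \<in> space (gaussian A). \<delta> * card A \<le> (- 1) * ((\<Sum>i\<in>A. (x i)\<^sup>2) - card A)})"
      by (intro finite_measure_mono) (auto simp: abs_if)
    also have "\<dots> \<le> measure (gaussian A) {x \<in> space (gaussian A). \<delta> * card A \<le> 1 * ((\<Sum>i\<in>A. (x i)\<^sup>2) - card A)}
         + measure (gaussian A) {x \<in> space (gaussian A). \<delta> * card A \<le> (- 1) * ((\<Sum>i\<in>A. (x i)\<^sup>2) - card A)}"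
      by (rule measure_Un_le) measurable
    also have "\<dots> \<le> \<rho>1 ^ card A + \<rho>2 ^ card A" using 1 2 A by (intro add_mono) auto
    also have "\<dots> \<le> max \<rho>1 \<rho>2 ^ card A + max \<rho>1 \<rho>2 ^ card A"
      using 1 2 by (intro add_mono power_mono) auto
    finally show ?thesis by simp
  qed
  then show ?thesis using 1 2 by (intro exI[of _ "max \<rho>1 \<rho>2"]) auto
qed

section \<open>Finitely supported vectors\<close>

text \<open>One inner product space contains every R^N, as the subspace \<open>Rspace N\<close>. The
  geometric lemmas can then be proved once, for a subspace of any real inner product space.\<close>

typedef fvec = "{f :: nat \<Rightarrow> real. finite {i. f i \<noteq> 0}}" morphisms coord Fvec
  by (rule exI[of _ "\<lambda>_. 0"]) simp

setup_lifting type_definition_fvec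

lemma finite_coord: "finite {i. coord x i \<noteq> 0}"
  using coord[of x] by simp

instantiation fvec :: real_vector
begin

lift_definition zero_fvec :: fvec is "\<lambda>_. 0" by simp
lift_definition plus_fvec :: "fvec \<Rightarrow> fvec \<Rightarrow> fvec" is "\<lambda>f g i. f i + g i"
  by (erule (1) finite_subset[rotated, OF finite_UnI]) auto
lift_definition minus_fvec :: "fvec \<Rightarrow> fvec \<Rightarrow> fvec" is "\<lambda>f g i. f i - g i"
  by (erule (1) finite_subset[rotated, OF finite_UnI]) auto
lift_definition uminus_fvec :: "fvec \<Rightarrow> fvec" is "\<lambda>f i. - f i" by simp
lift_definition scaleR_fvec :: "real \<Rightarrow> fvec \<Rightarrow> fvec" is "\<lambda>c f i. c * f i"
  by (erule finite_subset[rotated]) auto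

instance
  by standard (auto simp: coord_inject[symmetric] fun_eq_iff plus_fvec.rep_eq minus_fvec.rep_eq
      uminus_fvec.rep_eq zero_fvec.rep_eq scaleR_fvec.rep_eq algebra_simps)

end

instantiation fvec :: real_inner
begin

definition inner_fvec :: "fvec \<Rightarrow> fvec \<Rightarrow> real" where
  "inner_fvec x y = (\<Sum>i | coord x i \<noteq> 0. coord x i * coord y i)"
definition norm_fvec :: "fvec \<Rightarrow> real" where
  "norm_fvec x = sqrt (inner x x)"
definition dist_fvec :: "fvec \<Rightarrow> fvec \<Rightarrow> real" where
  "dist_fvec x y = norm (x - y)"
definition sgn_fvec :: "fvec \<Rightarrow> fvec" where
  "sgn_fvec x = x /\<^sub>R norm x"
definition uniformity_fvec :: "(fvec \<times> fvec) filter" where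
  "uniformity_fvec = (INF e\<in>{0<..}. principal {(x, y). dist x y < e})"
definition open_fvec :: "fvec set \<Rightarrow> bool" where
  "open_fvec U = (\<forall>x\<in>U. eventually (\<lambda>(x', y). x' = x \<longrightarrow> y \<in> U) uniformity)"

text \<open>The sum may run over any finite set that contains the common support; this freedom makes
  symmetry and linearity in the first argument visible.\<close>

lemma inner_fvec_sum:
  assumes "finite S" "\<And>i. coord x i \<noteq> 0 \<Longrightarrow> coord y i \<noteq> 0 \<Longrightarrow> i \<in> S"
  shows "inner x y = (\<Sum>i\<in>S. coord x i * coord y i)"
proof -
  have "inner x y = (\<Sum>i\<in>S \<inter> {i. coord x i \<noteq> 0}. coord x i * coord y i)"
    unfolding inner_fvec_def using assms finite_coord[of x]
    by (intro sum.mono_neutral_right) auto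
  also have "\<dots> = (\<Sum>i\<in>S. coord x i * coord y i)"
    using assms by (intro sum.mono_neutral_left) auto
  finally show ?thesis .
qed

instance
proof
  fix x y z :: fvec and a b :: real
  show "inner x y = inner y x"
    using finite_coord[of x] by (subst (1 2) inner_fvec_sum[of "{i. coord x i \<noteq> 0}"]) (auto simp: mult.commute)
  show "inner (x + y) z = inner x z + inner y z"
    using finite_coord[of z]
    by (subst (1 2 3) inner_fvec_sum[of "{i. coord z i \<noteq> 0}"])
       (auto simp: plus_fvec.rep_eq distrib_right sum.distrib)
  show "inner (a *\<^sub>R x) y = a * inner x y"
    using finite_coord[of y]
    by (subst (1 2) inner_fvec_sum[of "{i. coord y i \<noteq> 0}"])
       (auto simp: scaleR_fvec.rep_eq sum_distrib_left mult.assoc)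
  show "0 \<le> inner x x"
    unfolding inner_fvec_def by (intro sum_nonneg) auto
  show "inner x x = 0 \<longleftrightarrow> x = 0"
    unfolding inner_fvec_def using finite_coord[of x]
    by (auto simp: sum_nonneg_eq_0_iff coord_inject[symmetric] zero_fvec.rep_eq fun_eq_iff)
qed (auto simp: norm_fvec_def dist_fvec_def sgn_fvec_def uniformity_fvec_def open_fvec_def)

end

lemmas coord_simps [simp] = plus_fvec.rep_eq minus_fvec.rep_eq uminus_fvec.rep_eq
  zero_fvec.rep_eq scaleR_fvec.rep_eq

definition Rspace :: "nat \<Rightarrow> fvec set" where
  "Rspace N = {x. \<forall>i\<ge>N. coord x i = 0}"

lemma subspace_Rspace: "subspace (Rspace N)"
  by (auto simp: subspace_def Rspace_def)

lemma inner_Rspace: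
  assumes "x \<in> Rspace N"
  shows "x \<bullet> y = (\<Sum>i<N. coord x i * coord y i)"
  by (rule inner_fvec_sum) (use assms in \<open>auto simp: Rspace_def not_less[symmetric]\<close>)

lemma norm_Rspace:
  assumes "x \<in> Rspace N"
  shows "(norm x)\<^sup>2 = (\<Sum>i<N. (coord x i)\<^sup>2)"
  using inner_Rspace[OF assms, of x] by (simp add: dot_square_norm power2_eq_square)

lemma sum_coord_le_norm:
  shows "(\<Sum>i<N. (coord x i)\<^sup>2) \<le> (norm x)\<^sup>2"
proof -
  have "x \<bullet> x = (\<Sum>i\<in>{..<N} \<union> {i. coord x i \<noteq> 0}. coord x i * coord x i)"
    using finite_coord[of x] by (intro inner_fvec_sum) auto
  then have "(norm x)\<^sup>2 = (\<Sum>i\<in>{..<N} \<union> {i. coord x i \<noteq> 0}. (coord x i)\<^sup>2)"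
    by (simp add: dot_square_norm power2_eq_square)
  then show ?thesis using finite_coord[of x] by (auto intro!: sum_mono2)
qed

definition vec_of :: "nat \<Rightarrow> (nat \<Rightarrow> real) \<Rightarrow> fvec" where
  "vec_of N f = Fvec (\<lambda>i. if i < N then f i else 0)"

lemma coord_vec_of [simp]: "coord (vec_of N f) i = (if i < N then f i else 0)"
proof -
  have "finite {i. (if i < N then f i else 0) \<noteq> 0}"
    by (rule finite_subset[of _ "{..<N}"]) auto
  then show ?thesis
    unfolding vec_of_def by (subst Fvec_inverse) auto
qed

lemma vec_of_Rspace [simp]: "vec_of N f \<in> Rspace N"
  by (simp add: Rspace_def)

lemma abs_coord_le_norm: "\<bar>coord x i\<bar> \<le> norm x"
proof (rule power2_le_imp_le)
  have "(\<Sum>j\<in>{i}. (coord x j)\<^sup>2) \<le> (\<Sum>j<Suc i. (coord x j)\<^sup>2)"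
    by (intro sum_mono2) auto
  also have "\<dots> \<le> (norm x)\<^sup>2" by (rule sum_coord_le_norm)
  finally show "\<bar>coord x i\<bar>\<^sup>2 \<le> (norm x)\<^sup>2" by simp
qed simp

section \<open>Quadratic growth at maximisers\<close>

text \<open>The crude constant k^2 survives the induction: multiplying by y adds at most k to it,
  and k + k^2 \<le> (k + 1)^2.\<close>

lemma pow_taylor:
  fixes x y :: real
  assumes "0 \<le> x" "x \<le> 1" "0 \<le> y" "y \<le> 1"
  shows "y ^ k \<le> x ^ k + k * x ^ (k - 1) * (y - x) + (real k)\<^sup>2 * (y - x)\<^sup>2"
proof (induction k)
  case (Suc k)
  show ?case
  proof (cases k)
    case 0
    then show ?thesis by (simp add: zero_le_power2)
  next
    case (Suc j)
    have xk: "x ^ k = x * x ^ (k - 1)" using Suc by simp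
    have "y ^ Suc k = y * y ^ k" by simp
    also have "\<dots> \<le> y * (x ^ k + k * x ^ (k - 1) * (y - x) + (real k)\<^sup>2 * (y - x)\<^sup>2)"
      using Suc.IH assms by (intro mult_left_mono) auto
    also have "\<dots> = x ^ Suc k + real (Suc k) * x ^ k * (y - x) + k * x ^ (k - 1) * (y - x)\<^sup>2 + y * ((real k)\<^sup>2 * (y - x)\<^sup>2)"
      unfolding xk by (simp add: power2_eq_square xk algebra_simps)
    also have "\<dots> \<le> x ^ Suc k + real (Suc k) * x ^ k * (y - x) + k * 1 * (y - x)\<^sup>2 + 1 * ((real k)\<^sup>2 * (y - x)\<^sup>2)"
    proof -
      have "x ^ (k - 1) \<le> 1" using assms by (intro power_le_one) auto
      then have "k * x ^ (k - 1) * (y - x)\<^sup>2 \<le> k * 1 * (y - x)\<^sup>2"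
        by (intro mult_right_mono) (auto intro: mult_left_le)
      moreover have "y * ((real k)\<^sup>2 * (y - x)\<^sup>2) \<le> 1 * ((real k)\<^sup>2 * (y - x)\<^sup>2)"
        using assms by (intro mult_right_mono) auto
      ultimately show ?thesis by simp
    qed
    also have "\<dots> \<le> x ^ Suc k + real (Suc k) * x ^ k * (y - x) + (real (Suc k))\<^sup>2 * (y - x)\<^sup>2"
    proof -
      have "k + (real k)\<^sup>2 \<le> (real (Suc k))\<^sup>2" by (simp add: power2_eq_square algebra_simps)
      then have "(k + (real k)\<^sup>2) * (y - x)\<^sup>2 \<le> (real (Suc k))\<^sup>2 * (y - x)\<^sup>2"
        by (rule mult_right_mono) simp
      then show ?thesis by (simp add: algebra_simps)
    qed
    finally show ?thesis by simp
  qed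
qed simp

text \<open>A C^(1,1) bound on the unit sphere: one constant controls value, gradient and remainder.
  The displacement is the ambient chord \<open>w - u\<close>, so \<open>D u\<close> is an ambient
  derivative.\<close>

definition quad_approx :: "real \<Rightarrow> ('v::real_inner \<Rightarrow> real) \<Rightarrow> ('v \<Rightarrow> 'v \<Rightarrow> real) \<Rightarrow> bool" where
  "quad_approx C f D \<longleftrightarrow> (\<forall>u. linear (D u)) \<and>
    (\<forall>u w. norm u = 1 \<longrightarrow> \<bar>D u w\<bar> \<le> C * norm w) \<and>
    (\<forall>u. norm u = 1 \<longrightarrow> \<bar>f u\<bar> \<le> C) \<and>
    (\<forall>u w. norm u = 1 \<longrightarrow> norm w = 1 \<longrightarrow> \<bar>f w - f u - D u (w - u)\<bar> \<le> C * (norm (w - u))\<^sup>2)"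

lemma quad_approx_scale:
  assumes "quad_approx C f D"
  shows "quad_approx (\<bar>c\<bar> * C) (\<lambda>u. c * f u) (\<lambda>u w. c * D u w)"
proof -
  have "\<bar>c * f w - c * f u - c * D u (w - u)\<bar> = \<bar>c\<bar> * \<bar>f w - f u - D u (w - u)\<bar>" for u w
    by (simp add: abs_mult[symmetric] algebra_simps)
  then show ?thesis
    using assms unfolding quad_approx_def
    by (auto simp: abs_mult mult.assoc intro!: mult_left_mono linear_compose_scale_right[where f="D _", unfolded real_scaleR_def])
qed

lemma quad_approx_add:
  assumes "quad_approx C f D" "quad_approx C' g D'"
  shows "quad_approx (C + C') (\<lambda>u. f u + g u) (\<lambda>u w. D u w + D' u w)"
  unfolding quad_approx_def
proof (intro conjI allI impI)
  fix u w :: 'a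
  show "linear (\<lambda>w. D u w + D' u w)"
    using assms by (auto simp: quad_approx_def intro: linear_compose_add)
  assume u: "norm u = 1"
  have "\<bar>D u w\<bar> \<le> C * norm w" "\<bar>D' u w\<bar> \<le> C' * norm w"
    using assms u by (auto simp: quad_approx_def)
  then show "\<bar>D u w + D' u w\<bar> \<le> (C + C') * norm w" by (simp add: distrib_right)
  have "\<bar>f u\<bar> \<le> C" "\<bar>g u\<bar> \<le> C'"
    using assms u by (auto simp: quad_approx_def)
  then show "\<bar>f u + g u\<bar> \<le> C + C'" by simp
  assume w: "norm w = 1"
  have "\<bar>f w - f u - D u (w - u)\<bar> \<le> C * (norm (w - u))\<^sup>2"
     "\<bar>g w - g u - D' u (w - u)\<bar> \<le> C' * (norm (w - u))\<^sup>2"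
    using assms u w by (auto simp: quad_approx_def)
  then show "\<bar>f w + g w - (f u + g u) - (D u (w - u) + D' u (w - u))\<bar> \<le> (C + C') * (norm (w - u))\<^sup>2"
    by (simp add: distrib_right)
qed

lemma quad_approx_mono: "quad_approx C f D \<Longrightarrow> C \<le> C' \<Longrightarrow> quad_approx C' f D"
  unfolding quad_approx_def
  by (meson abs_ge_zero mult_right_mono norm_ge_zero order_trans zero_le_power2)

text \<open>For a unit vector v the overlap \<open>u \<bullet> v\<close> lies in [0, 1] here, where
  the signal is monotone in the overlap for either parity of k.\<close>

definition halfsphere :: "'v::real_inner set \<Rightarrow> 'v \<Rightarrow> 'v set" where
  "halfsphere W v = {u \<in> W. norm u = 1 \<and> 0 \<le> u \<bullet> v}"

lemma norm_diff_unit: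
  fixes u v :: "'v::real_inner"
  assumes "norm u = 1" "norm v = 1"
  shows "(norm (u - v))\<^sup>2 = 2 - 2 * (u \<bullet> v)"
proof -
  have "u \<bullet> u = 1" "v \<bullet> v = 1" using assms by (simp_all add: norm_eq_1)
  then show ?thesis unfolding power2_norm_eq_inner
    by (simp add: inner_diff_left inner_diff_right inner_commute)
qed

lemma inner_unit_le_1:
  fixes u v :: "'v::real_inner"
  assumes "norm u = 1" "norm v = 1"
  shows "u \<bullet> v \<le> 1"
  using norm_cauchy_schwarz[of u v] assms by simp

text \<open>Strong concavity near v is used only through the normalised midpoint w of u and u':
  projecting the midpoint back to the sphere increases the inner product with v by a factor
  1 + |u - u'|^2 / 8.\<close>

lemma midpoint_concavity:
  fixes v u u' :: "'v::real_inner"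
  assumes q: "quad_approx C f D" and k: "k \<ge> 1" and \<eta>: "\<eta> > 0" "\<eta>\<^sup>2 = 1 / (8 * real k)"
    and lam: "64 * C + 16 \<le> lam" and C: "C \<ge> 0"
    and W: "subspace W" "v \<in> W" "norm v = 1"
    and u: "u \<in> halfsphere W v" "norm (u - v) \<le> \<eta>"
    and u': "u' \<in> halfsphere W v" "norm (u' - v) \<le> \<eta>"
  defines "F \<equiv> \<lambda>u. f u + lam / real k * (u \<bullet> v) ^ k"
  shows "\<exists>w\<in>halfsphere W v. F w \<ge> (F u + F u') / 2 + (norm (u - u'))\<^sup>2 / 2"
proof -
  define d where "d = norm (u - u')"
  define n where "n = norm (u + u') / 2"
  have nu: "norm u = 1" "norm u' = 1" "u \<in> W" "u' \<in> W" using u u' by (auto simp: halfsphere_def)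
  have \<eta>2: "\<eta>\<^sup>2 \<le> 1 / 8" using k by (simp add: \<eta> field_simps)
  have \<eta>half: "\<eta> \<le> 1 / 2"
  proof (rule power2_le_imp_le)
    show "\<eta>\<^sup>2 \<le> (1/2)\<^sup>2" using \<eta>2 by (simp add: power2_eq_square)
  qed simp
  have d0: "0 \<le> d" by (simp add: d_def)
  have "d \<le> norm (u - v) + norm (u' - v)"
    unfolding d_def using norm_triangle_ineq4[of "u - v" "u' - v"] by simp
  then have d2: "d \<le> 2 * \<eta>" using u u' by simp
  then have d1: "d \<le> 1" using \<eta>half by simp
  have n2: "n\<^sup>2 = 1 - d\<^sup>2 / 4"
  proof -
    have "(norm (u + u'))\<^sup>2 = 4 - d\<^sup>2"
      using nu unfolding d_def norm_diff_unit[OF nu(1,2)] unfolding power2_norm_eq_inner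
      by (simp add: inner_add_left inner_add_right inner_commute norm_eq_1)
    then show ?thesis by (simp add: n_def power_divide)
  qed
  have dsq: "d\<^sup>2 \<le> 1" using d0 d1 by (simp add: power_le_one)
  have n0: "n > 0"
  proof -
    have "n\<^sup>2 > 0" using n2 dsq by simp
    moreover have "n \<ge> 0" by (simp add: n_def)
    ultimately show ?thesis by (simp add: less_le)
  qed
  have n1: "n \<le> 1 - d\<^sup>2 / 8"
  proof (rule power2_le_imp_le)
    show "n\<^sup>2 \<le> (1 - d\<^sup>2 / 8)\<^sup>2"
      using zero_le_power2[of "d\<^sup>2"] unfolding n2 by (simp add: power2_diff power_divide)
    show "0 \<le> 1 - d\<^sup>2 / 8" using dsq by simp
  qed
  have n_le1: "n \<le> 1" using n1 zero_le_power2[of d] by linarith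
  have n3: "1 - n \<le> d\<^sup>2 / 4"
  proof -
    have "n\<^sup>2 \<le> n * 1" unfolding power2_eq_square using n0 n_le1 by (intro mult_left_mono) auto
    then show ?thesis using n2 by simp
  qed
  have inv: "1 / n \<ge> 1 + d\<^sup>2 / 8"
  proof -
    have "(1 + d\<^sup>2 / 8) * n \<le> (1 + d\<^sup>2 / 8) * (1 - d\<^sup>2 / 8)"
      using n1 by (intro mult_left_mono) auto
    also have "\<dots> \<le> 1"
      using zero_le_power2[of "d\<^sup>2 / 8"] by (simp add: algebra_simps power2_eq_square)
    finally show ?thesis using n0 by (simp add: field_simps)
  qed
  define w where "w = (1 / (2 * n)) *\<^sub>R (u + u')"
  have nw: "norm w = 1" using n0 unfolding w_def by (simp add: n_def)
  define m where "m = u \<bullet> v"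
  define m' where "m' = u' \<bullet> v"
  define \<mu> where "\<mu> = (m + m') / 2"
  have m: "m = 1 - (norm (u - v))\<^sup>2 / 2" "m' = 1 - (norm (u' - v))\<^sup>2 / 2"
    unfolding m_def m'_def using norm_diff_unit[of u v] norm_diff_unit[of u' v] nu W by (auto simp: field_simps)
  have mle: "m \<le> 1" "m' \<le> 1" by (simp_all add: m)
  have sqs: "(norm (u - v))\<^sup>2 \<le> \<eta>\<^sup>2" "(norm (u' - v))\<^sup>2 \<le> \<eta>\<^sup>2"
    using u u' by (auto intro!: power_mono)
  then have mge: "1 - \<eta>\<^sup>2 / 2 \<le> m" "1 - \<eta>\<^sup>2 / 2 \<le> m'" by (simp_all add: m)
  have m0: "0 \<le> m" "0 \<le> m'" using mge \<eta>2 by auto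
  have \<mu>: "1 - \<eta>\<^sup>2 / 2 \<le> \<mu>" "\<mu> \<le> 1" "0 \<le> \<mu>" using mge mle m0 by (auto simp: \<mu>_def)
  have wv: "w \<bullet> v = \<mu> * (1 / n)"
    by (simp add: w_def \<mu>_def m_def m'_def inner_add_left)
  have wD: "w \<in> halfsphere W v"
    using nw nu W n0 \<mu>(3) unfolding halfsphere_def w_def[symmetric]
    by (simp add: wv) (simp add: w_def subspace_add subspace_scale)
  \<comment> \<open>Bernoulli's inequality with 1 / n \<ge> 1 + d^2 / 8: the projection gains the
    relative amount k d^2 / 8, whose factor k cancels the 1 / k of the signal.\<close>
  have sig1: "(w \<bullet> v) ^ k \<ge> \<mu> ^ k * (1 + k * (d\<^sup>2 / 8))"
  proof -
    have "1 + k * (d\<^sup>2 / 8) \<le> (1 + d\<^sup>2 / 8) ^ k"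
      using Bernoulli_inequality[of "d\<^sup>2 / 8" k] order_trans[OF _ zero_le_power2, of "-8" d] by simp
    also have "\<dots> \<le> (1 / n) ^ k" using inv by (intro power_mono) auto
    finally show ?thesis unfolding wv power_mult_distrib using \<mu> by (intro mult_left_mono) auto
  qed
  have muk: "\<mu> ^ k \<ge> 1 / 2"
  proof -
    have "1 / 2 \<le> 1 + k * (- (\<eta>\<^sup>2 / 2))" using k by (simp add: \<eta> field_simps)
    also have "\<dots> \<le> (1 + (- (\<eta>\<^sup>2 / 2))) ^ k"
      using \<eta>2 by (intro Bernoulli_inequality) auto
    also have "\<dots> \<le> \<mu> ^ k" using \<mu> \<eta>2 by (intro power_mono) auto
    finally show ?thesis .
  qed
  \<comment> \<open>With a and b the distances to v, m - m' = (b - a)(b + a) / 2. The overlaps thus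
    differ by at most d \<eta>, which makes the convexity defect of t^k small against the projection
    gain.\<close>
  have mm: "(m - m')\<^sup>2 \<le> d\<^sup>2 * (\<eta>\<^sup>2)"
  proof -
    define a where "a = norm (u - v)"
    define b where "b = norm (u' - v)"
    have "\<bar>b - a\<bar> \<le> d" unfolding a_def b_def d_def
      using norm_triangle_ineq3[of "u' - v" "u - v"] by (simp add: norm_minus_commute)
    moreover have "m - m' = (b - a) * ((b + a) / 2)"
      unfolding m a_def[symmetric] b_def[symmetric] by (simp add: power2_eq_square algebra_simps)
    moreover have "0 \<le> (b + a) / 2" "(b + a) / 2 \<le> \<eta>" using u u' by (auto simp: a_def b_def)
    ultimately have "\<bar>m - m'\<bar> \<le> d * \<eta>"
      by (metis abs_ge_zero abs_mult abs_of_nonneg mult_mono')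
    then have "\<bar>m - m'\<bar>\<^sup>2 \<le> (d * \<eta>)\<^sup>2" by (intro power_mono) auto
    then show ?thesis by (simp add: power_mult_distrib)
  qed
  have conv: "(m ^ k + m' ^ k) / 2 \<le> \<mu> ^ k + (real k)\<^sup>2 * ((m - m')\<^sup>2 / 4)"
  proof -
    have "m ^ k \<le> \<mu> ^ k + k * \<mu> ^ (k - 1) * (m - \<mu>) + (real k)\<^sup>2 * (m - \<mu>)\<^sup>2"
      using m0 mle \<mu> by (intro pow_taylor) auto
    moreover have "m' ^ k \<le> \<mu> ^ k + k * \<mu> ^ (k - 1) * (m' - \<mu>) + (real k)\<^sup>2 * (m' - \<mu>)\<^sup>2"
      using m0 mle \<mu> by (intro pow_taylor) auto
    moreover have "m - \<mu> = (m - m') / 2" "m' - \<mu> = - ((m - m') / 2)"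
      by (simp_all add: \<mu>_def field_simps)
    ultimately show ?thesis by (simp add: power_divide field_simps)
  qed
  have lam0: "lam \<ge> 0" using lam C by simp
  \<comment> \<open>The gain is at least k d^2 / 16, since \<mu>^k \<ge> 1/2; the choice of \<eta>
    bounds the convexity defect by half of that.\<close>
  have signal: "lam / k * (w \<bullet> v) ^ k - lam / k * ((m ^ k + m' ^ k) / 2) \<ge> lam * d\<^sup>2 / 32"
  proof -
    have "(w \<bullet> v) ^ k - (m ^ k + m' ^ k) / 2 \<ge> \<mu> ^ k * (k * (d\<^sup>2 / 8)) - (real k)\<^sup>2 * ((m - m')\<^sup>2 / 4)"
      using sig1[unfolded distrib_left] conv by linarith
    moreover have "\<mu> ^ k * (k * (d\<^sup>2 / 8)) \<ge> 1/2 * (k * (d\<^sup>2 / 8))"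
      using muk by (intro mult_right_mono) auto
    moreover have "(real k)\<^sup>2 * ((m - m')\<^sup>2 / 4) \<le> k * (d\<^sup>2 / 32)"
    proof -
      have "(real k)\<^sup>2 * ((m - m')\<^sup>2 / 4) \<le> (real k)\<^sup>2 * (d\<^sup>2 * \<eta>\<^sup>2 / 4)"
        using mm by (intro mult_left_mono) auto
      then show ?thesis unfolding \<eta> using k by (simp add: power2_eq_square)
    qed
    ultimately have "(w \<bullet> v) ^ k - (m ^ k + m' ^ k) / 2 \<ge> k * (d\<^sup>2 / 32)" by linarith
    then have "lam / k * ((w \<bullet> v) ^ k - (m ^ k + m' ^ k) / 2) \<ge> lam / k * (k * (d\<^sup>2 / 32))"
      using lam0 by (intro mult_left_mono) auto
    then show ?thesis using k by (simp add: algebra_simps)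
  qed
  \<comment> \<open>Expanding around u', the linear terms cancel up to the projection error
    \<open>e\<close>, of norm at most d^2 / 4. The losses add up to C d^2 (1/4 + 1 + 1/2).\<close>
  have noise: "f w - (f u + f u') / 2 \<ge> - 2 * C * d\<^sup>2"
  proof -
    have lin: "linear (D u')" using q by (simp add: quad_approx_def)
    define e where "e = w - (1/2) *\<^sub>R (u + u')"
    have "e = (1 / n - 1) *\<^sub>R ((1/2) *\<^sub>R (u + u'))"
      unfolding e_def w_def scaleR_scaleR scaleR_diff_left[symmetric] by (simp add: diff_divide_distrib)
    then have "norm e = \<bar>1 / n - 1\<bar> * n" by (simp add: n_def)
    also have "\<dots> = 1 - n" using n0 n_le1 by (simp add: abs_if field_simps)
    finally have ne: "norm e \<le> d\<^sup>2 / 4" using n3 by simp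
    have wu: "w - u' = (1/2) *\<^sub>R (u - u') + e"
    proof -
      have "(1/2) *\<^sub>R u' + (1/2) *\<^sub>R u' = u'" by (simp flip: scaleR_left_distrib)
      then show ?thesis by (simp add: e_def algebra_simps)
    qed
    have "norm (w - u') \<le> d / 2 + d\<^sup>2 / 4"
      unfolding wu using norm_triangle_ineq[of "(1/2) *\<^sub>R (u - u')" e] ne by (simp add: d_def)
    also have "d\<^sup>2 / 4 \<le> d / 2" using d0 d1 mult_left_mono[of d 2 d] by (simp add: power2_eq_square)
    finally have nwu: "norm (w - u') \<le> d" by simp
    have "f w \<ge> f u' + D u' (w - u') - C * (norm (w - u'))\<^sup>2"
      using q nw nu unfolding quad_approx_def by (smt (verit))
    moreover have "C * (norm (w - u'))\<^sup>2 \<le> C * d\<^sup>2"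
      using nwu C by (intro mult_left_mono power_mono) auto
    moreover have "D u' (w - u') = D u' (u - u') / 2 + D u' e"
      unfolding wu by (simp add: linear_add[OF lin] linear_scale[OF lin])
    moreover have "\<bar>D u' e\<bar> \<le> C * (d\<^sup>2 / 4)"
    proof -
      have "\<bar>D u' e\<bar> \<le> C * norm e" using q nu by (simp add: quad_approx_def)
      also have "\<dots> \<le> C * (d\<^sup>2 / 4)" using ne C by (intro mult_left_mono) auto
      finally show ?thesis .
    qed
    moreover have "f u \<le> f u' + D u' (u - u') + C * d\<^sup>2"
      using q nu unfolding quad_approx_def d_def by (smt (verit))
    moreover have "0 \<le> C * d\<^sup>2" using C by simp
    ultimately show ?thesis by (simp add: field_simps)
  qed
  have "F w - (F u + F u') / 2 \<ge> (lam / 32 - 2 * C) * d\<^sup>2"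
    using signal noise unfolding F_def m_def m'_def by (simp add: algebra_simps add_divide_distrib)
  \<comment> \<open>The origin of 64 C + 16: it makes lam / 32 - 2 C at least 1/2.\<close>
  moreover have "(lam / 32 - 2 * C) * d\<^sup>2 \<ge> 1/2 * d\<^sup>2"
    using lam by (intro mult_right_mono) auto
  ultimately show ?thesis using wD by (intro bexI[of _ w]) (auto simp: d_def)
qed

text \<open>Near-maximality of u' is tested against the normalised midpoint w of u and u': F(w)
  \<le> F(u') + \<zeta> turns the midpoint gain |u - u'|^2 / 2 into the claim. This works near v;
  points farther away lose so much signal that the bound holds by size.\<close>

lemma quadratic_growth:
  fixes k :: nat
  assumes k: "k \<ge> 1" and C: "C \<ge> 0"
  shows "\<exists>c>0. \<forall>lam\<ge>c. \<forall>f D (W :: 'v::real_inner set) v u' \<zeta>. quad_approx C f D \<longrightarrow> subspace W \<longrightarrow> v \<in> W \<longrightarrow> norm v = 1 \<longrightarrow>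
      0 \<le> \<zeta> \<longrightarrow> \<zeta> \<le> 1 \<longrightarrow> u' \<in> halfsphere W v \<longrightarrow>
      (\<forall>w\<in>halfsphere W v. f w + lam / real k * (w \<bullet> v) ^ k \<le> f u' + lam / real k * (u' \<bullet> v) ^ k + \<zeta>) \<longrightarrow>
      (\<forall>u\<in>halfsphere W v. (norm (u - u'))\<^sup>2 \<le> (f u' + lam / real k * (u' \<bullet> v) ^ k) - (f u + lam / real k * (u \<bullet> v) ^ k) + 2 * \<zeta>)"
proof -
  define \<eta> where "\<eta> = sqrt (1 / (8 * real k))"
  have \<eta>: "\<eta> > 0" "\<eta>\<^sup>2 = 1 / (8 * real k)" using k by (auto simp: \<eta>_def)
  \<comment> \<open>The first entry serves \<open>midpoint_concavity\<close>. The second makes the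
    signal deficit lam / (16 k^2) at distance \<eta> from v exceed the noise range 2 C by more than
    5.\<close>
  define c where "c = max (64 * C + 16) (16 * real k * real k * (2 * C + 6))"
  have c0: "c > 0" using C by (auto simp: c_def)
  show ?thesis
  proof (intro exI[of _ c] conjI c0 allI impI ballI)
    fix lam f D and W :: "'v set" and v u' u :: 'v and \<zeta> :: real
    assume lam: "lam \<ge> c" and q: "quad_approx C f D" and W: "subspace W" "v \<in> W" "norm v = 1"
      and \<zeta>: "0 \<le> \<zeta>" "\<zeta> \<le> 1" and u': "u' \<in> halfsphere W v"
      and max: "\<forall>w\<in>halfsphere W v. f w + lam / real k * (w \<bullet> v) ^ k \<le> f u' + lam / real k * (u' \<bullet> v) ^ k + \<zeta>"
      and u: "u \<in> halfsphere W v"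
    define F where "F u = f u + lam / real k * (u \<bullet> v) ^ k" for u
    have max': "F w \<le> F u' + \<zeta>" if "w \<in> halfsphere W v" for w using max that by (simp add: F_def)
    have lam0: "lam > 0" using lam c0 by simp
    have vD: "v \<in> halfsphere W v" using W by (simp add: halfsphere_def)
    have "f v \<ge> - C" using q W by (simp add: quad_approx_def abs_le_iff minus_le_iff)
    moreover have "v \<bullet> v = 1" using W by (simp add: norm_eq_1)
    ultimately have Fv: "F v \<ge> lam / k - C" by (simp add: F_def)
    \<comment> \<open>The margin 5 is the squared diameter 4 of the sphere plus the slack \<zeta>
      \<le> 1.\<close>
    have far: "F x \<le> lam / k - C - 5" if x: "x \<in> halfsphere W v" "\<eta> < norm (x - v)" for x
    proof -
      have nx: "norm x = 1" "0 \<le> x \<bullet> v" using x by (auto simp: halfsphere_def)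
      have "\<eta>\<^sup>2 \<le> (norm (x - v))\<^sup>2" using x \<eta> by (intro power_mono) auto
      then have xv: "x \<bullet> v \<le> 1 - \<eta>\<^sup>2 / 2" using norm_diff_unit[OF nx(1) W(3)] by simp
      have "(x \<bullet> v) ^ k \<le> x \<bullet> v"
        using nx inner_unit_le_1[OF nx(1) W(3)] power_decreasing[of 1 k "x \<bullet> v"] k by simp
      then have "lam / k * (x \<bullet> v) ^ k \<le> lam / k * (1 - \<eta>\<^sup>2 / 2)"
        using xv lam0 by (intro mult_left_mono) auto
      moreover have "f x \<le> C" using q nx by (simp add: quad_approx_def abs_le_iff)
      moreover have "lam / k * (\<eta>\<^sup>2 / 2) \<ge> 2 * C + 5"
      proof -
        have "16 * real k * real k * (2 * C + 5) \<le> 16 * real k * real k * (2 * C + 6)"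
          by (intro mult_left_mono) auto
        also have "\<dots> \<le> lam" using lam by (simp add: c_def)
        finally show ?thesis unfolding \<eta> using k by (simp add: field_simps)
      qed
      ultimately show ?thesis by (simp add: F_def algebra_simps)
    qed
    have near: "norm (u' - v) \<le> \<eta>"
    proof (rule ccontr)
      assume "\<not> ?thesis"
      then have "F u' \<le> lam / k - C - 5" using far u' by auto
      with max'[OF vD] Fv \<zeta> show False by simp
    qed
    have "(norm (u - u'))\<^sup>2 \<le> F u' - F u + 2 * \<zeta>"
    proof (cases "norm (u - v) \<le> \<eta>")
      case True
      have "64 * C + 16 \<le> lam" using lam by (simp add: c_def)
      from midpoint_concavity[OF q k \<eta> this C W u True u' near]
      obtain w where w: "w \<in> halfsphere W v" "F w \<ge> (F u + F u') / 2 + (norm (u - u'))\<^sup>2 / 2"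
        by (auto simp: F_def)
      with max'[of w] show ?thesis by (simp add: field_simps)
    next
      case False
      then have "F u \<le> lam / k - C - 5" using far u by auto
      with max'[OF vD] Fv \<zeta> have "F u' - F u \<ge> 4" by simp
      moreover have "(norm (u - u'))\<^sup>2 \<le> 2\<^sup>2"
        using norm_triangle_ineq4[of u u'] u u' by (intro power_mono) (auto simp: halfsphere_def)
      ultimately show ?thesis using \<zeta> by simp
    qed
    then show "(norm (u - u'))\<^sup>2 \<le> (f u' + lam / real k * (u' \<bullet> v) ^ k) - (f u + lam / real k * (u \<bullet> v) ^ k) + 2 * \<zeta>"
      by (simp add: F_def)
  qed
qed

section \<open>Perturbing a field near its maximiser\<close>

text \<open>By quadratic growth a near-maximiser of V + \<eta> a lies within (L + 3) \<eta> of u'.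
  There a - b is the constant e up to Q (L + 3)^2 \<eta>^2, and the prefactor \<eta> turns this into
  \<eta>^3.\<close>

lemma sup_perturbation_le:
  fixes V a b :: "'v::real_inner \<Rightarrow> real"
  assumes u': "u' \<in> D"
    and growth: "\<And>u. u \<in> D \<Longrightarrow> (norm (u - u'))\<^sup>2 \<le> V u' - V u + 2 * \<eta> ^ 3"
    and lip: "\<And>u. u \<in> D \<Longrightarrow> \<bar>a u - a u'\<bar> \<le> L * norm (u - u')"
    and diff: "\<And>u. u \<in> D \<Longrightarrow> \<bar>a u - b u - e\<bar> \<le> Q * (norm (u - u'))\<^sup>2"
    and bdd: "bdd_above ((\<lambda>u. V u + \<eta> * a u) ` D)" "bdd_above ((\<lambda>u. V u + \<eta> * b u) ` D)"
    and \<eta>: "0 < \<eta>" "\<eta> \<le> 1" and "0 \<le> L" "0 \<le> Q"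
  shows "(SUP u\<in>D. V u + \<eta> * a u) \<le> (SUP u\<in>D. V u + \<eta> * b u) + \<eta> * \<bar>e\<bar> + (1 + Q * (L + 3)\<^sup>2) * \<eta> ^ 3"
proof -
  let ?S = "SUP u\<in>D. V u + \<eta> * a u"
  have \<eta>3: "0 < \<eta> ^ 3" "\<eta> ^ 3 \<le> \<eta>\<^sup>2" using \<eta> by (auto intro: power_decreasing)
  have "?S - \<eta> ^ 3 < ?S" using \<eta>3 by simp
  then obtain u where u: "u \<in> D" "?S - \<eta> ^ 3 < V u + \<eta> * a u"
    using less_cSUP_iff[OF _ bdd(1)] u' by blast
  define d where "d = norm (u - u')"
  have d0: "0 \<le> d" by (simp add: d_def)
  have "V u' + \<eta> * a u' \<le> ?S" by (rule cSUP_upper[OF u' bdd(1)])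
  then have "V u' - V u \<le> \<eta> * (a u - a u') + \<eta> ^ 3" using u by (simp add: algebra_simps)
  also have "\<eta> * (a u - a u') \<le> \<eta> * (L * d)"
    using lip[OF u(1)] \<eta> unfolding d_def by (intro mult_left_mono) auto
  \<comment> \<open>3 \<eta>^2 collects \<eta>^3 from the choice of u and 2 \<eta>^3 from the growth
    slack.\<close>
  finally have "d\<^sup>2 \<le> \<eta> * L * d + 3 * \<eta>\<^sup>2"
    using growth[OF u(1)] \<eta>3 unfolding d_def by simp
  have dle: "d \<le> (L + 3) * \<eta>"
  proof (rule ccontr)
    assume "\<not> ?thesis"
    then have gt: "(L + 3) * \<eta> < d" by simp
    have "3 * \<eta> \<le> (L + 3) * \<eta>" using assms by (intro mult_right_mono) auto
    then have d3: "3 * \<eta> < d" using gt by simp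
    have "(L + 3) * \<eta> * d \<le> d * d" using gt d0 by (intro mult_right_mono) auto
    moreover have "3 * \<eta> * (3 * \<eta>) \<le> 3 * \<eta> * d" using d3 \<eta> by (intro mult_left_mono) auto
    moreover have "0 < \<eta> * \<eta>" using \<eta> by simp
    ultimately show False using \<open>d\<^sup>2 \<le> \<eta> * L * d + 3 * \<eta>\<^sup>2\<close> by (simp add: power2_eq_square algebra_simps)
  qed
  have "\<eta> * (a u - b u) \<le> \<eta> * (\<bar>e\<bar> + Q * ((L + 3) * \<eta>)\<^sup>2)"
  proof (intro mult_left_mono)
    have "Q * d\<^sup>2 \<le> Q * ((L + 3) * \<eta>)\<^sup>2" using assms dle d0 by (intro mult_left_mono power_mono) auto
    then show "a u - b u \<le> \<bar>e\<bar> + Q * ((L + 3) * \<eta>)\<^sup>2"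
      using diff[OF u(1)] unfolding d_def by linarith
  qed (use \<eta> in auto)
  moreover have "V u + \<eta> * b u \<le> (SUP u\<in>D. V u + \<eta> * b u)"
    by (rule cSUP_upper[OF u(1) bdd(2)])
  ultimately have "?S \<le> (SUP u\<in>D. V u + \<eta> * b u) + \<eta> ^ 3 + \<eta> * (\<bar>e\<bar> + Q * ((L + 3) * \<eta>)\<^sup>2)"
    using u by (simp add: algebra_simps)
  also have "\<dots> = (SUP u\<in>D. V u + \<eta> * b u) + \<eta> * \<bar>e\<bar> + (1 + Q * (L + 3)\<^sup>2) * \<eta> ^ 3"
    by (simp add: power_mult_distrib algebra_simps power3_eq_cube power2_eq_square)
  finally show ?thesis .
qed

text \<open>\<open>lf\<close> keeps the tangential gradient of f at u' and takes an arbitrary radial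
  slope b. For unit u the radial component of u - u' has size |u - u'|^2 / 2, so changing that slope
  shifts the field by a constant and a second-order term.\<close>

lemma tangent_field_coupling:
  fixes V f :: "'v::real_inner \<Rightarrow> real"
  assumes q: "quad_approx C f Df" and b: "\<bar>b\<bar> \<le> C"
    and D: "\<And>u. u \<in> D \<Longrightarrow> norm u = 1" and u': "u' \<in> D"
    and growth: "\<And>u. u \<in> D \<Longrightarrow> (norm (u - u'))\<^sup>2 \<le> V u' - V u + 2 * \<eta> ^ 3"
    and Vb: "bdd_above (V ` D)" and \<eta>: "0 < \<eta>" "\<eta> \<le> 1"
  defines "lf \<equiv> \<lambda>w. Df u' (w - (w \<bullet> u') *\<^sub>R u') + b * (w \<bullet> u')"
  shows "\<bar>(SUP u\<in>D. V u + \<eta> * f u) - (SUP u\<in>D. V u + \<eta> * lf u)\<bar>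
    \<le> \<eta> * (\<bar>f u'\<bar> + \<bar>b\<bar>) + (1 + 2 * C * (3 * C + 3)\<^sup>2) * \<eta> ^ 3"
proof -
  have C: "0 \<le> C" using b by simp
  have nu': "norm u' = 1" using D u' by simp
  have lin: "linear (Df u')" and Db: "\<And>w. \<bar>Df u' w\<bar> \<le> C * norm w"
    using q nu' by (auto simp: quad_approx_def)
  have l0: "lf u' = b"
    using nu' linear_0[OF lin] by (simp add: lf_def dot_square_norm)
  have main: "\<bar>f u - f u'\<bar> \<le> 3 * C * norm (u - u')"
    "\<bar>lf u - lf u'\<bar> \<le> 3 * C * norm (u - u')"
    "\<bar>f u - lf u - (f u' - b)\<bar> \<le> 2 * C * (norm (u - u'))\<^sup>2" if uD: "u \<in> D" for u
  proof -
    define d where "d = norm (u - u')"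
    have nu: "norm u = 1" using D uD by simp
    have d: "0 \<le> d" "d \<le> 2" using norm_triangle_ineq4[of u u'] nu nu' by (auto simp: d_def)
    have ip: "u \<bullet> u' = 1 - d\<^sup>2 / 2" using norm_diff_unit[OF nu nu'] by (simp add: d_def field_simps)
    have dd: "d\<^sup>2 \<le> 2 * d" using d by (simp add: power2_eq_square mult_right_mono)
    have t: "\<bar>f u - f u' - Df u' (u - u')\<bar> \<le> C * d\<^sup>2"
      using q nu nu' by (simp add: quad_approx_def d_def)
    have D1: "\<bar>Df u' (u - u')\<bar> \<le> C * d" using Db[of "u - u'"] by (simp add: d_def)
    have Cdd: "C * d\<^sup>2 \<le> C * (2 * d)" using dd C by (intro mult_left_mono) auto
    show "\<bar>f u - f u'\<bar> \<le> 3 * C * norm (u - u')"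
      using t D1 Cdd unfolding d_def[symmetric] by linarith
    have ue: "u - (u \<bullet> u') *\<^sub>R u' = (u - u') + (d\<^sup>2 / 2) *\<^sub>R u'"
      by (simp add: ip scaleR_diff_left)
    have D2: "Df u' (u - (u \<bullet> u') *\<^sub>R u') = Df u' (u - u') + (d\<^sup>2 / 2) * Df u' u'"
    proof -
      have "Df u' ((u - u') + (d\<^sup>2 / 2) *\<^sub>R u') = Df u' (u - u') + Df u' ((d\<^sup>2 / 2) *\<^sub>R u')"
        by (rule linear_add[OF lin])
      also have "Df u' ((d\<^sup>2 / 2) *\<^sub>R u') = (d\<^sup>2 / 2) *\<^sub>R Df u' u'"
        by (rule linear_scale[OF lin])
      finally show ?thesis unfolding ue real_scaleR_def .
    qed
    have l: "lf u - lf u' = Df u' (u - u') + (d\<^sup>2 / 2) * Df u' u' - (d\<^sup>2 / 2) * b"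
      unfolding l0 unfolding lf_def D2 unfolding ip by (simp add: algebra_simps)
    have "\<bar>Df u' u'\<bar> \<le> C" using Db[of u'] nu' by simp
    then have D3: "\<bar>(d\<^sup>2 / 2) * Df u' u'\<bar> \<le> (d\<^sup>2 / 2) * C"
      unfolding abs_mult by (intro mult_mono) auto
    have D4: "\<bar>(d\<^sup>2 / 2) * b\<bar> \<le> (d\<^sup>2 / 2) * C"
      using b unfolding abs_mult by (intro mult_mono) auto
    show "\<bar>lf u - lf u'\<bar> \<le> 3 * C * norm (u - u')"
    proof -
      have "\<bar>lf u - lf u'\<bar> \<le> \<bar>Df u' (u - u')\<bar> + \<bar>(d\<^sup>2 / 2) * Df u' u'\<bar> + \<bar>(d\<^sup>2 / 2) * b\<bar>"
        unfolding l by linarith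
      also have "\<dots> \<le> C * d + (d\<^sup>2 / 2) * C + (d\<^sup>2 / 2) * C"
        using D1 D3 D4 by linarith
      also have "\<dots> \<le> 3 * C * d" using Cdd by (simp add: algebra_simps)
      finally show ?thesis by (simp only: d_def)
    qed
    show "\<bar>f u - lf u - (f u' - b)\<bar> \<le> 2 * C * (norm (u - u'))\<^sup>2"
    proof -
      have e: "f u - lf u - (f u' - b) = (f u - f u' - Df u' (u - u')) - (d\<^sup>2 / 2) * Df u' u' + (d\<^sup>2 / 2) * b"
        using l l0 by simp
      have "\<bar>f u - lf u - (f u' - b)\<bar> \<le> \<bar>f u - f u' - Df u' (u - u')\<bar> + \<bar>(d\<^sup>2 / 2) * Df u' u'\<bar> + \<bar>(d\<^sup>2 / 2) * b\<bar>"
        unfolding e by linarith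
      also have "\<dots> \<le> C * d\<^sup>2 + (d\<^sup>2 / 2) * C + (d\<^sup>2 / 2) * C"
        using t D3 D4 by linarith
      finally show ?thesis by (simp add: d_def)
    qed
  qed
  obtain B where B: "\<And>u. u \<in> D \<Longrightarrow> V u \<le> B" using Vb by (auto simp: bdd_above_def)
  have bdd: "bdd_above ((\<lambda>u. V u + \<eta> * a u) ` D)" if "\<And>u. u \<in> D \<Longrightarrow> \<bar>a u - a u'\<bar> \<le> 3 * C * norm (u - u')" for a
  proof (rule bdd_aboveI2)
    fix u assume u: "u \<in> D"
    have "3 * C * norm (u - u') \<le> 3 * C * 2"
      using norm_triangle_ineq4[of u u'] D[OF u] nu' C by (intro mult_left_mono) auto
    then have "a u \<le> a u' + 6 * C" using that[OF u] by linarith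
    then have "\<eta> * a u \<le> \<eta> * (a u' + 6 * C)" using \<eta> by (intro mult_left_mono) auto
    then show "V u + \<eta> * a u \<le> B + \<eta> * (a u' + 6 * C)" using B[OF u] by simp
  qed
  have e: "\<eta> * \<bar>f u' - b\<bar> \<le> \<eta> * (\<bar>f u'\<bar> + \<bar>b\<bar>)"
    using \<eta> by (intro mult_left_mono) auto
  have "(SUP u\<in>D. V u + \<eta> * f u) \<le> (SUP u\<in>D. V u + \<eta> * lf u) + \<eta> * \<bar>f u' - b\<bar> + (1 + 2 * C * (3 * C + 3)\<^sup>2) * \<eta> ^ 3"
    by (rule sup_perturbation_le[OF u' growth main(1) main(3) bdd bdd \<eta>]) (use main C in auto)
  moreover have "(SUP u\<in>D. V u + \<eta> * lf u) \<le> (SUP u\<in>D. V u + \<eta> * f u) + \<eta> * \<bar>b - f u'\<bar> + (1 + 2 * C * (3 * C + 3)\<^sup>2) * \<eta> ^ 3"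
  proof (rule sup_perturbation_le[OF u' growth main(2) _ bdd bdd \<eta>])
    fix u assume "u \<in> D"
    show "\<bar>lf u - f u - (b - f u')\<bar> \<le> 2 * C * (norm (u - u'))\<^sup>2"
      using main(3)[OF \<open>u \<in> D\<close>] by linarith
  qed (use main C in auto)
  ultimately show ?thesis using e by (simp add: abs_le_iff abs_minus_commute)
qed

text \<open>For a given overlap m the best transverse part of u, of length sqrt(1 - m^2), points
  along the projection of g off v. That projection has length near 1, so the problem becomes
  one-dimensional in m.\<close>

lemma linear_field_sup:
  fixes g v :: "'v::real_inner"
  assumes W: "subspace W" "v \<in> W" "norm v = 1" "g \<in> W"
    and \<delta>: "0 < \<delta>" "\<delta> \<le> 1/2" and g: "\<bar>g \<bullet> v\<bar> \<le> \<delta>" "\<bar>(norm g)\<^sup>2 - 1\<bar> \<le> \<delta>"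
    and A: "0 \<le> A" and mx: "0 \<le> mx" "mx \<le> 1"
    and max: "\<And>m. 0 \<le> m \<Longrightarrow> m \<le> 1 \<Longrightarrow> A * sqrt (1 - m\<^sup>2) + \<phi> m \<le> A * sqrt (1 - mx\<^sup>2) + \<phi> mx"
  shows "\<bar>(SUP u\<in>halfsphere W v. A * (g \<bullet> u) + \<phi> (u \<bullet> v)) - (A * sqrt (1 - mx\<^sup>2) + \<phi> mx)\<bar> \<le> 3 * A * \<delta>"
proof -
  let ?U = "A * sqrt (1 - mx\<^sup>2) + \<phi> mx"
  have vv: "v \<bullet> v = 1" using W by (simp add: norm_eq_1)
  have up: "A * (g \<bullet> u) + \<phi> (u \<bullet> v) \<le> ?U + 3 * A * \<delta>" if "u \<in> halfsphere W v" for u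
  proof -
    define m where "m = u \<bullet> v"
    have nu: "norm u = 1" "0 \<le> m" using that by (auto simp: halfsphere_def m_def)
    have m1: "m \<le> 1" using inner_unit_le_1[OF nu(1) W(3)] by (simp add: m_def)
    define x where "x = u - m *\<^sub>R v"
    have "u \<bullet> u = 1" using nu by (simp add: norm_eq_1)
    then have "(norm x)\<^sup>2 = 1 - m\<^sup>2"
      unfolding power2_norm_eq_inner x_def
      by (simp add: inner_diff_left inner_diff_right vv inner_commute m_def[symmetric] power2_eq_square)
    then have nx: "norm x = sqrt (1 - m\<^sup>2)" by (metis norm_ge_zero real_sqrt_unique)
    have ng: "norm g \<le> 1 + \<delta>"
    proof (rule power2_le_imp_le)
      show "(norm g)\<^sup>2 \<le> (1 + \<delta>)\<^sup>2" 
        using g(2) \<delta> self_le_power[of "1 + \<delta>" 2] by linarith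
    qed (use \<delta> in simp)
    have "g \<bullet> u = m * (g \<bullet> v) + g \<bullet> x"
      by (simp add: x_def inner_diff_right)
    also have "m * (g \<bullet> v) \<le> 1 * \<delta>"
    proof -
      have "\<bar>m * (g \<bullet> v)\<bar> \<le> 1 * \<delta>" unfolding abs_mult using nu m1 g by (intro mult_mono) auto
      then show ?thesis by simp
    qed
    also have "g \<bullet> x \<le> (1 + \<delta>) * norm x"
      using norm_cauchy_schwarz[of g x] mult_right_mono[OF ng norm_ge_zero[of x]] by simp
    also have "(1 + \<delta>) * norm x \<le> norm x + \<delta>"
      using nx \<delta> by (simp add: distrib_right mult_left_le)
    finally have "g \<bullet> u \<le> sqrt (1 - m\<^sup>2) + 3 * \<delta>" using nx \<delta> by simp
    then have "A * (g \<bullet> u) \<le> A * (sqrt (1 - m\<^sup>2) + 3 * \<delta>)" using A by (rule mult_left_mono)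
    with max[OF nu(2) m1] show ?thesis by (simp add: m_def algebra_simps)
  qed
  have ne: "v \<in> halfsphere W v" using W vv by (simp add: halfsphere_def)
  have "(SUP u\<in>halfsphere W v. A * (g \<bullet> u) + \<phi> (u \<bullet> v)) \<le> ?U + 3 * A * \<delta>"
    using ne up by (intro cSUP_least) auto
  moreover have "?U - 3 * A * \<delta> \<le> (SUP u\<in>halfsphere W v. A * (g \<bullet> u) + \<phi> (u \<bullet> v))"
  proof -
    define h where "h = g - (g \<bullet> v) *\<^sub>R v"
    have hv: "h \<bullet> v = 0" by (simp add: h_def inner_diff_left vv)
    have gh: "g = (g \<bullet> v) *\<^sub>R v + h" by (simp add: h_def)
    have "(norm h)\<^sup>2 = (norm g)\<^sup>2 - (g \<bullet> v)\<^sup>2"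
      unfolding power2_norm_eq_inner h_def
      by (simp add: inner_diff_left inner_diff_right vv inner_commute power2_eq_square)
    moreover have "(g \<bullet> v)\<^sup>2 \<le> \<delta>\<^sup>2" using g by (metis abs_ge_zero power2_abs power_mono)
    moreover have "\<delta>\<^sup>2 \<le> \<delta> * (1/2)" unfolding power2_eq_square using \<delta> by (intro mult_left_mono) auto
    \<comment> \<open>|h|^2 \<ge> 1 - \<delta> - \<delta>^2 dominates (1 - 2 \<delta>)^2 for
      \<delta> \<le> 1/2. At \<delta> = 1/2 the latter vanishes, hence the separate
      positivity.\<close>
    ultimately have h2: "(norm h)\<^sup>2 \<ge> (1 - 2 * \<delta>)\<^sup>2" "(norm h)\<^sup>2 > 0"
      using g \<delta> by (simp_all add: power2_diff power_mult_distrib abs_le_iff)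
    then have nh: "norm h \<ge> 1 - 2 * \<delta>" "norm h > 0"
      by (auto intro: power2_le_imp_le)
    define y where "y = h /\<^sub>R norm h"
    have y: "norm y = 1" "y \<bullet> v = 0" "v \<bullet> y = 0" "y \<in> W"
      using nh hv W by (auto simp: y_def inner_commute h_def subspace_diff subspace_scale)
    have gy: "g \<bullet> y = norm h"
    proof -
      have "g \<bullet> h = (norm h)\<^sup>2"
        using arg_cong[OF gh, of "\<lambda>x. x \<bullet> h"] hv
        by (simp add: inner_add_left inner_commute[of v h] dot_square_norm)
      then show ?thesis using nh by (simp add: y_def power2_eq_square)
    qed
    define u where "u = mx *\<^sub>R v + sqrt (1 - mx\<^sup>2) *\<^sub>R y"
    have mx2: "mx\<^sup>2 \<le> 1" using mx by (simp add: power_le_one)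
    have uv: "u \<bullet> v = mx" by (simp add: u_def inner_add_left vv y)
    have "u \<bullet> u = mx\<^sup>2 + (1 - mx\<^sup>2)"
    proof -
      have "y \<bullet> y = 1" using y by (simp add: norm_eq_1)
      moreover have "sqrt (1 - mx\<^sup>2) * sqrt (1 - mx\<^sup>2) = 1 - mx\<^sup>2" using mx2 by simp
      ultimately show ?thesis
        unfolding u_def by (simp add: inner_add_left inner_add_right vv y power2_eq_square)
    qed
    then have "norm u = 1" by (simp add: norm_eq_1)
    then have uD: "u \<in> halfsphere W v"
      using W y mx uv unfolding halfsphere_def by (auto simp: u_def subspace_add subspace_scale)
    have "g \<bullet> u = mx * (g \<bullet> v) + sqrt (1 - mx\<^sup>2) * norm h"
      by (simp add: u_def inner_add_right gy)
    moreover have "mx * (g \<bullet> v) \<ge> - \<delta>"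
    proof -
      have "\<bar>mx * (g \<bullet> v)\<bar> \<le> 1 * \<delta>" unfolding abs_mult using mx g by (intro mult_mono) auto
      then show ?thesis by simp
    qed
    moreover have "sqrt (1 - mx\<^sup>2) * norm h \<ge> sqrt (1 - mx\<^sup>2) * (1 - 2 * \<delta>)"
      using nh mx2 by (intro mult_left_mono) auto
    moreover have "sqrt (1 - mx\<^sup>2) * (2 * \<delta>) \<le> 1 * (2 * \<delta>)"
      using \<delta> mx by (intro mult_right_mono) auto
    ultimately have "g \<bullet> u \<ge> sqrt (1 - mx\<^sup>2) - 3 * \<delta>" by (simp add: algebra_simps)
    then have "A * (g \<bullet> u) \<ge> A * (sqrt (1 - mx\<^sup>2) - 3 * \<delta>)" using A by (rule mult_left_mono)
    moreover have "A * (g \<bullet> u) + \<phi> (u \<bullet> v) \<le> (SUP u\<in>halfsphere W v. A * (g \<bullet> u) + \<phi> (u \<bullet> v))"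
      using up by (intro cSUP_upper[OF uD] bdd_aboveI2)
    ultimately show ?thesis by (simp add: uv algebra_simps)
  qed
  ultimately show ?thesis by (simp add: abs_le_iff)
qed

section \<open>The operator norm of a Gaussian tensor\<close>

lemma finite_tidx [simp]: "finite (tidx p N)"
proof -
  have "tidx p N = {is. set is \<subseteq> {..<N} \<and> length is = p}" by (auto simp: tidx_def)
  then show ?thesis by (simp add: finite_lists_length_eq)
qed

lemma tidx_Suc: "tidx (Suc p) N = (\<lambda>(i, is). i # is) ` ({..<N} \<times> tidx p N)"
proof -
  have "is \<in> (\<lambda>(i, is). i # is) ` ({..<N} \<times> tidx p N)" if "is \<in> tidx (Suc p) N" for "is"
    using that by (cases "is") (auto simp: tidx_def)
  then show ?thesis by (auto simp: tidx_def)
qed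

text \<open>The inner product of rank-one tensors is the product of the inner products of their
  factors; the variances and orthogonality relations below all come from this.\<close>

lemma sum_tidx_prod:
  fixes a :: "nat \<Rightarrow> nat \<Rightarrow> real"
  shows "(\<Sum>is\<in>tidx p N. \<Prod>j<p. a j (is ! j)) = (\<Prod>j<p. \<Sum>i<N. a j i)"
proof (induction p arbitrary: a)
  case 0
  have "tidx 0 N = {[]}" by (auto simp: tidx_def)
  then show ?case by simp
next
  case (Suc p)
  have inj: "inj_on (\<lambda>(i, is). i # is) ({..<N} \<times> tidx p N)" by (auto simp: inj_on_def)
  have "(\<Sum>is\<in>tidx (Suc p) N. \<Prod>j<Suc p. a j (is ! j))
    = (\<Sum>(i, is)\<in>{..<N} \<times> tidx p N. a 0 i * (\<Prod>j<p. a (Suc j) (is ! j)))"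
    unfolding tidx_Suc sum.reindex[OF inj]
    by (intro sum.cong refl) (auto simp: prod.lessThan_Suc_shift simp del: prod.lessThan_Suc)
  also have "\<dots> = (\<Sum>i<N. a 0 i) * (\<Sum>is\<in>tidx p N. \<Prod>j<p. a (Suc j) (is ! j))"
    by (simp add: sum.cartesian_product[symmetric] sum_product)
  also have "\<dots> = (\<Prod>j<Suc p. \<Sum>i<N. a j i)"
    unfolding Suc.IH[of "\<lambda>j. a (Suc j)"] by (simp add: prod.lessThan_Suc_shift del: prod.lessThan_Suc)
  finally show ?case .
qed

text \<open>The p-linear form of the tensor x. Keeping the slots apart makes derivatives
  substitutions \<open>us(j := w)\<close> in one slot.\<close>

definition mform :: "nat \<Rightarrow> nat \<Rightarrow> (nat list \<Rightarrow> real) \<Rightarrow> (nat \<Rightarrow> fvec) \<Rightarrow> real" where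
  "mform N p x us = (\<Sum>is\<in>tidx p N. (\<Prod>j<p. coord (us j) (is ! j)) * x is)"

lemma mform_cong: "(\<And>j. j < p \<Longrightarrow> us j = ws j) \<Longrightarrow> mform N p x us = mform N p x ws"
  by (simp add: mform_def)

lemma mform_upd:
  assumes "j < p"
  shows "mform N p x (us(j := w)) =
    (\<Sum>is\<in>tidx p N. ((\<Prod>l\<in>{..<p} - {j}. coord (us l) (is ! l)) * x is) * coord w (is ! j))"
proof -
  have "(\<Prod>l<p. coord ((us(j := w)) l) (is ! l)) = coord w (is ! j) * (\<Prod>l\<in>{..<p} - {j}. coord (us l) (is ! l))" for "is"
    using assms by (subst prod.remove[of "{..<p}" j]) auto
  then show ?thesis by (simp add: mform_def mult_ac)
qed

lemma mform_linear: "j < p \<Longrightarrow> linear (\<lambda>w. mform N p x (us(j := w)))"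
  by (rule linearI) (simp add: mform_upd distrib_left sum.distrib, simp add: mform_upd sum_distrib_left mult_ac)

lemma mform_diff: "j < p \<Longrightarrow> mform N p x (us(j := a)) - mform N p x (us(j := b)) = mform N p x (us(j := a - b))"
  using linear_diff[OF mform_linear] by metis

lemma mform_scale: "mform N p x (\<lambda>j. c j *\<^sub>R us j) = (\<Prod>j<p. c j) * mform N p x us"
  by (simp add: mform_def prod.distrib sum_distrib_left mult_ac)

lemma mform_slot:
  assumes "j < p"
  obtains \<phi> where "\<And>w. mform N p x (us(j := w)) = (\<Sum>i<N. \<phi> i * coord w i)"
proof
  fix w
  define A where "A is = (\<Prod>l\<in>{..<p} - {j}. coord (us l) (is ! l)) * x is" for "is"
  have "(\<lambda>is. is ! j) ` tidx p N \<subseteq> {..<N}"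
    using assms by (auto simp: tidx_def) (meson lessThan_iff nth_mem subsetD)
  then have "(\<Sum>is\<in>tidx p N. A is * coord w (is ! j)) =
      (\<Sum>i<N. \<Sum>is | is \<in> tidx p N \<and> is ! j = i. A is * coord w (is ! j))"
    by (subst sum.group) auto
  also have "\<dots> = (\<Sum>i<N. (\<Sum>is | is \<in> tidx p N \<and> is ! j = i. A is) * coord w i)"
    unfolding sum_distrib_right by (intro sum.cong refl) auto
  finally show "mform N p x (us(j := w)) = (\<Sum>i<N. (\<Sum>is | is \<in> tidx p N \<and> is ! j = i. A is) * coord w i)"
    using assms by (simp add: mform_upd A_def)
qed

text \<open>The grid of mesh 1 / sqrt N in the ball of radius 2; the radius leaves room for rounding
  vectors of the unit ball.\<close>

definition lattice_points :: "nat \<Rightarrow> fvec set" where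
  "lattice_points N = (\<lambda>z. vec_of N (\<lambda>i. of_int (z i) / sqrt N)) `
     {z \<in> {..<N} \<rightarrow>\<^sub>E UNIV. (\<Sum>i<N. (z i)\<^sup>2) \<le> 4 * int N}"

lemma sum_half_powers: "(\<Sum>a\<in>{- int M..int M}. (1/2::real) ^ nat \<bar>a\<bar>) = 3 - 2 * (1/2) ^ M"
proof (induction M)
  case (Suc M)
  have "{- int (Suc M)..int (Suc M)} = insert (- int (Suc M)) (insert (int (Suc M)) {- int M..int M})"
    by auto
  then show ?case using Suc by (simp add: nat_add_distrib)
qed simp

text \<open>Give z the weight product of 16 * 2^(-|z_i|). It is at least 1 on the ball, as the |z_i|
  sum to at most 4 N, and its sum over a box factorises into N factors of at most 16 * 3 =
  48.\<close>

lemma card_lattice_points: "finite (lattice_points N)" "card (lattice_points N) \<le> 48 ^ N"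
proof -
  define Z where "Z = {z \<in> {..<N} \<rightarrow>\<^sub>E (UNIV :: int set). (\<Sum>i<N. (z i)\<^sup>2) \<le> 4 * int N}"
  define B where "B = {..<N} \<rightarrow>\<^sub>E {- int (4 * N)..int (4 * N)}"
  have absle: "\<bar>a\<bar> \<le> a\<^sup>2" for a :: int
  proof (cases "a = 0")
    case False
    then have "\<bar>a\<bar> * 1 \<le> \<bar>a\<bar> * \<bar>a\<bar>" by (intro mult_left_mono) auto
    then show ?thesis by (simp add: power2_eq_square)
  qed simp
  have ZB: "Z \<subseteq> B"
  proof
    fix z assume z: "z \<in> Z"
    have "\<bar>z i\<bar> \<le> 4 * int N" if "i < N" for i
    proof -
      have "(z i)\<^sup>2 \<le> (\<Sum>i<N. (z i)\<^sup>2)" using that by (intro member_le_sum) auto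
      then show ?thesis using z absle[of "z i"] by (auto simp: Z_def)
    qed
    then show "z \<in> B" using z by (auto simp: B_def Z_def PiE_iff abs_le_iff) (metis minus_le_iff)
  qed
  have finB: "finite B" unfolding B_def by (intro finite_PiE) auto
  then have finZ: "finite Z" using ZB finite_subset by auto
  have eq: "lattice_points N = (\<lambda>z. vec_of N (\<lambda>i. of_int (z i) / sqrt N)) ` Z"
    by (simp add: lattice_points_def Z_def)
  show "finite (lattice_points N)" unfolding eq using finZ by simp
  have "real (card (lattice_points N)) \<le> real (card Z)"
    unfolding eq using finZ by (simp add: card_image_le)
  also have "\<dots> = (\<Sum>z\<in>Z. 1)" by simp
  also have "\<dots> \<le> (\<Sum>z\<in>Z. \<Prod>i<N. 16 * (1/2) ^ nat \<bar>z i\<bar>)"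
  proof (intro sum_mono)
    fix z assume z: "z \<in> Z"
    have "(\<Sum>i<N. \<bar>z i\<bar>) \<le> (\<Sum>i<N. (z i)\<^sup>2)" by (intro sum_mono absle)
    then have "(\<Sum>i<N. \<bar>z i\<bar>) \<le> 4 * int N" using z by (simp add: Z_def)
    moreover have "int (\<Sum>i<N. nat \<bar>z i\<bar>) = (\<Sum>i<N. \<bar>z i\<bar>)" by simp
    ultimately have le: "(\<Sum>i<N. nat \<bar>z i\<bar>) \<le> 4 * N" by linarith
    have "(\<Prod>i<N. 16 * (1/2::real) ^ nat \<bar>z i\<bar>) = 16 ^ N * (1/2) ^ (\<Sum>i<N. nat \<bar>z i\<bar>)"
      by (simp add: prod.distrib power_sum)
    also have "\<dots> \<ge> 16 ^ N * (1/2) ^ (4 * N)"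
      using le by (intro mult_left_mono power_decreasing) auto
    also have "16 ^ N * (1/2::real) ^ (4 * N) = 1"
      by (simp add: power_mult power_mult_distrib[symmetric] power_divide)
    finally show "1 \<le> (\<Prod>i<N. 16 * (1/2::real) ^ nat \<bar>z i\<bar>)" .
  qed
  also have "\<dots> \<le> (\<Sum>z\<in>B. \<Prod>i<N. 16 * (1/2) ^ nat \<bar>z i\<bar>)"
    using finB ZB by (intro sum_mono2) (auto intro!: prod_nonneg)
  also have "\<dots> = (\<Prod>i<N. \<Sum>a\<in>{- int (4 * N)..int (4 * N)}. 16 * (1/2) ^ nat \<bar>a\<bar>)"
    unfolding B_def by (rule prod_sum_PiE[symmetric]) auto
  also have "\<dots> = (16 * (3 - 2 * (1/2) ^ (4 * N))) ^ N"
    unfolding sum_distrib_left[symmetric] sum_half_powers by simp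
  also have "\<dots> \<le> 48 ^ N"
  proof (rule power_mono)
    define q where "q = (1/2::real) ^ (4 * N)"
    have h: "0 \<le> q" "q \<le> 1" by (auto simp: q_def intro: power_le_one)
    show "16 * (3 - 2 * (1/2) ^ (4 * N)) \<le> (48::real)" "0 \<le> 16 * (3 - 2 * (1/2::real) ^ (4 * N))"
      using h unfolding q_def[symmetric] by simp_all
  qed
  finally show "card (lattice_points N) \<le> 48 ^ N" by (simp flip: of_nat_le_iff)
qed

text \<open>Each coordinate of w is rounded in the direction that raises the linear functional, so
  that passing to the grid loses nothing in its value; only the norm grows.\<close>

lemma round_to_lattice:
  assumes N: "N \<ge> 1" and w: "norm w \<le> 1"
  obtains y where "y \<in> lattice_points N" "\<bar>\<Sum>i<N. \<phi> i * coord w i\<bar> \<le> \<bar>\<Sum>i<N. \<phi> i * coord y i\<bar>"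
proof -
  define s where "s = (if (\<Sum>i<N. \<phi> i * coord w i) \<ge> 0 then 1 else -1 :: real)"
  \<comment> \<open>The value \<open>undefined\<close> beyond N puts z in the extensional function
    space that indexes the grid.\<close>
  define z where "z i = (if i < N then if s * \<phi> i \<ge> 0 then \<lceil>sqrt N * coord w i\<rceil> else \<lfloor>sqrt N * coord w i\<rfloor> else undefined)" for i
  define y where "y = vec_of N (\<lambda>i. of_int (z i) / sqrt N)"
  have sN: "sqrt N > 0" "sqrt N * sqrt N = N" using N by auto
  have cy: "coord y i = of_int (z i) / sqrt N" if "i < N" for i
    using that by (simp add: y_def)
  have dev: "\<bar>coord y i - coord w i\<bar> \<le> 1 / sqrt N" and dir: "s * \<phi> i * coord w i \<le> s * \<phi> i * coord y i"
    if i: "i < N" for i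
  proof -
    have eq: "coord y i - coord w i = (of_int (z i) - sqrt N * coord w i) / sqrt N"
      using sN by (simp add: cy[OF i] field_simps)
    have "\<bar>of_int (z i) - sqrt N * coord w i\<bar> \<le> 1" using i unfolding z_def by (auto; linarith)
    then show "\<bar>coord y i - coord w i\<bar> \<le> 1 / sqrt N"
      unfolding eq using sN by (simp add: divide_right_mono)
    have "0 \<le> (s * \<phi> i) * (of_int (z i) - sqrt N * coord w i)"
    proof (cases "0 \<le> s * \<phi> i")
      case True
      then show ?thesis using i by (intro mult_nonneg_nonneg[of "s * \<phi> i"]) (auto simp: z_def)
    next
      case False
      then show ?thesis using i by (intro mult_nonpos_nonpos[of "s * \<phi> i"]) (auto simp: z_def)
    qed
    then have "0 \<le> (s * \<phi> i) * (coord y i - coord w i)"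
      unfolding eq using sN by (metis divide_nonneg_pos times_divide_eq_right)
    then show "s * \<phi> i * coord w i \<le> s * \<phi> i * coord y i" by (simp add: algebra_simps)
  qed
  \<comment> \<open>y^2 \<le> 2 w^2 + 2 (y - w)^2 in each coordinate, with rounding error at most 1
    / sqrt N, gives squared norm at most 4.\<close>
  have "(\<Sum>i<N. (coord y i)\<^sup>2) \<le> (\<Sum>i<N. 2 * (coord w i)\<^sup>2 + 2 * (1 / N))"
  proof (intro sum_mono)
    fix i assume "i \<in> {..<N}"
    then have "\<bar>coord y i - coord w i\<bar>\<^sup>2 \<le> (1 / sqrt N)\<^sup>2" using dev by (intro power_mono) auto
    then have d: "(coord y i - coord w i)\<^sup>2 \<le> 1 / N" by (simp add: power_divide)
    have "(coord y i)\<^sup>2 \<le> 2 * (coord w i)\<^sup>2 + 2 * (coord y i - coord w i)\<^sup>2"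
      using sum_squares_bound[of "2 * coord w i" "coord y i"] zero_le_power2[of "coord y i - 2 * coord w i"]
      by (simp add: power2_eq_square algebra_simps)
    with d show "(coord y i)\<^sup>2 \<le> 2 * (coord w i)\<^sup>2 + 2 * (1 / N)" by simp
  qed
  also have "\<dots> = 2 * (\<Sum>i<N. (coord w i)\<^sup>2) + 2"
    using N by (simp add: sum.distrib sum_distrib_left)
  also have "\<dots> \<le> 4"
  proof -
    have "(norm w)\<^sup>2 \<le> 1" using w by (simp add: power_le_one)
    then show ?thesis using sum_coord_le_norm[of w N] by linarith
  qed
  finally have "(\<Sum>i<N. (of_int (z i) / sqrt N)\<^sup>2) \<le> 4" by (simp add: cy)
  then have "(\<Sum>i<N. (real_of_int (z i))\<^sup>2) \<le> 4 * N"
    using N by (simp add: power_divide sum_divide_distrib[symmetric] field_simps)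
  then have "real_of_int (\<Sum>i<N. (z i)\<^sup>2) \<le> real_of_int (4 * int N)" by simp
  then have "(\<Sum>i<N. (z i)\<^sup>2) \<le> 4 * int N" by (simp only: of_int_le_iff)
  moreover have "z \<in> {..<N} \<rightarrow>\<^sub>E UNIV" by (auto simp: z_def split: if_splits)
  ultimately have yL: "y \<in> lattice_points N" by (auto simp: lattice_points_def y_def)
  have "\<bar>\<Sum>i<N. \<phi> i * coord w i\<bar> = s * (\<Sum>i<N. \<phi> i * coord w i)" by (simp add: s_def)
  also have "\<dots> \<le> s * (\<Sum>i<N. \<phi> i * coord y i)"
    unfolding sum_distrib_left using dir by (intro sum_mono) (auto simp: mult.assoc)
  also have "\<dots> \<le> \<bar>\<Sum>i<N. \<phi> i * coord y i\<bar>" by (auto simp: s_def)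
  finally show thesis using that yL by blast
qed

lemma norm_lattice_point:
  assumes "y \<in> lattice_points N" "N \<ge> 1"
  shows "(\<Sum>i<N. (coord y i)\<^sup>2) \<le> 4"
proof -
  obtain z where z: "y = vec_of N (\<lambda>i. of_int (z i) / sqrt N)" "(\<Sum>i<N. (z i)\<^sup>2) \<le> 4 * int N"
    using assms by (auto simp: lattice_points_def)
  have "(\<Sum>i<N. (coord y i)\<^sup>2) = real_of_int (\<Sum>i<N. (z i)\<^sup>2) / N"
    by (simp add: z power_divide sum_divide_distrib)
  also have "\<dots> \<le> real_of_int (4 * int N) / N"
    using z by (intro divide_right_mono) (simp_all only: of_int_le_iff of_nat_0_le_iff)
  finally show ?thesis using assms by simp
qed

text \<open>The slots are rounded one at a time, each for the functional that the other slots
  define; homogeneity then passes from the unit ball to all vectors.\<close>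

lemma mform_bound_from_lattice:
  assumes N: "N \<ge> 1"
    and L: "\<And>us. (\<And>j. j < p \<Longrightarrow> us j \<in> lattice_points N) \<Longrightarrow> \<bar>mform N p x us\<bar> \<le> K"
  shows "\<bar>mform N p x us\<bar> \<le> K * (\<Prod>j<p. norm (us j))"
proof -
  have unit: "\<bar>mform N p x us\<bar> \<le> K"
    if "m \<le> p" "\<And>j. j < m \<Longrightarrow> norm (us j) \<le> 1" "\<And>j. m \<le> j \<Longrightarrow> j < p \<Longrightarrow> us j \<in> lattice_points N" for m us
    using that
  proof (induction m arbitrary: us)
    case 0
    then show ?case using L by simp
  next
    case (Suc m)
    then have m: "m < p" by simp
    obtain \<phi> where \<phi>: "\<And>w. mform N p x (us(m := w)) = (\<Sum>i<N. \<phi> i * coord w i)"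
      using mform_slot[OF m] by blast
    obtain y where y: "y \<in> lattice_points N" "\<bar>\<Sum>i<N. \<phi> i * coord (us m) i\<bar> \<le> \<bar>\<Sum>i<N. \<phi> i * coord y i\<bar>"
      using round_to_lattice[OF N, of "us m" \<phi>] Suc.prems(2)[of m] by auto
    have "\<bar>mform N p x us\<bar> \<le> \<bar>mform N p x (us(m := y))\<bar>"
      using y(2) unfolding \<phi>[symmetric] by simp
    also have "\<dots> \<le> K" using Suc.prems y by (intro Suc.IH) auto
    finally show ?case .
  qed
  define ws where "ws j = us j /\<^sub>R norm (us j)" for j
  have ws: "us j = norm (us j) *\<^sub>R ws j" for j
    by (cases "us j = 0") (simp_all add: ws_def)
  have "mform N p x us = (\<Prod>j<p. norm (us j)) * mform N p x ws"
    using mform_scale[of N p x "\<lambda>j. norm (us j)" ws] ws by simp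
  moreover have "\<bar>mform N p x ws\<bar> \<le> K" 
  proof (rule unit[of p])
    show "norm (ws j) \<le> 1" for j by (cases "us j = 0") (auto simp: ws_def)
  qed auto
  moreover have "0 \<le> (\<Prod>j<p. norm (us j))" by (intro prod_nonneg) auto
  ultimately show ?thesis by (simp add: abs_mult mult.commute mult_right_mono)
qed

text \<open>A union bound over tuples of grid points, which by
  \<open>mform_bound_from_lattice\<close> controls the form everywhere.\<close>

lemma mform_norm_tail:
  "\<exists>K>0. \<forall>N\<ge>1. \<exists>B\<in>sets (gaussian (tidx p N)). measure (gaussian (tidx p N)) B \<le> 2 * exp (- real N) \<and>
    (\<forall>x\<in>space (gaussian (tidx p N)) - B. \<forall>us. \<bar>mform N p x us\<bar> \<le> K * sqrt N * (\<Prod>j<p. norm (us j)))"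
proof -
  \<comment> \<open>4^p bounds the variance at a tuple of grid points, p ln 48 pays for the number
    of tuples, and the 1 leaves the factor exp(-N).\<close>
  define K where "K = sqrt (2 * 4 ^ p * (p * ln 48 + 1))"
  have ln48: "0 < ln (48::real)" by simp
  have pos: "0 < 2 * 4 ^ p * (p * ln (48::real) + 1)"
    by (intro mult_pos_pos add_nonneg_pos mult_nonneg_nonneg) auto
  have K: "K > 0" "K\<^sup>2 = 2 * 4 ^ p * (p * ln 48 + 1)" using pos by (auto simp: K_def)
  show ?thesis
  proof (intro exI[of _ K] conjI K(1) allI impI)
    fix N :: nat assume N: "N \<ge> 1"
    interpret prob_space "gaussian (tidx p N)" by (rule prob_space_gaussian)
    define U where "U = {..<p} \<rightarrow>\<^sub>E lattice_points N"
    have finU: "finite U" unfolding U_def using card_lattice_points(1) by (intro finite_PiE) auto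
    define E where "E us = {x \<in> space (gaussian (tidx p N)). K * sqrt N \<le> \<bar>mform N p x us\<bar>}" for us
    have m: "(\<lambda>x. mform N p x us) \<in> borel_measurable (gaussian (tidx p N))" for us
      unfolding mform_def by (intro borel_measurable_sum borel_measurable_times) auto
    have E: "E us \<in> sets (gaussian (tidx p N))" for us
      unfolding E_def by (intro borel_measurable_le borel_measurable_const borel_measurable_abs m)
    have PE: "prob (E us) \<le> 2 * exp (- (K\<^sup>2 * N / (2 * 4 ^ p)))" if us: "us \<in> U" for us
    proof -
      have "(\<Sum>is\<in>tidx p N. (\<Prod>j<p. coord (us j) (is ! j))\<^sup>2) = (\<Prod>j<p. \<Sum>i<N. (coord (us j) i)\<^sup>2)"
        unfolding prod_power_distrib by (rule sum_tidx_prod)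
      also have "\<dots> \<le> (\<Prod>j<p. 4)"
        using us N by (intro prod_mono conjI sum_nonneg norm_lattice_point) (auto simp: U_def)
      finally have "(\<Sum>is\<in>tidx p N. (\<Prod>j<p. coord (us j) (is ! j))\<^sup>2) \<le> 4 ^ p" by simp
      from gaussian_linear_tail[OF finite_tidx this, of "K * sqrt N"]
      show ?thesis using K(1) by (simp add: E_def mform_def power_mult_distrib)
    qed
    define B where "B = (\<Union>us\<in>U. E us)"
    have "B \<in> sets (gaussian (tidx p N))" unfolding B_def using finU E by auto
    moreover have "prob B \<le> 2 * exp (- real N)"
    proof -
      have cU: "real (card U) \<le> exp (N * p * ln 48)"
      proof -
        have "card U = card (lattice_points N) ^ p" by (simp add: U_def card_PiE)
        also have "\<dots> \<le> (48 ^ N) ^ p" by (intro power_mono card_lattice_points) simp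
        finally have "real (card U) \<le> real ((48 ^ N) ^ p)" by (simp only: of_nat_le_iff)
        moreover have "exp (N * p * ln 48) = (48::real) ^ (N * p)"
          using exp_of_nat_mult[of "N * p" "ln (48::real)"] by simp
        ultimately show ?thesis by (simp add: power_mult)
      qed
      have KN: "K\<^sup>2 * N / (2 * 4 ^ p) = N * p * ln 48 + N"
        unfolding K by (simp add: field_simps)
      have "prob B \<le> (\<Sum>us\<in>U. prob (E us))"
        unfolding B_def using finU E by (intro finite_measure_subadditive_finite) auto
      also have "\<dots> \<le> (\<Sum>us\<in>U. 2 * exp (- (K\<^sup>2 * N / (2 * 4 ^ p))))"
        by (intro sum_mono PE)
      also have "\<dots> = real (card U) * (2 * exp (- (N * p * ln 48 + N)))" by (simp add: KN)
      also have "\<dots> \<le> exp (N * p * ln 48) * (2 * exp (- (N * p * ln 48 + N)))"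
        using cU by (intro mult_right_mono) auto
      also have "\<dots> = 2 * (exp (N * p * ln 48) * exp (- (N * p * ln 48 + N)))" by simp
      also have "\<dots> = 2 * exp (- real N)" unfolding exp_add[symmetric] by simp
      finally show ?thesis .
    qed
    moreover have "\<bar>mform N p x us\<bar> \<le> K * sqrt N * (\<Prod>j<p. norm (us j))"
      if x: "x \<in> space (gaussian (tidx p N)) - B" for x us
    proof (rule mform_bound_from_lattice[OF N])
      fix us :: "nat \<Rightarrow> fvec" assume us: "\<And>j. j < p \<Longrightarrow> us j \<in> lattice_points N"
      have "restrict us {..<p} \<in> U" using us by (auto simp: U_def)
      then have "\<not> K * sqrt N \<le> \<bar>mform N p x (restrict us {..<p})\<bar>"
        using x by (auto simp: B_def E_def)
      moreover have "mform N p x (restrict us {..<p}) = mform N p x us"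
        by (rule mform_cong) simp
      ultimately show "\<bar>mform N p x us\<bar> \<le> K * sqrt N" by simp
    qed
    ultimately show "\<exists>B\<in>sets (gaussian (tidx p N)). prob B \<le> 2 * exp (- real N) \<and>
      (\<forall>x\<in>space (gaussian (tidx p N)) - B. \<forall>us. \<bar>mform N p x us\<bar> \<le> K * sqrt N * (\<Prod>j<p. norm (us j)))"
      by blast
  qed
qed

text \<open>With x the negated disorder this is the noise part of -H / N as a function of the unit
  vector; its variance at a unit vector of \<open>Rspace N\<close> is 1 / N. At p = 1 it is the
  linear field.\<close>

definition pspin :: "nat \<Rightarrow> nat \<Rightarrow> (nat list \<Rightarrow> real) \<Rightarrow> fvec \<Rightarrow> real" where
  "pspin N p x u = mform N p x (\<lambda>_. u) / sqrt N"

definition pspin_deriv :: "nat \<Rightarrow> nat \<Rightarrow> (nat list \<Rightarrow> real) \<Rightarrow> fvec \<Rightarrow> fvec \<Rightarrow> real" where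
  "pspin_deriv N p x u w = (\<Sum>j<p. mform N p x ((\<lambda>_. u)(j := w))) / sqrt N"

lemma prod_norm_upd:
  fixes p :: nat
  assumes "j < p" "\<And>l. l < p \<Longrightarrow> l \<noteq> j \<Longrightarrow> norm (us l :: fvec) = 1"
  shows "(\<Prod>l<p. norm ((us(j := w)) l)) = norm w"
  using assms by (subst prod.remove[of "{..<p}" j]) (auto intro!: prod.neutral)

text \<open>Two telescopings over slots: one from u to w, one replacing the resulting hybrid tuples
  by u inside the derivative. The remainder is bounded by p^2 terms with two slots filled by w -
  u.\<close>

lemma quad_approx_pspin:
  assumes N: "N \<ge> 1" and K: "0 \<le> K"
    and b: "\<And>us. \<bar>mform N p x us\<bar> \<le> K * sqrt N * (\<Prod>j<p. norm (us j))"
  shows "quad_approx ((real p + 1)\<^sup>2 * K) (pspin N p x) (pspin_deriv N p x)"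
  unfolding quad_approx_def
proof (intro conjI allI impI)
  have sN: "sqrt N > 0" using N by simp
  have pp: "real p * K \<le> (real p + 1)\<^sup>2 * K" "K \<le> (real p + 1)\<^sup>2 * K" "(real p)\<^sup>2 * K \<le> (real p + 1)\<^sup>2 * K"
    using K by (auto simp: power2_eq_square algebra_simps mult_nonneg_nonneg)
  fix u w :: fvec
  show "linear (pspin_deriv N p x u)"
  proof -
    have "linear (\<lambda>w. (\<Sum>j<p. mform N p x ((\<lambda>_. u)(j := w))))"
      by (intro linear_compose_sum ballI mform_linear) simp
    then show ?thesis unfolding pspin_deriv_def
      by (auto simp: linear_iff add_divide_distrib)
  qed
  assume u: "norm u = 1"
  have one: "\<bar>mform N p x ((\<lambda>_. u)(j := w))\<bar> \<le> K * sqrt N * norm w" if "j < p" for j w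
    using b[of "(\<lambda>_. u)(j := w)"] prod_norm_upd[OF that, of "\<lambda>_. u" w] u by simp
  have "\<bar>\<Sum>j<p. mform N p x ((\<lambda>_. u)(j := w))\<bar> \<le> (\<Sum>j<p. K * sqrt N * norm w)"
    by (rule order_trans[OF sum_abs sum_mono]) (use one in auto)
  also have "\<dots> = real p * K * norm w * sqrt N" by simp
  also have "\<dots> \<le> (real p + 1)\<^sup>2 * K * norm w * sqrt N"
    by (rule mult_right_mono[OF mult_right_mono[OF pp(1)]]) auto
  finally show "\<bar>pspin_deriv N p x u w\<bar> \<le> (real p + 1)\<^sup>2 * K * norm w"
    using sN by (simp add: pspin_deriv_def abs_divide pos_divide_le_eq)
  have "\<bar>mform N p x (\<lambda>_. u)\<bar> \<le> K * sqrt N" using b[of "\<lambda>_. u"] u by simp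
  also have "\<dots> \<le> (real p + 1)\<^sup>2 * K * sqrt N" by (rule mult_right_mono[OF pp(2)]) auto
  finally show "\<bar>pspin N p x u\<bar> \<le> (real p + 1)\<^sup>2 * K"
    using sN by (simp add: pspin_def abs_divide pos_divide_le_eq)
  assume w: "norm w = 1"
  define d where "d = w - u"
  \<comment> \<open>Hybrid tuple: the first m slots have already moved from u to w.\<close>
  define h where "h m = (\<lambda>j. if j < m then w else u)" for m :: nat
  have nh: "norm (h m j) = 1" for m j using u w by (simp add: h_def)
  have step: "mform N p x (h (Suc m)) - mform N p x (h m) = mform N p x ((h m)(m := d))" if "m < p" for m
  proof -
    have "h (Suc m) = (h m)(m := w)" "h m = (h m)(m := u)" by (auto simp: h_def)
    then show ?thesis using mform_diff[OF that, of N x "h m" w u] by (simp add: d_def)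
  qed
  have first: "mform N p x (\<lambda>_. w) - mform N p x (\<lambda>_. u) = (\<Sum>m<p. mform N p x ((h m)(m := d)))"
  proof -
    have "(\<Sum>m<p. mform N p x ((h m)(m := d))) = (\<Sum>m<p. mform N p x (h (Suc m)) - mform N p x (h m))"
      by (intro sum.cong refl) (simp add: step)
    also have "\<dots> = mform N p x (h p) - mform N p x (h 0)" by (rule sum_lessThan_telescope)
    also have "mform N p x (h p) = mform N p x (\<lambda>_. w)" by (rule mform_cong) (simp add: h_def)
    also have "h 0 = (\<lambda>_. u)" by (auto simp: h_def)
    finally show ?thesis by (rule sym)
  qed
  have second: "\<bar>mform N p x ((h m)(m := d)) - mform N p x ((\<lambda>_. u)(m := d))\<bar> \<le> p * (K * sqrt N * (norm d)\<^sup>2)"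
    if m: "m < p" for m
  proof -
    have st: "mform N p x ((h (Suc l))(m := d)) - mform N p x ((h l)(m := d)) = mform N p x ((h l)(m := d, l := d))"
      if "l < m" for l
    proof -
      have "(h (Suc l))(m := d) = (h l)(m := d, l := w)" "(h l)(m := d) = (h l)(m := d, l := u)"
        using that by (auto simp: h_def)
      then show ?thesis using mform_diff[of l p N x "(h l)(m := d)" w u] that m by (simp add: d_def)
    qed
    have "(\<Sum>l<m. mform N p x ((h l)(m := d, l := d))) = (\<Sum>l<m. mform N p x ((h (Suc l))(m := d)) - mform N p x ((h l)(m := d)))"
      by (intro sum.cong refl) (simp add: st)
    also have "\<dots> = mform N p x ((h m)(m := d)) - mform N p x ((h 0)(m := d))" by (rule sum_lessThan_telescope)
    also have "h 0 = (\<lambda>_. u)" by (auto simp: h_def)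
    finally have eq: "mform N p x ((h m)(m := d)) - mform N p x ((\<lambda>_. u)(m := d)) = (\<Sum>l<m. mform N p x ((h l)(m := d, l := d)))"
      by (rule sym)
    have "\<bar>mform N p x ((h l)(m := d, l := d))\<bar> \<le> K * sqrt N * (norm d)\<^sup>2" if "l < m" for l
    proof -
      have "(\<Prod>j<p. norm (((h l)(m := d, l := d)) j)) = norm d * (\<Prod>j\<in>{..<p} - {l}. norm (((h l)(m := d)) j))"
        using that m by (subst prod.remove[of "{..<p}" l]) auto
      also have "(\<Prod>j\<in>{..<p} - {l}. norm (((h l)(m := d)) j)) = norm d"
        using that m nh by (subst prod.remove[of "{..<p} - {l}" m]) (auto intro!: prod.neutral)
      finally have P: "(\<Prod>j<p. norm (((h l)(m := d, l := d)) j)) = norm d * norm d" .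
      show ?thesis using b[of "(h l)(m := d, l := d)"] unfolding P by (simp only: power2_eq_square)
    qed
    then have "\<bar>\<Sum>l<m. mform N p x ((h l)(m := d, l := d))\<bar> \<le> (\<Sum>l<m. K * sqrt N * (norm d)\<^sup>2)"
      by (intro order_trans[OF sum_abs sum_mono]) auto
    also have "\<dots> \<le> p * (K * sqrt N * (norm d)\<^sup>2)" using m K by (auto intro!: mult_right_mono)
    finally show ?thesis unfolding eq .
  qed
  have "\<bar>(\<Sum>m<p. mform N p x ((h m)(m := d))) - (\<Sum>m<p. mform N p x ((\<lambda>_. u)(m := d)))\<bar> \<le> (\<Sum>m<p. p * (K * sqrt N * (norm d)\<^sup>2))"
    unfolding sum_subtractf[symmetric] by (rule order_trans[OF sum_abs sum_mono]) (use second in auto)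
  also have "\<dots> = (real p)\<^sup>2 * K * (norm d)\<^sup>2 * sqrt N" by (simp add: power2_eq_square)
  also have "\<dots> \<le> (real p + 1)\<^sup>2 * K * (norm d)\<^sup>2 * sqrt N"
    by (rule mult_right_mono[OF mult_right_mono[OF pp(3)]]) auto
  finally have "\<bar>mform N p x (\<lambda>_. w) - mform N p x (\<lambda>_. u) - (\<Sum>m<p. mform N p x ((\<lambda>_. u)(m := d)))\<bar> / sqrt N
      \<le> (real p + 1)\<^sup>2 * K * (norm d)\<^sup>2"
    unfolding first using sN by (simp add: pos_divide_le_eq)
  then show "\<bar>pspin N p x w - pspin N p x u - pspin_deriv N p x u (w - u)\<bar> \<le> (real p + 1)\<^sup>2 * K * (norm (w - u))\<^sup>2"
    using sN by (simp add: pspin_def pspin_deriv_def d_def diff_divide_distrib[symmetric] abs_divide)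
qed

section \<open>The tangential gradient as a Gaussian vector\<close>

text \<open>For suprema over a sphere, which are uncountable: a Lipschitz bound in finitely many
  coordinates gives continuity and hence measurability.\<close>

lemma lipschitz_measurable_gaussian:
  fixes f :: "('i::countable \<Rightarrow> real) \<Rightarrow> real"
  assumes "finite A" and lip: "\<And>x y. \<bar>f x - f y\<bar> \<le> (\<Sum>i\<in>A. \<bar>x i - y i\<bar>)"
  shows "f \<in> borel_measurable (gaussian A)"
proof -
  have "isCont f x" for x
  proof -
    have c: "isCont (\<lambda>y :: 'i \<Rightarrow> real. y i) x" for i
    proof -
      have "continuous_on UNIV (\<lambda>y :: 'i \<Rightarrow> real. y i)" 
        using continuous_on_product_then_coordinatewise[OF continuous_on_id] .
      then show ?thesis 
        unfolding continuous_on_eq_continuous_at[OF open_UNIV] by (rule bspec) simp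
    qed
    have "((\<lambda>y. \<Sum>i\<in>A. \<bar>y i - x i\<bar>) \<longlongrightarrow> (\<Sum>i\<in>A. \<bar>x i - x i\<bar>)) (at x)"
      by (intro tendsto_sum tendsto_rabs tendsto_diff tendsto_const isContD[OF c])
    then have z: "((\<lambda>y. \<Sum>i\<in>A. \<bar>y i - x i\<bar>) \<longlongrightarrow> 0) (at x)"
      by simp
    have "((\<lambda>y. f y - f x) \<longlongrightarrow> 0) (at x)"
    proof (rule Lim_null_comparison[OF _ z])
      show "\<forall>\<^sub>F y in at x. norm (f y - f x) \<le> (\<Sum>i\<in>A. \<bar>y i - x i\<bar>)"
        by (rule always_eventually) (simp add: lip)
    qed
    then show ?thesis unfolding isCont_def by (rule LIM_zero_cancel)
  qed
  then have "f \<in> borel_measurable borel"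
    by (intro borel_measurable_continuous_onI continuous_at_imp_continuous_on) auto
  then have fm: "f \<in> borel_measurable (PiM UNIV (\<lambda>_. borel))"
    unfolding measurable_cong_sets[OF sets_PiM_equal_borel refl] .
  \<comment> \<open>f lives on all functions, where countability of the index type identifies the
    Borel sets with the product sets. Extension by 0 from A leaves the value of f unchanged.\<close>
  have "(\<lambda>x :: 'i \<Rightarrow> real. f (\<lambda>i. if i \<in> A then x i else 0)) \<in> borel_measurable (gaussian A)"
  proof (rule measurable_compose[OF _ fm])
    show "(\<lambda>x i. if i \<in> A then x i else 0) \<in> measurable (gaussian A) (Pi\<^sub>M UNIV (\<lambda>_. borel))"
    proof (rule measurable_PiM_single')
      show "(\<lambda>x. if i \<in> A then x i else 0) \<in> borel_measurable (gaussian A)" for i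
      proof (cases "i \<in> A")
        case True
        show ?thesis unfolding if_P[OF True] by (rule measurable_gaussian_component[OF True])
      qed (simp only: if_False measurable_const UNIV_I space_borel)
    qed (simp only: space_borel PiE_UNIV_domain Pi_UNIV UNIV_I subset_UNIV Pi_I)
  qed
  moreover have "f (\<lambda>i. if i \<in> A then x i else 0) = f x" for x
  proof -
    have "(\<Sum>i\<in>A. \<bar>(if i \<in> A then x i else 0) - x i\<bar>) = 0"
      by (rule sum.neutral) simp
    then show ?thesis using lip[of "\<lambda>i. if i \<in> A then x i else 0" x] by linarith
  qed
  ultimately show ?thesis by (simp only:)
qed

lemma abs_SUP_diff_le:
  fixes F G :: "'a \<Rightarrow> real"
  assumes "D \<noteq> {}" "bdd_above (F ` D)" "bdd_above (G ` D)" "\<And>u. u \<in> D \<Longrightarrow> \<bar>F u - G u\<bar> \<le> c"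
  shows "\<bar>(SUP u\<in>D. F u) - (SUP u\<in>D. G u)\<bar> \<le> c"
proof -
  have "(SUP u\<in>D. F u) \<le> (SUP u\<in>D. G u) + c"
  proof (rule cSUP_least[OF assms(1)])
    fix u assume u: "u \<in> D"
    have "G u \<le> (SUP u\<in>D. G u)" using assms u by (intro cSUP_upper)
    then show "F u \<le> (SUP u\<in>D. G u) + c" using assms(4)[OF u] by linarith
  qed
  moreover have "(SUP u\<in>D. G u) \<le> (SUP u\<in>D. F u) + c"
  proof (rule cSUP_least[OF assms(1)])
    fix u assume u: "u \<in> D"
    have "F u \<le> (SUP u\<in>D. F u)" using assms u by (intro cSUP_upper)
    then show "G u \<le> (SUP u\<in>D. F u) + c" using assms(4)[OF u] by linarith
  qed
  ultimately show ?thesis by linarith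
qed

text \<open>Conditioning on the shared factor: an inequality for each good y integrates to one for
  the product measures. Since it is asked fibre by fibre, the coupling behind it may be chosen
  separately for each y.\<close>

lemma measure_pair_compare:
  assumes "prob_space M" "prob_space N1" "prob_space N2"
    and F: "F1 \<in> sets (M \<Otimes>\<^sub>M N1)" "F2 \<in> sets (M \<Otimes>\<^sub>M N2)" "B \<in> sets M"
    and \<beta>: "0 \<le> \<beta>"
    and le: "\<And>y. y \<in> space M - B \<Longrightarrow> measure N1 (Pair y -` F1) \<le> measure N2 (Pair y -` F2) + \<beta>"
  shows "measure (M \<Otimes>\<^sub>M N1) F1 \<le> measure (M \<Otimes>\<^sub>M N2) F2 + measure M B + \<beta>"
proof -
  interpret M: prob_space M by fact
  interpret N1: prob_space N1 by fact
  interpret N2: prob_space N2 by fact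
  interpret P1: pair_prob_space M N1 ..
  interpret P2: pair_prob_space M N2 ..
  have "emeasure (M \<Otimes>\<^sub>M N1) F1 = (\<integral>\<^sup>+y. emeasure N1 (Pair y -` F1) \<partial>M)"
    by (rule N1.emeasure_pair_measure_alt[OF F(1)])
  also have "\<dots> \<le> (\<integral>\<^sup>+y. emeasure N2 (Pair y -` F2) + indicator B y + ennreal \<beta> \<partial>M)"
  proof (rule nn_integral_mono)
    fix y assume y: "y \<in> space M"
    show "emeasure N1 (Pair y -` F1) \<le> emeasure N2 (Pair y -` F2) + indicator B y + ennreal \<beta>"
    proof (cases "y \<in> B")
      case True
      have "emeasure N1 (Pair y -` F1) \<le> 1" by (rule N1.emeasure_le_1)
      also have "1 \<le> emeasure N2 (Pair y -` F2) + indicator B y + ennreal \<beta>"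
        using True by (auto simp: indicator_def intro: add_increasing2 add_increasing)
      finally show ?thesis .
    next
      case False
      then show ?thesis using le[of y] y \<beta>
        by (simp add: N1.emeasure_eq_measure N2.emeasure_eq_measure ennreal_plus[symmetric] del: ennreal_plus)
    qed
  qed
  also have "\<dots> = (\<integral>\<^sup>+y. emeasure N2 (Pair y -` F2) \<partial>M) + emeasure M B + ennreal \<beta>"
    using N2.measurable_emeasure_Pair[OF F(2)] F(3)
    by (simp add: nn_integral_add M.emeasure_space_1)
  also have "(\<integral>\<^sup>+y. emeasure N2 (Pair y -` F2) \<partial>M) = emeasure (M \<Otimes>\<^sub>M N2) F2"
    by (rule N2.emeasure_pair_measure_alt[OF F(2), symmetric])
  finally show ?thesis
    using \<beta> by (simp add: P1.emeasure_eq_measure P2.emeasure_eq_measure M.emeasure_eq_measure ennreal_plus[symmetric] del: ennreal_plus)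
qed

text \<open>A rotation acting on the block T only. It splits an independent increment off that block
  and keeps the law.\<close>

lemma gaussian_split:
  assumes "finite I" "T \<subseteq> I" "a\<^sup>2 + b\<^sup>2 = 1"
  shows "distr (gaussian I \<Otimes>\<^sub>M gaussian T) (gaussian I)
    (\<lambda>w. \<lambda>i\<in>I. if i \<in> T then a * fst w i + b * snd w i else fst w i) = gaussian I"
proof -
  have fT: "finite T" using assms finite_subset by auto
  let ?L = "\<lambda>j i. if i = j then (if j \<in> T then a else 1) else 0"
  let ?R = "\<lambda>j i. if i = j then b else 0"
  have d: "(\<Sum>i\<in>A. (if i = j then c else 0) * g i) = (if j \<in> A then c * g j else 0)"
    if "finite A" for A and j :: 'a and c :: real and g
    using that by (simp add: mult_delta_left)
  have "(\<lambda>w. \<lambda>j\<in>I. (\<Sum>i\<in>I. ?L j i * fst w i) + (\<Sum>i\<in>T. ?R j i * snd w i))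
    = (\<lambda>w. \<lambda>i\<in>I. if i \<in> T then a * fst w i + b * snd w i else fst w i)"
    unfolding d[OF assms(1)] d[OF fT] by (intro ext restrict_ext) auto
  moreover have "(\<Sum>i\<in>I. ?L j i * ?L l i) + (\<Sum>i\<in>T. ?R j i * ?R l i) = (if j = l then 1 else 0)"
    if "j \<in> I" "l \<in> I" for j l
    unfolding d[OF assms(1)] d[OF fT] using that assms(3) by (auto simp: power2_eq_square)
  ultimately show ?thesis
    using gaussian_pair_linear[of I T I ?L ?R] assms fT by simp
qed

lemma measurable_restrict_gaussian:
  assumes "\<And>i. i \<in> I \<Longrightarrow> f i \<in> borel_measurable M"
  shows "(\<lambda>w. \<lambda>i\<in>I. f i w) \<in> measurable M (gaussian I)"
  unfolding measurable_cong_sets[OF refl sets_gaussian] by (rule measurable_restrict) (use assms in auto)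

lemma measurable_gaussian_fst:
  "i \<in> I \<Longrightarrow> (\<lambda>w. fst w i) \<in> borel_measurable (gaussian I \<Otimes>\<^sub>M M)"
  by (rule measurable_compose[OF measurable_fst measurable_gaussian_component])

lemma measurable_gaussian_snd:
  "i \<in> I \<Longrightarrow> (\<lambda>w. snd w i) \<in> borel_measurable (M \<Otimes>\<^sub>M gaussian I)"
  by (rule measurable_compose[OF measurable_snd measurable_gaussian_component])

lemma pspin_combine:
  assumes "\<And>is. is \<in> tidx p N \<Longrightarrow> x is = a * y is + b * z is"
  shows "pspin N p x u = a * pspin N p y u + b * pspin N p z u"
proof -
  have "mform N p x us = a * mform N p y us + b * mform N p z us" for us
  proof -
    have "mform N p x us = (\<Sum>is\<in>tidx p N. a * ((\<Prod>j<p. coord (us j) (is ! j)) * y is) + b * ((\<Prod>j<p. coord (us j) (is ! j)) * z is))"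
      unfolding mform_def by (intro sum.cong refl) (simp add: assms algebra_simps)
    then show ?thesis by (simp add: mform_def sum.distrib sum_distrib_left)
  qed
  then show ?thesis by (simp add: pspin_def add_divide_distrib)
qed

lemma pspin_cong: "(\<And>is. is \<in> tidx p N \<Longrightarrow> x is = y is) \<Longrightarrow> pspin N p x u = pspin N p y u"
  using pspin_combine[of p N x 1 y 0 y u] by simp

lemma abs_pspin_le:
  assumes "N \<ge> 1" "norm u = 1"
  shows "\<bar>pspin N p x u\<bar> \<le> (\<Sum>is\<in>tidx p N. \<bar>x is\<bar>)"
proof -
  have "\<bar>mform N p x (\<lambda>_. u)\<bar> \<le> (\<Sum>is\<in>tidx p N. \<bar>x is\<bar>)"
    unfolding mform_def
  proof (rule order_trans[OF sum_abs sum_mono])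
    fix "is"
    have "\<bar>\<Prod>j<p. coord u (is ! j)\<bar> \<le> 1"
      unfolding abs_prod using abs_coord_le_norm[of u] assms by (intro prod_le_1) auto
    then show "\<bar>(\<Prod>j<p. coord u (is ! j)) * x is\<bar> \<le> \<bar>x is\<bar>"
      unfolding abs_mult by (rule mult_left_le_one_le[rotated 2]) auto
  qed
  moreover have "\<bar>pspin N p x u\<bar> \<le> \<bar>mform N p x (\<lambda>_. u)\<bar>"
    using assms by (simp add: pspin_def abs_divide divide_le_eq mult_le_cancel_left1)
  ultimately show ?thesis by linarith
qed

section \<open>The tangential gradient map\<close>

lemma tidx_1: "tidx 1 N = (\<lambda>i. [i]) ` {..<N}"
proof -
  have "is \<in> (\<lambda>i. [i]) ` {..<N}" if "is \<in> tidx 1 N" for "is"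
    using that by (cases "is") (auto simp: tidx_def)
  then show ?thesis by (auto simp: tidx_def)
qed

lemma pspin_1: "pspin N 1 g y = (\<Sum>i<N. coord y i * g [i]) / sqrt N"
  unfolding pspin_def mform_def tidx_1 by (subst sum.reindex) (auto simp: inj_on_def)

text \<open>The coefficients of the linear field whose slope at the unit vector u is the tangential
  gradient of the p-spin field; the missing radial component is supplied by an independent normal.\<close>

definition tangent_coeff :: "nat \<Rightarrow> nat \<Rightarrow> fvec \<Rightarrow> nat \<Rightarrow> nat list \<Rightarrow> real" where
  "tangent_coeff N p u i is = (\<Sum>j<p. \<Prod>l<p. coord (((\<lambda>_. u)(j :=
     vec_of N (\<lambda>l. if l = i then 1 else 0) - coord u i *\<^sub>R u)) l) (is ! l)) / sqrt p"

text \<open>The row of i is a normalised sum of p rank-one tensors, each with \<open>P i\<close> in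
  one slot and u in the others, where \<open>P i\<close> is the projection of a basis vector
  orthogonally to u. Terms with different special slots are orthogonal because \<open>P i\<close> is
  orthogonal to u. The p equal diagonal terms give the inner product of the projections, which falls
  short of the identity by the radial term.\<close>

lemma tangent_coeff_orthonormal:
  assumes p: "p \<ge> 1" and u: "u \<in> Rspace N" "norm u = 1" and i: "i < N" "i' < N"
  shows "(\<Sum>is\<in>tidx p N. tangent_coeff N p u i is * tangent_coeff N p u i' is) + coord u i * coord u i'
    = (if i = i' then 1 else 0)"
proof -
  define e where "e i = vec_of N (\<lambda>l. if l = i then 1 else 0)" for i
  define P where "P i = e i - coord u i *\<^sub>R u" for i
  have eR: "e i \<in> Rspace N" for i by (simp add: e_def)
  have PR: "P i \<in> Rspace N" for i
    unfolding P_def using subspace_Rspace eR u by (intro subspace_diff subspace_scale) auto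
  have eu: "e i \<bullet> x = coord x i" if "i < N" for i x
    unfolding inner_Rspace[OF eR] using that by (simp add: e_def if_distrib[of "\<lambda>t. t * _"] cong: if_cong)
  have uu: "u \<bullet> u = 1" using u by (simp add: norm_eq_1)
  have Pu: "P i \<bullet> u = 0" if "i < N" for i
    using that by (simp add: P_def inner_diff_left eu uu)
  have PP: "P i \<bullet> P i' = (if i = i' then 1 else 0) - coord u i * coord u i'"
  proof -
    have "P i \<bullet> P i' = P i \<bullet> e i' - coord u i' * (P i \<bullet> u)"
      unfolding P_def[of i'] by (simp add: inner_diff_right)
    also have "P i \<bullet> e i' = e i' \<bullet> P i" by (rule inner_commute)
    also have "\<dots> = coord (P i) i'" using i by (simp add: eu)
    finally show ?thesis using i by (simp add: Pu) (simp add: P_def e_def)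
  qed
  define a where "a j i = (\<lambda>_. u)(j := P i)" for j :: nat and i
  have aR: "a j i l \<in> Rspace N" for j i l using u PR by (simp add: a_def)
  have tc: "tangent_coeff N p u i is = (\<Sum>j<p. \<Prod>l<p. coord (a j i l) (is ! l)) / sqrt p" for i "is"
    by (simp add: tangent_coeff_def a_def P_def e_def)
  have inn: "(\<Sum>is\<in>tidx p N. (\<Prod>l<p. coord (a j i l) (is ! l)) * (\<Prod>l<p. coord (a j' i' l) (is ! l)))
     = (if j = j' then P i \<bullet> P i' else 0)" if j: "j < p" "j' < p" for j j'
  proof -
    have "(\<Sum>is\<in>tidx p N. (\<Prod>l<p. coord (a j i l) (is ! l)) * (\<Prod>l<p. coord (a j' i' l) (is ! l)))
      = (\<Prod>l<p. a j i l \<bullet> a j' i' l)"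
      unfolding inner_Rspace[OF aR] prod.distrib[symmetric] by (rule sum_tidx_prod)
    also have "\<dots> = (if j = j' then P i \<bullet> P i' else 0)"
    proof (cases "j = j'")
      case True
      then show ?thesis using j uu
        by (subst prod.remove[of "{..<p}" j]) (auto simp: a_def intro!: prod.neutral)
    next
      case False
      then have "a j i j \<bullet> a j' i' j = 0" using i by (simp add: a_def Pu)
      then show ?thesis using False j by (auto intro!: prod_zero)
    qed
    finally show ?thesis .
  qed
  have "(\<Sum>is\<in>tidx p N. tangent_coeff N p u i is * tangent_coeff N p u i' is)
     = (\<Sum>is\<in>tidx p N. \<Sum>j<p. \<Sum>j'<p. (\<Prod>l<p. coord (a j i l) (is ! l)) * (\<Prod>l<p. coord (a j' i' l) (is ! l))) / p"
    unfolding tc times_divide_times_eq real_sqrt_mult_self sum_product by (simp add: sum_divide_distrib)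
  also have "\<dots> = (\<Sum>j<p. \<Sum>j'<p. \<Sum>is\<in>tidx p N. (\<Prod>l<p. coord (a j i l) (is ! l)) * (\<Prod>l<p. coord (a j' i' l) (is ! l))) / p"
    by (subst sum.swap, intro arg_cong2[where f="(/)"] sum.cong refl, rule sum.swap)
  also have "\<dots> = (\<Sum>j<p. \<Sum>j'<p. if j = j' then P i \<bullet> P i' else 0) / p"
    by (intro arg_cong2[where f="(/)"] sum.cong refl inn) auto
  also have "\<dots> = P i \<bullet> P i'" using p by simp
  finally show ?thesis by (simp add: PP)
qed

text \<open>The radial normal is a family over the one-point index type, so both inputs have the
  form \<open>gaussian\<close> and \<open>gaussian_pair_linear\<close> applies.\<close>

definition tangent_map :: "nat \<Rightarrow> nat \<Rightarrow> fvec \<Rightarrow> (nat list \<Rightarrow> real) \<times> (unit \<Rightarrow> real) \<Rightarrow> nat list \<Rightarrow> real" where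
  "tangent_map N p u w = (\<lambda>j\<in>tidx 1 N. (\<Sum>is\<in>tidx p N. tangent_coeff N p u (j ! 0) is * fst w is)
     + (\<Sum>c\<in>{()}. coord u (j ! 0) * snd w c))"

lemma tangent_map_law:
  assumes "p \<ge> 1" "u \<in> Rspace N" "norm u = 1"
  shows "distr (gaussian (tidx p N) \<Otimes>\<^sub>M gaussian {()}) (gaussian (tidx 1 N)) (tangent_map N p u) = gaussian (tidx 1 N)"
  unfolding tangent_map_def[abs_def]
proof (rule gaussian_pair_linear)
  fix j l assume "j \<in> tidx 1 N" "l \<in> tidx 1 N"
  then obtain i i' where i: "j = [i]" "l = [i']" "i < N" "i' < N" unfolding tidx_1 by auto
  show "(\<Sum>is\<in>tidx p N. tangent_coeff N p u (j ! 0) is * tangent_coeff N p u (l ! 0) is) +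
      (\<Sum>c\<in>{()}. coord u (j ! 0) * coord u (l ! 0)) = (if j = l then 1 else 0)"
    using tangent_coeff_orthonormal[OF assms i(3,4)] i by simp
qed auto

text \<open>Identifies the coupled linear field with the \<open>lf\<close> of
  \<open>tangent_field_coupling\<close>; the radial slope is the radial normal times sqrt p / sqrt
  N.\<close>

lemma pspin_tangent_map:
  assumes p: "p \<ge> 1" and u: "u \<in> Rspace N" and y: "y \<in> Rspace N"
  shows "sqrt p * pspin N 1 (tangent_map N p u w) y =
    pspin_deriv N p (fst w) u (y - (y \<bullet> u) *\<^sub>R u) + sqrt p * snd w () / sqrt N * (y \<bullet> u)"
proof -
  define e where "e i = vec_of N (\<lambda>l. if l = i then 1 else 0)" for i
  define Py where "Py = y - (y \<bullet> u) *\<^sub>R u"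
  define t where "t j is = (\<Prod>l\<in>{..<p} - {j}. coord u (is ! l))" for j and "is" :: "nat list"
  have yu: "y \<bullet> u = (\<Sum>i<N. coord y i * coord u i)" by (rule inner_Rspace[OF y])
  have expand: "(\<Prod>l<p. coord (((\<lambda>_. u)(j := z)) l) (is ! l)) = t j is * coord z (is ! j)" if "j < p" for j z "is"
    using that unfolding t_def by (subst prod.remove[of "{..<p}" j]) auto
  have lin: "(\<Sum>i<N. coord y i * coord (e i - coord u i *\<^sub>R u) m) = coord Py m" if "m < N" for m
  proof -
    have "(\<Sum>i<N. coord y i * coord (e i - coord u i *\<^sub>R u) m) = (\<Sum>i<N. coord y i * (if m = i then 1 else 0)) - (\<Sum>i<N. coord y i * coord u i) * coord u m"
      using that by (simp add: e_def right_diff_distrib sum_subtractf sum_distrib_right mult.assoc)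
    then show ?thesis using that by (simp add: Py_def yu if_distrib[of "times _"] cong: if_cong)
  qed
  have coeff: "(\<Sum>i<N. coord y i * tangent_coeff N p u i is) = (\<Sum>j<p. t j is * coord Py (is ! j)) / sqrt p"
    if "is": "is \<in> tidx p N" for "is"
  proof -
    have "tangent_coeff N p u i is = (\<Sum>j<p. t j is * coord (e i - coord u i *\<^sub>R u) (is ! j)) / sqrt p" for i
      unfolding tangent_coeff_def e_def[symmetric] by (intro arg_cong2[where f="(/)"] sum.cong refl expand) auto
    then have "(\<Sum>i<N. coord y i * tangent_coeff N p u i is) =
       (\<Sum>i<N. \<Sum>j<p. t j is * (coord y i * coord (e i - coord u i *\<^sub>R u) (is ! j))) / sqrt p"
      by (simp add: sum_distrib_left sum_divide_distrib mult_ac del: coord_simps)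
    also have "\<dots> = (\<Sum>j<p. \<Sum>i<N. t j is * (coord y i * coord (e i - coord u i *\<^sub>R u) (is ! j))) / sqrt p"
      by (subst sum.swap) simp
    also have "\<dots> = (\<Sum>j<p. t j is * coord Py (is ! j)) / sqrt p"
    proof (intro arg_cong2[where f="(/)"] sum.cong refl)
      fix j assume "j \<in> {..<p}"
      then have "is ! j < N" using "is" by (auto simp: tidx_def) (meson lessThan_iff nth_mem subsetD)
      then show "(\<Sum>i<N. t j is * (coord y i * coord (e i - coord u i *\<^sub>R u) (is ! j))) = t j is * coord Py (is ! j)"
        unfolding sum_distrib_left[symmetric] by (simp add: lin del: coord_simps)
    qed
    finally show ?thesis .
  qed
  have "(\<Sum>i<N. coord y i * tangent_map N p u w [i]) =
     (\<Sum>i<N. \<Sum>is\<in>tidx p N. coord y i * tangent_coeff N p u i is * fst w is) + (\<Sum>i<N. coord y i * coord u i) * snd w ()"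
  proof -
    have "tangent_map N p u w [i] = (\<Sum>is\<in>tidx p N. tangent_coeff N p u i is * fst w is) + coord u i * snd w ()"
      if "i < N" for i
      using that unfolding tangent_map_def tidx_1 by simp
    then show ?thesis
      by (simp add: distrib_left sum.distrib sum_distrib_left sum_distrib_right mult.assoc)
  qed
  also have "(\<Sum>i<N. \<Sum>is\<in>tidx p N. coord y i * tangent_coeff N p u i is * fst w is)
     = (\<Sum>is\<in>tidx p N. (\<Sum>i<N. coord y i * tangent_coeff N p u i is) * fst w is)"
    by (subst sum.swap) (simp add: sum_distrib_right)
  also have "\<dots> = (\<Sum>is\<in>tidx p N. (\<Sum>j<p. t j is * coord Py (is ! j)) / sqrt p * fst w is)"
    by (intro sum.cong refl) (simp add: coeff)
  also have "\<dots> = (\<Sum>is\<in>tidx p N. \<Sum>j<p. t j is * coord Py (is ! j) * fst w is) / sqrt p"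
    by (simp add: sum_divide_distrib sum_distrib_right)
  also have "(\<Sum>is\<in>tidx p N. \<Sum>j<p. t j is * coord Py (is ! j) * fst w is) = (\<Sum>j<p. mform N p (fst w) ((\<lambda>_. u)(j := Py)))"
    unfolding mform_def by (subst sum.swap, intro sum.cong refl) (simp add: expand del: fun_upd_apply)
  finally have "(\<Sum>i<N. coord y i * tangent_map N p u w [i]) = (\<Sum>j<p. mform N p (fst w) ((\<lambda>_. u)(j := Py))) / sqrt p + (y \<bullet> u) * snd w ()"
    by (simp add: yu)
  then show ?thesis
    unfolding pspin_1 pspin_deriv_def Py_def[symmetric] using p
    by (simp add: distrib_left add_divide_distrib)
qed

section \<open>Interpolation to a linear field\<close>

definition field :: "nat \<Rightarrow> nat \<Rightarrow> nat \<Rightarrow> real \<Rightarrow> fvec \<Rightarrow> real \<Rightarrow> real \<Rightarrow> (nat list \<Rightarrow> real) \<Rightarrow> fvec \<Rightarrow> real" where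
  "field N p k lam v s r x u = s * pspin N p x u + r * pspin N 1 x u + lam / real k * (u \<bullet> v) ^ k"

definition field_sup :: "nat \<Rightarrow> nat \<Rightarrow> nat \<Rightarrow> real \<Rightarrow> fvec \<Rightarrow> real \<Rightarrow> real \<Rightarrow> (nat list \<Rightarrow> real) \<Rightarrow> real" where
  "field_sup N p k lam v s r x = (SUP u\<in>halfsphere (Rspace N) v. field N p k lam v s r x u)"

text \<open>Since p is not 1, one Gaussian family indexed by lists of length p and lists of length 1
  carries both the tensor and the independent linear field.\<close>

abbreviation idx :: "nat \<Rightarrow> nat \<Rightarrow> nat list set" where
  "idx p N \<equiv> tidx p N \<union> tidx 1 N"

lemma halfsphere_self: "v \<in> W \<Longrightarrow> norm v = 1 \<Longrightarrow> v \<in> halfsphere W v"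
  by (simp add: halfsphere_def)

lemma abs_signal_le:
  assumes "norm u = 1" "norm v = 1"
  shows "\<bar>lam / real k * (u \<bullet> v) ^ k\<bar> \<le> \<bar>lam / real k\<bar>"
proof -
  have "\<bar>u \<bullet> v\<bar> \<le> 1" using Cauchy_Schwarz_ineq2[of u v] assms by simp
  then have "\<bar>(u \<bullet> v) ^ k\<bar> \<le> 1" by (simp add: power_abs power_le_one)
  then show ?thesis unfolding abs_mult by (intro mult_left_le) auto
qed

lemma field_le:
  assumes "N \<ge> 1" "norm u = 1" "norm v = 1"
  shows "field N p k lam v s r x u \<le> \<bar>s\<bar> * (\<Sum>is\<in>tidx p N. \<bar>x is\<bar>) + \<bar>r\<bar> * (\<Sum>is\<in>tidx 1 N. \<bar>x is\<bar>) + \<bar>lam / real k\<bar>"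
proof -
  have "\<bar>s * pspin N p x u\<bar> \<le> \<bar>s\<bar> * (\<Sum>is\<in>tidx p N. \<bar>x is\<bar>)"
    unfolding abs_mult using abs_pspin_le assms by (intro mult_left_mono) auto
  moreover have "\<bar>r * pspin N 1 x u\<bar> \<le> \<bar>r\<bar> * (\<Sum>is\<in>tidx 1 N. \<bar>x is\<bar>)"
    unfolding abs_mult using abs_pspin_le assms by (intro mult_left_mono) auto
  ultimately show ?thesis
    using abs_signal_le[OF assms(2,3), of lam k] unfolding field_def by linarith
qed

lemma bdd_field:
  assumes "N \<ge> 1" "norm v = 1"
  shows "bdd_above (field N p k lam v s r x ` halfsphere (Rspace N) v)"
  using assms field_le by (intro bdd_aboveI2) (auto simp: halfsphere_def)

lemma field_combine:
  assumes "\<And>is. is \<in> tidx p N \<Longrightarrow> s * x is = s' * y is + e * z is"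
    and "\<And>is. is \<in> tidx 1 N \<Longrightarrow> r * x is = r' * y is + e' * z is"
  shows "field N p k lam v s r x u = field N p k lam v s' r' y u + e * pspin N p z u + e' * pspin N 1 z u"
proof -
  have sc: "c * pspin N q x u = pspin N q (\<lambda>is. c * x is) u" for c q x
    by (subst (2) pspin_combine[where a=c and y=x and b=0 and z=x]) auto
  have "s * pspin N p x u = s' * pspin N p y u + e * pspin N p z u"
    unfolding sc[of s] by (rule pspin_combine[OF assms(1)])
  moreover have "r * pspin N 1 x u = r' * pspin N 1 y u + e' * pspin N 1 z u"
    unfolding sc[of r] by (rule pspin_combine[OF assms(2)])
  ultimately show ?thesis by (simp add: field_def)
qed

lemma field_sup_measurable:
  assumes "N \<ge> 1" "v \<in> Rspace N" "norm v = 1"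
  shows "field_sup N p k lam v s r \<in> borel_measurable (gaussian (idx p N))"
proof -
  \<comment> \<open>The summand 1 keeps c positive when s = r = 0.\<close>
  define c where "c = \<bar>s\<bar> + \<bar>r\<bar> + 1"
  have c: "c > 0" by (simp add: c_def)
  have L: "\<bar>field_sup N p k lam v s r x / c - field_sup N p k lam v s r y / c\<bar> \<le> (\<Sum>i\<in>idx p N. \<bar>x i - y i\<bar>)" for x y
  proof -
    have "\<bar>field_sup N p k lam v s r x - field_sup N p k lam v s r y\<bar> \<le> c * (\<Sum>i\<in>idx p N. \<bar>x i - y i\<bar>)"
      unfolding field_sup_def
    proof (rule abs_SUP_diff_le[OF _ bdd_field bdd_field])
      fix u assume u: "u \<in> halfsphere (Rspace N) v"
      then have nu: "norm u = 1" by (simp add: halfsphere_def)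
      define d where "d i = x i - y i" for i
      have "field N p k lam v s r x u = field N p k lam v s r y u + s * pspin N p d u + r * pspin N 1 d u"
        by (rule field_combine) (simp_all add: d_def algebra_simps)
      moreover have "\<bar>s * pspin N p d u\<bar> \<le> \<bar>s\<bar> * (\<Sum>i\<in>idx p N. \<bar>d i\<bar>)"
        unfolding abs_mult
      proof (intro mult_left_mono)
        have "(\<Sum>i\<in>tidx p N. \<bar>d i\<bar>) \<le> (\<Sum>i\<in>idx p N. \<bar>d i\<bar>)" by (intro sum_mono2) auto
        then show "\<bar>pspin N p d u\<bar> \<le> (\<Sum>i\<in>idx p N. \<bar>d i\<bar>)"
          using abs_pspin_le[OF assms(1) nu, of p d] by linarith
      qed simp
      moreover have "\<bar>r * pspin N 1 d u\<bar> \<le> \<bar>r\<bar> * (\<Sum>i\<in>idx p N. \<bar>d i\<bar>)"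
        unfolding abs_mult
      proof (intro mult_left_mono)
        have "(\<Sum>i\<in>tidx 1 N. \<bar>d i\<bar>) \<le> (\<Sum>i\<in>idx p N. \<bar>d i\<bar>)" by (intro sum_mono2) auto
        then show "\<bar>pspin N 1 d u\<bar> \<le> (\<Sum>i\<in>idx p N. \<bar>d i\<bar>)"
          using abs_pspin_le[OF assms(1) nu, of 1 d] by linarith
      qed simp
      moreover have "0 \<le> (\<Sum>i\<in>idx p N. \<bar>d i\<bar>)" by (intro sum_nonneg) auto
      ultimately show "\<bar>field N p k lam v s r x u - field N p k lam v s r y u\<bar> \<le> c * (\<Sum>i\<in>idx p N. \<bar>x i - y i\<bar>)"
        unfolding c_def d_def[symmetric] distrib_right by linarith
    qed (use assms halfsphere_self in auto)
    then show ?thesis using c by (simp add: diff_divide_distrib[symmetric] abs_divide pos_divide_le_eq mult.commute)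
  qed
  have "(\<lambda>x. field_sup N p k lam v s r x / c) \<in> borel_measurable (gaussian (idx p N))"
    by (rule lipschitz_measurable_gaussian[OF _ L]) simp
  then have "(\<lambda>x. c * (field_sup N p k lam v s r x / c)) \<in> borel_measurable (gaussian (idx p N))"
    by (rule borel_measurable_times[OF borel_measurable_const])
  moreover have "(\<lambda>x. c * (field_sup N p k lam v s r x / c)) = field_sup N p k lam v s r"
    using c by (intro ext) simp
  ultimately show ?thesis by (simp only:)
qed

lemma measure_distr_eq:
  assumes "distr M N f = N" "f \<in> measurable M N" "A \<in> sets N"
  shows "measure N A = measure M (f -` A \<inter> space M)"
  using measure_distr[OF assms(2,3)] assms(1) by simp

text \<open>Replaces the amplitude c on the block T by the amplitude c' and an independent increment
  of amplitude e. The increment is the second factor of the product space, so the rest of the field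
  can be conditioned on.\<close>

lemma field_sup_split:
  fixes p N :: nat and c c' e a :: real
  assumes N: "N \<ge> 1" "v \<in> Rspace N" "norm v = 1" and T: "T \<subseteq> idx p N" and c: "0 < c" "c\<^sup>2 = c'\<^sup>2 + e\<^sup>2"
    and G: "\<And>x y z u. (\<And>i. i \<in> idx p N \<Longrightarrow> x i = (if i \<in> T then c' / c * y i + e / c * z i else y i)) \<Longrightarrow>
       field N p k lam v s r x u = G y z u"
  defines "F \<equiv> {w \<in> space (gaussian (idx p N) \<Otimes>\<^sub>M gaussian T). a < (SUP u\<in>halfsphere (Rspace N) v. G (fst w) (snd w) u)}"
  shows "F \<in> sets (gaussian (idx p N) \<Otimes>\<^sub>M gaussian T)"
    and "measure (gaussian (idx p N)) {x \<in> space (gaussian (idx p N)). a < field_sup N p k lam v s r x}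
      = measure (gaussian (idx p N) \<Otimes>\<^sub>M gaussian T) F"
proof -
  let ?I = "idx p N" and ?W = "gaussian (idx p N) \<Otimes>\<^sub>M gaussian T"
  define \<phi> where "\<phi> w = (\<lambda>i\<in>?I. if i \<in> T then c' / c * fst w i + e / c * snd w i else fst w i)"
    for w :: "(nat list \<Rightarrow> real) \<times> (nat list \<Rightarrow> real)"
  define E where "E = {x \<in> space (gaussian ?I). a < field_sup N p k lam v s r x}"
  have "(c' / c)\<^sup>2 + (e / c)\<^sup>2 = 1"
    unfolding power_divide add_divide_distrib[symmetric] c(2)[symmetric] using c(1) by simp
  from gaussian_split[OF _ T this]
  have law: "distr ?W (gaussian ?I) \<phi> = gaussian ?I"
    unfolding \<phi>_def[abs_def] by simp
  have m: "\<phi> \<in> measurable ?W (gaussian ?I)"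
    unfolding \<phi>_def[abs_def]
  proof (rule measurable_restrict_gaussian)
    fix i assume i: "i \<in> ?I"
    show "(\<lambda>w. if i \<in> T then c' / c * fst w i + e / c * snd w i else fst w i) \<in> borel_measurable ?W"
    proof (cases "i \<in> T")
      case True
      show ?thesis unfolding if_P[OF True]
        by (intro borel_measurable_add borel_measurable_times borel_measurable_const
            measurable_gaussian_fst[OF i] measurable_gaussian_snd[OF True])
    next
      case False
      show ?thesis unfolding if_not_P[OF False] by (rule measurable_gaussian_fst[OF i])
    qed
  qed
  have E: "E \<in> sets (gaussian ?I)"
    unfolding E_def by (intro borel_measurable_less borel_measurable_const field_sup_measurable N)
  have eq: "field_sup N p k lam v s r (\<phi> w) = (SUP u\<in>halfsphere (Rspace N) v. G (fst w) (snd w) u)" for w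
    unfolding field_sup_def by (intro arg_cong[where f=Sup] image_cong refl G) (simp add: \<phi>_def)
  have F: "F = \<phi> -` E \<inter> space ?W"
    unfolding F_def E_def eq[symmetric] using measurable_space[OF m] by blast
  show "F \<in> sets ?W" unfolding F by (rule measurable_sets[OF m E])
  show "measure (gaussian ?I) {x \<in> space (gaussian ?I). a < field_sup N p k lam v s r x} = measure ?W F"
    unfolding F E_def[symmetric] by (rule measure_distr_eq[OF law m E])
qed

section \<open>Couplings and exceptional events\<close>

lemma coupling_measure_le:
  assumes "prob_space W"
    and 1: "distr W M1 f1 = M1" "f1 \<in> measurable W M1" "A1 \<in> sets M1"
    and 2: "distr W M2 f2 = M2" "f2 \<in> measurable W M2" "A2 \<in> sets M2"
    and B: "B \<in> sets W" and imp: "\<And>w. w \<in> space W - B \<Longrightarrow> f1 w \<in> A1 \<Longrightarrow> f2 w \<in> A2"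
  shows "measure M1 A1 \<le> measure M2 A2 + measure W B"
proof -
  interpret prob_space W by fact
  have m: "f2 -` A2 \<inter> space W \<in> sets W" by (rule measurable_sets[OF 2(2,3)])
  have "measure M1 A1 = measure W (f1 -` A1 \<inter> space W)" by (rule measure_distr_eq[OF 1])
  also have "\<dots> \<le> measure W ((f2 -` A2 \<inter> space W) \<union> B)"
    using m B imp by (intro finite_measure_mono) auto
  also have "\<dots> \<le> measure W (f2 -` A2 \<inter> space W) + measure W B"
    using m B by (rule measure_Un_le)
  also have "measure W (f2 -` A2 \<inter> space W) = measure M2 A2" by (rule measure_distr_eq[OF 2, symmetric])
  finally show ?thesis .
qed

lemma measure_pair_fst_snd:
  assumes "prob_space M" "prob_space N" "A \<in> sets M" "B \<in> sets N"
  shows "fst -` A \<inter> space (M \<Otimes>\<^sub>M N) \<in> sets (M \<Otimes>\<^sub>M N)" "measure (M \<Otimes>\<^sub>M N) (fst -` A \<inter> space (M \<Otimes>\<^sub>M N)) = measure M A"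
    "snd -` B \<inter> space (M \<Otimes>\<^sub>M N) \<in> sets (M \<Otimes>\<^sub>M N)" "measure (M \<Otimes>\<^sub>M N) (snd -` B \<inter> space (M \<Otimes>\<^sub>M N)) = measure N B"
proof -
  interpret M: prob_space M by fact
  interpret N: prob_space N by fact
  interpret pair_prob_space M N ..
  have fA: "fst -` A \<inter> space (M \<Otimes>\<^sub>M N) = A \<times> space N"
    using sets.sets_into_space[OF assms(3)] by (auto simp: space_pair_measure)
  have sB: "snd -` B \<inter> space (M \<Otimes>\<^sub>M N) = space M \<times> B"
    using sets.sets_into_space[OF assms(4)] by (auto simp: space_pair_measure)
  show "fst -` A \<inter> space (M \<Otimes>\<^sub>M N) \<in> sets (M \<Otimes>\<^sub>M N)" "snd -` B \<inter> space (M \<Otimes>\<^sub>M N) \<in> sets (M \<Otimes>\<^sub>M N)"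
    unfolding fA sB using assms by auto
  show "measure (M \<Otimes>\<^sub>M N) (fst -` A \<inter> space (M \<Otimes>\<^sub>M N)) = measure M A"
    unfolding fA measure_def using assms N.emeasure_pair_measure_Times[OF assms(3) sets.top[of N]]
    by (simp add: N.emeasure_space_1)
  show "measure (M \<Otimes>\<^sub>M N) (snd -` B \<inter> space (M \<Otimes>\<^sub>M N)) = measure N B"
    unfolding sB measure_def using assms N.emeasure_pair_measure_Times[OF sets.top[of M] assms(4)]
    by (simp add: M.emeasure_space_1)
qed

lemma gaussian_marginal:
  assumes "finite I" "T \<subseteq> I"
  shows "distr (gaussian I) (gaussian T) (\<lambda>x. \<lambda>i\<in>T. x i) = gaussian T"
proof -
  interpret prob_space "gaussian I" by (rule prob_space_gaussian)
  have fT: "finite T" using assms finite_subset by auto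
  show ?thesis
  proof (rule distr_eq_gaussianI[OF _ fT])
    fix t :: "'a \<Rightarrow> real"
    have "(\<Sum>j\<in>T. t j * x j) = (\<Sum>i\<in>I. (if i \<in> T then t i else 0) * x i)" for x
      using assms by (intro sum.mono_neutral_cong_left) auto
    moreover have "(\<Sum>j\<in>T. (t j)\<^sup>2) = (\<Sum>i\<in>I. (if i \<in> T then t i else 0)\<^sup>2)"
      using assms by (intro sum.mono_neutral_cong_left) auto
    ultimately show "(CLINT x|gaussian I. iexp (\<Sum>j\<in>T. t j * x j)) = exp (- (\<Sum>j\<in>T. (t j)\<^sup>2) / 2)"
      by (simp only: char_gaussian[OF assms(1)])
  qed (use assms in auto)
qed

lemma tangent_map_measurable:
  "tangent_map N p u \<in> measurable (gaussian (tidx p N) \<Otimes>\<^sub>M gaussian {()}) (gaussian (tidx 1 N))"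
  unfolding tangent_map_def[abs_def]
  by (intro measurable_restrict_gaussian borel_measurable_add borel_measurable_sum borel_measurable_times
      borel_measurable_const measurable_gaussian_fst measurable_gaussian_snd)

text \<open>At a single unit vector the variance is at most 1 / N; coordinates of u beyond N do not
  contribute, hence an inequality.\<close>

lemma pspin_point_tail:
  assumes N: "N \<ge> 1" and u: "norm u = 1" and t: "0 \<le> t"
  shows "{x \<in> space (gaussian (tidx p N)). t \<le> \<bar>pspin N p x u\<bar>} \<in> sets (gaussian (tidx p N))"
    "measure (gaussian (tidx p N)) {x \<in> space (gaussian (tidx p N)). t \<le> \<bar>pspin N p x u\<bar>} \<le> 2 * exp (- (t\<^sup>2 * N / 2))"
proof -
  define c where "c is = (\<Prod>j<p. coord u (is ! j)) / sqrt N" for "is"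
  have eq: "pspin N p x u = (\<Sum>is\<in>tidx p N. c is * x is)" for x
    by (simp add: pspin_def mform_def c_def sum_divide_distrib)
  have "(\<Sum>is\<in>tidx p N. (c is)\<^sup>2) = (\<Sum>is\<in>tidx p N. (\<Prod>j<p. (coord u (is ! j))\<^sup>2)) / N"
    using N by (simp add: c_def power_divide prod_power_distrib sum_divide_distrib)
  also have "\<dots> = (\<Prod>j<p. \<Sum>i<N. (coord u i)\<^sup>2) / N" by (subst sum_tidx_prod) simp
  also have "\<dots> \<le> 1 / N"
    using sum_coord_le_norm[of u N] u by (intro divide_right_mono) (auto intro!: power_le_one sum_nonneg)
  finally have "(\<Sum>is\<in>tidx p N. (c is)\<^sup>2) \<le> 1 / N" .
  from gaussian_linear_tail[OF finite_tidx this _ t] N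
  show "measure (gaussian (tidx p N)) {x \<in> space (gaussian (tidx p N)). t \<le> \<bar>pspin N p x u\<bar>} \<le> 2 * exp (- (t\<^sup>2 * N / 2))"
    by (simp add: eq)
  show "{x \<in> space (gaussian (tidx p N)). t \<le> \<bar>pspin N p x u\<bar>} \<in> sets (gaussian (tidx p N))"
    unfolding eq
    by (intro borel_measurable_le borel_measurable_const borel_measurable_abs borel_measurable_sum
        borel_measurable_times measurable_gaussian_component)
qed

definition op_bounded :: "nat \<Rightarrow> nat \<Rightarrow> real \<Rightarrow> (nat list \<Rightarrow> real) \<Rightarrow> bool" where
  "op_bounded N p K x \<longleftrightarrow> (\<forall>us. \<bar>mform N p x us\<bar> \<le> K * sqrt N * (\<Prod>j<p. norm (us j)))"

text \<open>One exceptional set serves every larger constant, so the constants of the tensor block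
  and of the linear block can be raised to a common one.\<close>

lemma op_bounded_tail:
  "\<exists>K\<ge>1. \<forall>N\<ge>1. \<exists>B\<in>sets (gaussian (tidx p N)). measure (gaussian (tidx p N)) B \<le> 2 * exp (- real N) \<and>
    (\<forall>K'\<ge>K. \<forall>x\<in>space (gaussian (tidx p N)) - B. op_bounded N p K' x)"
proof -
  obtain K where K: "K > 0" "\<forall>N\<ge>1. \<exists>B\<in>sets (gaussian (tidx p N)). measure (gaussian (tidx p N)) B \<le> 2 * exp (- real N) \<and>
    (\<forall>x\<in>space (gaussian (tidx p N)) - B. \<forall>us. \<bar>mform N p x us\<bar> \<le> K * sqrt N * (\<Prod>j<p. norm (us j)))"
    using mform_norm_tail[of p] by (elim exE conjE) (rule that)
  have mono: "K * sqrt N * (\<Prod>j<p. norm (us j)) \<le> K' * sqrt N * (\<Prod>j<p. norm (us j))"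
    if "max K 1 \<le> K'" for K' and us :: "nat \<Rightarrow> fvec" and N :: nat
    using that by (intro mult_right_mono prod_nonneg) auto
  show ?thesis
  proof (intro exI[of _ "max K 1"] conjI allI impI)
    fix N :: nat assume "N \<ge> 1"
    from K(2)[rule_format, OF this]
    obtain B where B: "B \<in> sets (gaussian (tidx p N))" "measure (gaussian (tidx p N)) B \<le> 2 * exp (- real N)"
      "\<forall>x\<in>space (gaussian (tidx p N)) - B. \<forall>us. \<bar>mform N p x us\<bar> \<le> K * sqrt N * (\<Prod>j<p. norm (us j))"
      by (elim bexE conjE) (rule that)
    have "op_bounded N p K' x" if "max K 1 \<le> K'" "x \<in> space (gaussian (tidx p N)) - B" for K' x
      unfolding op_bounded_def
    proof
      fix us
      show "\<bar>mform N p x us\<bar> \<le> K' * sqrt N * (\<Prod>j<p. norm (us j))"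
        by (rule order_trans[OF B(3)[rule_format, OF that(2)] mono[OF that(1)]])
    qed
    then show "\<exists>B\<in>sets (gaussian (tidx p N)). measure (gaussian (tidx p N)) B \<le> 2 * exp (- real N) \<and>
      (\<forall>K'\<ge>max K 1. \<forall>x\<in>space (gaussian (tidx p N)) - B. op_bounded N p K' x)"
      using B(1,2) by (intro bexI[of _ B] conjI allI impI ballI)
  qed simp
qed

lemma op_bounded_marginal:
  assumes "finite I" "tidx p N \<subseteq> I"
    and "B \<in> sets (gaussian (tidx p N))" "\<And>x. x \<in> space (gaussian (tidx p N)) - B \<Longrightarrow> op_bounded N p K x"
  defines "B' \<equiv> (\<lambda>x. \<lambda>i\<in>tidx p N. x i) -` B \<inter> space (gaussian I)"
  shows "B' \<in> sets (gaussian I)" "measure (gaussian I) B' = measure (gaussian (tidx p N)) B"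
    "\<And>x. x \<in> space (gaussian I) - B' \<Longrightarrow> op_bounded N p K x"
proof -
  have m: "(\<lambda>x. \<lambda>i\<in>tidx p N. x i) \<in> measurable (gaussian I) (gaussian (tidx p N))"
    using assms(2) by (intro measurable_restrict_gaussian measurable_gaussian_component) auto
  show "B' \<in> sets (gaussian I)" unfolding B'_def by (rule measurable_sets[OF m assms(3)])
  show "measure (gaussian I) B' = measure (gaussian (tidx p N)) B"
    unfolding B'_def by (rule measure_distr_eq[OF gaussian_marginal[OF assms(1,2)] m assms(3), symmetric])
  fix x assume x: "x \<in> space (gaussian I) - B'"
  then have "(\<lambda>i\<in>tidx p N. x i) \<in> space (gaussian (tidx p N)) - B"
    using measurable_space[OF m] by (auto simp: B'_def)
  from assms(4)[OF this] show "op_bounded N p K x" by (simp add: op_bounded_def mform_def)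
qed

text \<open>Only the value of the increment at the one point u and the radial normal are made small,
  so the level t can lie far below the scale of the operator norm. With t = \<eta>^2 their
  contribution \<eta> t is of order \<eta>^3.\<close>

lemma tangent_coupling_event:
  assumes N: "N \<ge> 1" and p: "p \<ge> 1" and u: "u \<in> Rspace N" "norm u = 1" and t: "0 \<le> t"
    and B: "B \<in> sets (gaussian (tidx p N))" "measure (gaussian (tidx p N)) B \<le> b"
  defines "W \<equiv> gaussian (tidx p N) \<Otimes>\<^sub>M gaussian {()}"
  shows "\<exists>E\<in>sets W. measure W E \<le> b + 2 * exp (- (t\<^sup>2 * N / 2)) + 2 * exp (- (t\<^sup>2 * N / (2 * real p))) \<and>
    (\<forall>w\<in>space W - E. fst w \<in> space (gaussian (tidx p N)) - B \<and> \<bar>pspin N p (fst w) u\<bar> < t \<and> \<bar>sqrt p * snd w () / sqrt N\<bar> < t)"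
proof -
  interpret T: prob_space "gaussian (tidx p N)" by (rule prob_space_gaussian)
  interpret Z: prob_space "gaussian {()}" by (rule prob_space_gaussian)
  interpret WW: pair_prob_space "gaussian (tidx p N)" "gaussian {()}" ..
  define A1 where "A1 = {x \<in> space (gaussian (tidx p N)). t \<le> \<bar>pspin N p x u\<bar>}"
  define A2 where "A2 = {z \<in> space (gaussian {()}). t \<le> \<bar>\<Sum>c\<in>{()}. (sqrt p / sqrt N) * z c\<bar>}"
  have A1: "A1 \<in> sets (gaussian (tidx p N))" "measure (gaussian (tidx p N)) A1 \<le> 2 * exp (- (t\<^sup>2 * N / 2))"
    unfolding A1_def by (rule pspin_point_tail[OF N u(2) t])+
  have A2: "A2 \<in> sets (gaussian {()})"
    unfolding A2_def
    by (intro borel_measurable_le borel_measurable_const borel_measurable_abs borel_measurable_sum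
        borel_measurable_times measurable_gaussian_component)
  have "(\<Sum>c\<in>{()}. (sqrt p / sqrt N)\<^sup>2) \<le> real p / N" by (simp add: power_divide)
  from gaussian_linear_tail[OF _ this _ t] N p
  have A2': "measure (gaussian {()}) A2 \<le> 2 * exp (- (t\<^sup>2 * N / (2 * real p)))"
    unfolding A2_def by simp
  note f1 = measure_pair_fst_snd[OF T.prob_space_axioms Z.prob_space_axioms B(1) A2]
  note f2 = measure_pair_fst_snd[OF T.prob_space_axioms Z.prob_space_axioms A1(1) A2]
  define E where "E = (fst -` B \<inter> space W) \<union> (fst -` A1 \<inter> space W) \<union> (snd -` A2 \<inter> space W)"
  have ES: "E \<in> sets W" unfolding E_def W_def by (intro sets.Un f1(1) f2(1) f2(3))
  have "measure W E \<le> measure W ((fst -` B \<inter> space W) \<union> (fst -` A1 \<inter> space W)) + measure W (snd -` A2 \<inter> space W)"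
    unfolding E_def W_def by (intro measure_Un_le sets.Un f1(1) f2(1) f2(3))
  also have "measure W ((fst -` B \<inter> space W) \<union> (fst -` A1 \<inter> space W)) \<le> measure W (fst -` B \<inter> space W) + measure W (fst -` A1 \<inter> space W)"
    unfolding W_def by (intro measure_Un_le f1(1) f2(1))
  finally have "measure W E \<le> b + 2 * exp (- (t\<^sup>2 * N / 2)) + 2 * exp (- (t\<^sup>2 * N / (2 * real p)))"
    using f1(2) f2(2) f2(4) A1(2) A2' B(2) unfolding W_def by linarith
  moreover have "fst w \<in> space (gaussian (tidx p N)) - B \<and> \<bar>pspin N p (fst w) u\<bar> < t \<and> \<bar>sqrt p * snd w () / sqrt N\<bar> < t"
    if w: "w \<in> space W - E" for w
  proof -
    have sp: "fst w \<in> space (gaussian (tidx p N))" "snd w \<in> space (gaussian {()})"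
      using w by (auto simp: W_def space_pair_measure)
    have "fst w \<notin> B" "fst w \<notin> A1" "snd w \<notin> A2" using w by (auto simp: E_def)
    then show ?thesis using sp by (auto simp: A1_def A2_def not_le)
  qed
  ultimately show ?thesis using ES by blast
qed

text \<open>Conditionally on the rest V of the field, the linear field is coupled to the increment through
  the tangential gradient of the increment at a near-maximiser of V.\<close>

lemma interpolation_step:
  assumes p: "p \<ge> 2" and k: "k \<ge> 1"
  shows "\<exists>c>0. \<forall>lam\<ge>c. \<exists>Q>0. \<forall>\<eta>. 0 < \<eta> \<longrightarrow> \<eta> \<le> 1 \<longrightarrow> (\<forall>N\<ge>1. \<forall>v\<in>Rspace N. \<forall>s r a. norm v = 1 \<longrightarrow> 0 \<le> s \<longrightarrow> 0 \<le> r \<longrightarrow> s\<^sup>2 + r\<^sup>2 \<le> 1 \<longrightarrow>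
     (let P = (\<lambda>s r a. measure (gaussian (idx p N)) {x \<in> space (gaussian (idx p N)). a < field_sup N p k lam v s (sqrt p * r) x});
          s1 = sqrt (s\<^sup>2 + \<eta>\<^sup>2); r1 = sqrt (r\<^sup>2 + \<eta>\<^sup>2);
          \<beta> = 6 * exp (- real N) + 2 * exp (- (\<eta> ^ 4 * N / 2)) + 2 * exp (- (\<eta> ^ 4 * N / (2 * real p)))
      in P s1 r a \<le> P s r1 (a - Q * \<eta> ^ 3) + \<beta> \<and> P s r1 a \<le> P s1 r (a - Q * \<eta> ^ 3) + \<beta>))"
proof -
  obtain K1 where K1: "K1 \<ge> 1" "\<forall>N\<ge>1. \<exists>B\<in>sets (gaussian (tidx p N)). measure (gaussian (tidx p N)) B \<le> 2 * exp (- real N) \<and>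
    (\<forall>K'\<ge>K1. \<forall>x\<in>space (gaussian (tidx p N)) - B. op_bounded N p K' x)"
    using op_bounded_tail[of p] by (elim exE conjE) (rule that)
  obtain K2 where K2: "K2 \<ge> 1" "\<forall>N\<ge>1. \<exists>B\<in>sets (gaussian (tidx 1 N)). measure (gaussian (tidx 1 N)) B \<le> 2 * exp (- real N) \<and>
    (\<forall>K'\<ge>K2. \<forall>x\<in>space (gaussian (tidx 1 N)) - B. op_bounded N 1 K' x)"
    using op_bounded_tail[of 1] by (elim exE conjE) (rule that)
  define K where "K = max K1 K2"
  have K: "K \<ge> 1" "K1 \<le> K" "K2 \<le> K" using K1(1) by (auto simp: K_def)
  define C2 where "C2 = (real p + 1)\<^sup>2 * K"
  \<comment> \<open>A common constant for every field of the path, since |s|, |r| \<le> 1. The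
    threshold c is thereby fixed before s, r and \<eta>.\<close>
  define C0 where "C0 = C2 + sqrt p * ((real 1 + 1)\<^sup>2 * K)"
  have "1 * 1 \<le> (real p + 1)\<^sup>2 * K" using K(1) by (intro mult_mono) (auto simp: one_le_power)
  then have C2: "1 \<le> C2" by (simp add: C2_def)
  have C0: "0 \<le> C0" using C2 K(1) by (simp add: C0_def)
  have qa: "quad_approx C2 (pspin N p x) (pspin_deriv N p x)" if "op_bounded N p K x" "N \<ge> 1" for N x
    unfolding C2_def using that K(1) by (intro quad_approx_pspin) (auto simp: op_bounded_def)
  have qa1: "quad_approx ((real 1 + 1)\<^sup>2 * K) (pspin N 1 x) (pspin_deriv N 1 x)" if "op_bounded N 1 K x" "N \<ge> 1" for N x
    using that K(1) by (intro quad_approx_pspin) (auto simp: op_bounded_def)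
  obtain c where c: "c > 0" and growth: "\<forall>lam\<ge>c. \<forall>f D (W :: fvec set) v u' \<zeta>. quad_approx C0 f D \<longrightarrow> subspace W \<longrightarrow> v \<in> W \<longrightarrow> norm v = 1 \<longrightarrow>
      0 \<le> \<zeta> \<longrightarrow> \<zeta> \<le> 1 \<longrightarrow> u' \<in> halfsphere W v \<longrightarrow>
      (\<forall>w\<in>halfsphere W v. f w + lam / real k * (w \<bullet> v) ^ k \<le> f u' + lam / real k * (u' \<bullet> v) ^ k + \<zeta>) \<longrightarrow>
      (\<forall>u\<in>halfsphere W v. (norm (u - u'))\<^sup>2 \<le> (f u' + lam / real k * (u' \<bullet> v) ^ k) - (f u + lam / real k * (u \<bullet> v) ^ k) + 2 * \<zeta>)"
    using quadratic_growth[OF k C0, where 'v=fvec] by (elim exE conjE) (rule that)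
  \<comment> \<open>1 + 2 C2 (3 C2 + 3)^2 from \<open>tangent_field_coupling\<close>, and 2 more
    from |f u'| + |b| \<le> 2 \<eta>^2.\<close>
  define Q where "Q = 3 + 2 * C2 * (3 * C2 + 3)\<^sup>2"
  have Q: "Q > 0" using C2 by (simp add: Q_def add_pos_nonneg)
  show ?thesis
  proof (rule exI[of _ c], rule conjI[OF c], intro allI impI, rule exI[of _ Q], rule conjI[OF Q],
      intro allI impI ballI)
    fix lam \<eta> s r a :: real and N :: nat and v
    assume lam: "c \<le> lam" and \<eta>: "0 < \<eta>" "\<eta> \<le> 1" and N: "1 \<le> N" and v: "v \<in> Rspace N" "norm v = 1"
      and s: "0 \<le> s" and r: "0 \<le> r" and sr: "s\<^sup>2 + r\<^sup>2 \<le> 1"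
    let ?I = "idx p N" and ?D = "halfsphere (Rspace N) v"
    \<comment> \<open>Failure probability of the coupling given the rest of the field. The other 4
      exp(-N) of the final bound is for \<open>Bad\<close>.\<close>
    define \<beta>1 where "\<beta>1 = 2 * exp (- real N) + 2 * exp (- (\<eta> ^ 4 * N / 2)) + 2 * exp (- (\<eta> ^ 4 * N / (2 * real p)))"
    from K1(2)[rule_format, OF N]
    obtain Bp where Bp: "Bp \<in> sets (gaussian (tidx p N))" "measure (gaussian (tidx p N)) Bp \<le> 2 * exp (- real N)"
      and Bp': "\<forall>K'\<ge>K1. \<forall>x\<in>space (gaussian (tidx p N)) - Bp. op_bounded N p K' x"
      by (elim bexE conjE) (rule that)
    from K2(2)[rule_format, OF N]
    obtain B1 where B1: "B1 \<in> sets (gaussian (tidx 1 N))" "measure (gaussian (tidx 1 N)) B1 \<le> 2 * exp (- real N)"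
      and B1': "\<forall>K'\<ge>K2. \<forall>x\<in>space (gaussian (tidx 1 N)) - B1. op_bounded N 1 K' x"
      by (elim bexE conjE) (rule that)
    note obp = Bp'[rule_format, OF K(2)] and ob1 = B1'[rule_format, OF K(3)]
    have finI: "finite ?I" by simp
    have sub: "tidx p N \<subseteq> ?I" "tidx 1 N \<subseteq> ?I" by simp_all
    note mp0 = op_bounded_marginal[OF finI sub(1) Bp(1) obp] and m10 = op_bounded_marginal[OF finI sub(2) B1(1) ob1]
    define Bad where "Bad = ((\<lambda>x. \<lambda>i\<in>tidx p N. x i) -` Bp \<inter> space (gaussian ?I)) \<union> ((\<lambda>x. \<lambda>i\<in>tidx 1 N. x i) -` B1 \<inter> space (gaussian ?I))"
    have Bad: "Bad \<in> sets (gaussian ?I)" unfolding Bad_def by (rule sets.Un[OF mp0(1) m10(1)])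
    have PBad: "measure (gaussian ?I) Bad \<le> 4 * exp (- real N)"
    proof -
      have "measure (gaussian ?I) Bad \<le> measure (gaussian ?I) ((\<lambda>x. \<lambda>i\<in>tidx p N. x i) -` Bp \<inter> space (gaussian ?I))
         + measure (gaussian ?I) ((\<lambda>x. \<lambda>i\<in>tidx 1 N. x i) -` B1 \<inter> space (gaussian ?I))"
        unfolding Bad_def by (rule measure_Un_le[OF mp0(1) m10(1)])
      then show ?thesis using mp0(2) m10(2) Bp(2) B1(2) by linarith
    qed
    have good: "op_bounded N p K y" "op_bounded N 1 K y" if "y \<in> space (gaussian ?I) - Bad" for y
    proof -
      have "y \<in> space (gaussian ?I) - (\<lambda>x. \<lambda>i\<in>tidx p N. x i) -` Bp \<inter> space (gaussian ?I)"
        "y \<in> space (gaussian ?I) - (\<lambda>x. \<lambda>i\<in>tidx 1 N. x i) -` B1 \<inter> space (gaussian ?I)"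
        using that unfolding Bad_def by blast+
      then show "op_bounded N p K y" "op_bounded N 1 K y" using mp0(3) m10(3) by blast+
    qed
    define Gp where "Gp y z u = field N p k lam v s (sqrt p * r) y u + \<eta> * pspin N p z u" for y z u
    define Gl where "Gl y z u = field N p k lam v s (sqrt p * r) y u + (sqrt p * \<eta>) * pspin N 1 z u" for y z u
    define Fp where "Fp a = {w \<in> space (gaussian ?I \<Otimes>\<^sub>M gaussian (tidx p N)). a < (SUP u\<in>?D. Gp (fst w) (snd w) u)}" for a
    define Fl where "Fl a = {w \<in> space (gaussian ?I \<Otimes>\<^sub>M gaussian (tidx 1 N)). a < (SUP u\<in>?D. Gl (fst w) (snd w) u)}" for a
    \<comment> \<open>p \<ge> 2 keeps the two blocks disjoint, so each can be split on its
      own.\<close>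
    have disj: "tidx p N \<inter> tidx 1 N = {}" using p by (auto simp: tidx_def)
    define s1 where "s1 = sqrt (s\<^sup>2 + \<eta>\<^sup>2)"
    define r1 where "r1 = sqrt (r\<^sup>2 + \<eta>\<^sup>2)"
    have s1: "0 < s1" "s1\<^sup>2 = s\<^sup>2 + \<eta>\<^sup>2" using \<eta> by (auto simp: s1_def intro!: add_nonneg_pos)
    have r1: "0 < r1" "r1\<^sup>2 = r\<^sup>2 + \<eta>\<^sup>2" using \<eta> by (auto simp: r1_def intro!: add_nonneg_pos)
    have Gp: "field N p k lam v s1 (sqrt p * r) x u = Gp y z u"
      if "\<And>i. i \<in> ?I \<Longrightarrow> x i = (if i \<in> tidx p N then s / s1 * y i + \<eta> / s1 * z i else y i)" for x y z u
    proof -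
      have "field N p k lam v s1 (sqrt p * r) x u = field N p k lam v s (sqrt p * r) y u + \<eta> * pspin N p z u + 0 * pspin N 1 z u"
        using that s1(1) disj by (intro field_combine) (auto simp: distrib_left)
      then show ?thesis by (simp add: Gp_def)
    qed
    have Gl: "field N p k lam v s (sqrt p * r1) x u = Gl y z u"
      if "\<And>i. i \<in> ?I \<Longrightarrow> x i = (if i \<in> tidx 1 N then r / r1 * y i + \<eta> / r1 * z i else y i)" for x y z u
    proof -
      have "field N p k lam v s (sqrt p * r1) x u = field N p k lam v s (sqrt p * r) y u + 0 * pspin N p z u + (sqrt p * \<eta>) * pspin N 1 z u"
        using that r1(1) disj by (intro field_combine) (auto simp: distrib_left)
      then show ?thesis by (simp add: Gl_def)
    qed
    note splitp = field_sup_split[where T="tidx p N" and G=Gp and c=s1 and c'=s and e=\<eta> and s=s1 and r="sqrt p * r", OF N v sub(1) s1 Gp, folded Fp_def]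
    note splitl = field_sup_split[where T="tidx 1 N" and G=Gl and c=r1 and c'=r and e=\<eta> and s=s and r="sqrt p * r1", OF N v sub(2) r1 Gl, folded Fl_def]
    have Fp: "Fp a \<in> sets (gaussian ?I \<Otimes>\<^sub>M gaussian (tidx p N))"
      "measure (gaussian ?I) {x \<in> space (gaussian ?I). a < field_sup N p k lam v s1 (sqrt p * r) x} = measure (gaussian ?I \<Otimes>\<^sub>M gaussian (tidx p N)) (Fp a)" for a
      by (rule splitp(1), blast) (rule splitp(2), blast)
    have Fl: "Fl a \<in> sets (gaussian ?I \<Otimes>\<^sub>M gaussian (tidx 1 N))"
      "measure (gaussian ?I) {x \<in> space (gaussian ?I). a < field_sup N p k lam v s (sqrt p * r1) x} = measure (gaussian ?I \<Otimes>\<^sub>M gaussian (tidx 1 N)) (Fl a)" for a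
      by (rule splitl(1), blast) (rule splitl(2), blast)
    have \<beta>1: "0 \<le> \<beta>1" by (simp add: \<beta>1_def)
    \<comment> \<open>From here y is fixed. The near-maximiser u' is then a constant vector for the
      increment, as \<open>tangent_map_law\<close> requires.\<close>
    have cond: "measure (gaussian (tidx p N)) (Pair y -` Fp a) \<le> measure (gaussian (tidx 1 N)) (Pair y -` Fl (a - Q * \<eta> ^ 3)) + \<beta>1"
         "measure (gaussian (tidx 1 N)) (Pair y -` Fl a) \<le> measure (gaussian (tidx p N)) (Pair y -` Fp (a - Q * \<eta> ^ 3)) + \<beta>1"
      if y: "y \<in> space (gaussian ?I) - Bad" for y a
    proof -
      let ?V = "field N p k lam v s (sqrt p * r) y"
      have s_le: "\<bar>s\<bar> \<le> 1" and r_le: "\<bar>r\<bar> \<le> 1"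
      proof -
        have "s\<^sup>2 \<le> 1" "r\<^sup>2 \<le> 1" using sr zero_le_power2[of s] zero_le_power2[of r] by linarith+
        then show "\<bar>s\<bar> \<le> 1" "\<bar>r\<bar> \<le> 1" by (simp_all add: abs_square_le_1)
      qed
      have q: "quad_approx C0 (\<lambda>u. s * pspin N p y u + (sqrt p * r) * pspin N 1 y u)
         (\<lambda>u w. s * pspin_deriv N p y u w + (sqrt p * r) * pspin_deriv N 1 y u w)"
      proof (rule quad_approx_mono[OF quad_approx_add[OF quad_approx_scale[OF qa] quad_approx_scale[OF qa1]]])
        have "\<bar>s\<bar> * C2 \<le> 1 * C2" using s_le C2 by (intro mult_right_mono) auto
        moreover have "\<bar>sqrt p * r\<bar> * ((real 1 + 1)\<^sup>2 * K) \<le> sqrt p * ((real 1 + 1)\<^sup>2 * K)"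
          using r_le K(1) by (intro mult_right_mono) (auto simp: abs_mult intro: mult_left_le)
        ultimately show "\<bar>s\<bar> * C2 + \<bar>sqrt p * r\<bar> * ((real 1 + 1)\<^sup>2 * K) \<le> C0" unfolding C0_def by linarith
      qed (use good[OF y] N in auto)
      have bV: "bdd_above (?V ` ?D)" by (rule bdd_field[OF N v(2)])
      have ne: "v \<in> ?D" using v by (rule halfsphere_self)
      \<comment> \<open>The slack \<eta>^3 matches the error budget of one step.\<close>
      have "(SUP u\<in>?D. ?V u) - \<eta> ^ 3 < (SUP u\<in>?D. ?V u)" using \<eta> by simp
      then obtain u' where u': "u' \<in> ?D" "(SUP u\<in>?D. ?V u) - \<eta> ^ 3 < ?V u'"
        using less_cSUP_iff[OF _ bV] ne by blast
      have near: "?V w \<le> ?V u' + \<eta> ^ 3" if "w \<in> ?D" for w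
        using cSUP_upper[OF that bV] u'(2) by linarith
      have \<eta>3: "0 \<le> \<eta> ^ 3" "\<eta> ^ 3 \<le> 1" using \<eta> by (auto intro: power_le_one)
      have gr: "(norm (u - u'))\<^sup>2 \<le> ?V u' - ?V u + 2 * \<eta> ^ 3" if "u \<in> ?D" for u
        using growth[rule_format, OF lam q subspace_Rspace v \<eta>3 u'(1), of u] near that unfolding field_def by blast
      have u'R: "u' \<in> Rspace N" "norm u' = 1" using u' by (auto simp: halfsphere_def)
      define W where "W = gaussian (tidx p N) \<Otimes>\<^sub>M gaussian {()}"
      have e4: "(\<eta>\<^sup>2)\<^sup>2 = \<eta> ^ 4" by simp
      obtain E where E: "E \<in> sets W" "measure W E \<le> \<beta>1" "\<And>w. w \<in> space W - E \<Longrightarrow>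
         fst w \<in> space (gaussian (tidx p N)) - Bp \<and> \<bar>pspin N p (fst w) u'\<bar> < \<eta>\<^sup>2 \<and> \<bar>sqrt p * snd w () / sqrt N\<bar> < \<eta>\<^sup>2"
        using tangent_coupling_event[OF N _ u'R zero_le_power2[of \<eta>] Bp(1,2)] p unfolding W_def \<beta>1_def e4 by auto
      have dev: "\<bar>(SUP u\<in>?D. Gp y (fst w) u) - (SUP u\<in>?D. Gl y (tangent_map N p u' w) u)\<bar> \<le> Q * \<eta> ^ 3"
        if w: "w \<in> space W - E" for w
      proof -
        note Ew = E(3)[OF w]
        define b where "b = sqrt p * snd w () / sqrt N"
        have \<eta>2: "\<eta>\<^sup>2 \<le> 1" using \<eta> by (simp add: power_le_one)
        have qw: "quad_approx C2 (pspin N p (fst w)) (pspin_deriv N p (fst w))"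
          using Ew obp by (intro qa N) blast
        have "\<bar>b\<bar> \<le> C2" using Ew \<eta>2 C2 unfolding b_def by linarith
        from tangent_field_coupling[OF qw this _ u'(1) gr bV \<eta>]
        have "\<bar>(SUP u\<in>?D. ?V u + \<eta> * pspin N p (fst w) u) - (SUP u\<in>?D. ?V u + \<eta> * (pspin_deriv N p (fst w) u' (u - (u \<bullet> u') *\<^sub>R u') + b * (u \<bullet> u')))\<bar>
          \<le> \<eta> * (\<bar>pspin N p (fst w) u'\<bar> + \<bar>b\<bar>) + (1 + 2 * C2 * (3 * C2 + 3)\<^sup>2) * \<eta> ^ 3"
          by (auto simp: halfsphere_def)
        also have "(SUP u\<in>?D. ?V u + \<eta> * (pspin_deriv N p (fst w) u' (u - (u \<bullet> u') *\<^sub>R u') + b * (u \<bullet> u'))) = (SUP u\<in>?D. Gl y (tangent_map N p u' w) u)"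
        proof (intro arg_cong[where f=Sup] image_cong refl)
          fix u assume "u \<in> ?D"
          then have "u \<in> Rspace N" by (simp add: halfsphere_def)
          from pspin_tangent_map[OF _ u'R(1) this, of p w] p
          show "?V u + \<eta> * (pspin_deriv N p (fst w) u' (u - (u \<bullet> u') *\<^sub>R u') + b * (u \<bullet> u')) = Gl y (tangent_map N p u' w) u"
            unfolding Gl_def b_def by (simp add: mult.assoc mult.left_commute)
        qed
        also have "\<eta> * (\<bar>pspin N p (fst w) u'\<bar> + \<bar>b\<bar>) \<le> \<eta> * (2 * \<eta>\<^sup>2)"
          using Ew \<eta> unfolding b_def by (intro mult_left_mono) auto
        also have "\<eta> * (2 * \<eta>\<^sup>2) + (1 + 2 * C2 * (3 * C2 + 3)\<^sup>2) * \<eta> ^ 3 = Q * \<eta> ^ 3"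
          by (simp add: Q_def algebra_simps power2_eq_square power3_eq_cube)
        finally show ?thesis unfolding Gp_def by simp
      qed
      have W: "prob_space W" unfolding W_def
        by (intro prob_space_pair prob_space_gaussian)
      have law1: "distr W (gaussian (tidx 1 N)) (tangent_map N p u') = gaussian (tidx 1 N)"
        unfolding W_def using p u'R by (intro tangent_map_law) auto
      have mes1: "tangent_map N p u' \<in> measurable W (gaussian (tidx 1 N))"
        unfolding W_def by (rule tangent_map_measurable)
      have law2: "distr W (gaussian (tidx p N)) fst = gaussian (tidx p N)"
        unfolding W_def by (rule prob_space.distr_pair_fst[OF prob_space_gaussian])
      have mes2: "fst \<in> measurable W (gaussian (tidx p N))" unfolding W_def by (rule measurable_fst)
      have mp: "(Pair y -` Fp b) \<in> sets (gaussian (tidx p N))" for b by (rule sets_Pair1[OF Fp(1)])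
      have ml: "(Pair y -` Fl b) \<in> sets (gaussian (tidx 1 N))" for b by (rule sets_Pair1[OF Fl(1)])
      have inp: "z \<in> Pair y -` Fp b \<longleftrightarrow> b < (SUP u\<in>?D. Gp y z u)" if "z \<in> space (gaussian (tidx p N))" for z b
        using that y by (auto simp: Fp_def space_pair_measure)
      have inl: "z \<in> Pair y -` Fl b \<longleftrightarrow> b < (SUP u\<in>?D. Gl y z u)" if "z \<in> space (gaussian (tidx 1 N))" for z b
        using that y by (auto simp: Fl_def space_pair_measure)
      show "measure (gaussian (tidx p N)) (Pair y -` Fp a) \<le> measure (gaussian (tidx 1 N)) (Pair y -` Fl (a - Q * \<eta> ^ 3)) + \<beta>1"
      proof -
        have "measure (gaussian (tidx p N)) (Pair y -` Fp a) \<le> measure (gaussian (tidx 1 N)) (Pair y -` Fl (a - Q * \<eta> ^ 3)) + measure W E"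
        proof (rule coupling_measure_le[OF W law2 mes2 mp law1 mes1 ml E(1)])
          fix w assume w: "w \<in> space W - E" "fst w \<in> Pair y -` Fp a"
          have sw: "fst w \<in> space (gaussian (tidx p N))" "tangent_map N p u' w \<in> space (gaussian (tidx 1 N))"
            using w measurable_space[OF mes2] measurable_space[OF mes1] by auto
          show "tangent_map N p u' w \<in> Pair y -` Fl (a - Q * \<eta> ^ 3)"
            using dev[OF w(1)] w(2) unfolding inp[OF sw(1)] inl[OF sw(2)] by linarith
        qed
        then show ?thesis using E(2) by simp
      qed
      show "measure (gaussian (tidx 1 N)) (Pair y -` Fl a) \<le> measure (gaussian (tidx p N)) (Pair y -` Fp (a - Q * \<eta> ^ 3)) + \<beta>1"
      proof -
        have "measure (gaussian (tidx 1 N)) (Pair y -` Fl a) \<le> measure (gaussian (tidx p N)) (Pair y -` Fp (a - Q * \<eta> ^ 3)) + measure W E"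
        proof (rule coupling_measure_le[OF W law1 mes1 ml law2 mes2 mp E(1)])
          fix w assume w: "w \<in> space W - E" "tangent_map N p u' w \<in> Pair y -` Fl a"
          have sw: "fst w \<in> space (gaussian (tidx p N))" "tangent_map N p u' w \<in> space (gaussian (tidx 1 N))"
            using w measurable_space[OF mes2] measurable_space[OF mes1] by auto
          show "fst w \<in> Pair y -` Fp (a - Q * \<eta> ^ 3)"
            using dev[OF w(1)] w(2) unfolding inp[OF sw(1)] inl[OF sw(2)] by linarith
        qed
        then show ?thesis using E(2) by simp
      qed
    qed
    note ps = prob_space_gaussian[of ?I] prob_space_gaussian[of "tidx p N"] prob_space_gaussian[of "tidx 1 N"]
    have "measure (gaussian ?I \<Otimes>\<^sub>M gaussian (tidx p N)) (Fp a) \<le> measure (gaussian ?I \<Otimes>\<^sub>M gaussian (tidx 1 N)) (Fl (a - Q * \<eta> ^ 3)) + measure (gaussian ?I) Bad + \<beta>1"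
      by (rule measure_pair_compare[OF ps(1,2,3) Fp(1) Fl(1) Bad \<beta>1 cond(1)])
    moreover have "measure (gaussian ?I \<Otimes>\<^sub>M gaussian (tidx 1 N)) (Fl a) \<le> measure (gaussian ?I \<Otimes>\<^sub>M gaussian (tidx p N)) (Fp (a - Q * \<eta> ^ 3)) + measure (gaussian ?I) Bad + \<beta>1"
      by (rule measure_pair_compare[OF ps(1,3,2) Fl(1) Fp(1) Bad \<beta>1 cond(2)])
    ultimately show "let P = (\<lambda>s r a. measure (gaussian ?I) {x \<in> space (gaussian ?I). a < field_sup N p k lam v s (sqrt p * r) x});
          s1 = sqrt (s\<^sup>2 + \<eta>\<^sup>2); r1 = sqrt (r\<^sup>2 + \<eta>\<^sup>2);
          \<beta> = 6 * exp (- real N) + 2 * exp (- (\<eta> ^ 4 * N / 2)) + 2 * exp (- (\<eta> ^ 4 * N / (2 * real p)))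
      in P s1 r a \<le> P s r1 (a - Q * \<eta> ^ 3) + \<beta> \<and> P s r1 a \<le> P s1 r (a - Q * \<eta> ^ 3) + \<beta>"
      using PBad unfolding Let_def s1_def[symmetric] r1_def[symmetric] Fp(2) Fl(2) \<beta>1_def by linarith
  qed
qed

section \<open>The limiting variational problem\<close>

definition profile :: "nat \<Rightarrow> nat \<Rightarrow> real \<Rightarrow> real \<Rightarrow> real" where
  "profile p k lam m = sqrt p * sqrt (1 - m\<^sup>2) + lam / real k * m ^ k"

abbreviation stationary :: "nat \<Rightarrow> nat \<Rightarrow> real \<Rightarrow> real \<Rightarrow> bool" where
  "stationary p k lam m \<equiv> 0 < m \<and> m < 1 \<and> lam * m ^ k / sqrt (real p) = m\<^sup>2 / sqrt (1 - m\<^sup>2)"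

lemma continuous_profile: "continuous_on {0..1} (profile p k lam)"
  unfolding profile_def by (intro continuous_intros)

text \<open>With t = m^2 the squared stationarity equation reads lam^2 t^(k - 2) (1 - t) = p. Here
  t^k (1 - t) does not increase for t \<ge> 1 - 1 / (2 k), and division by t^2 makes the decrease
  strict. The inequality is cross-multiplied because k - 2 may be negative.\<close>

lemma stationary_unique_aux:
  fixes a b :: real
  assumes k: "k \<ge> 1" and ab: "0 < a" "a < b" "b < 1" and t: "1 - 1 / (2 * real k) \<le> a"
  shows "b ^ k * (1 - b) * a\<^sup>2 < a ^ k * (1 - a) * b\<^sup>2"
proof -
  have "real k * (1 - a) \<le> 1 / 2" using t k by (simp add: field_simps)
  also have "1 / 2 \<le> 1 - 1 / (2 * real k)" using k by (simp add: field_simps)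
  finally have kb: "real k * (1 - a) \<le> b" using t ab by linarith
  define e where "e = (b - a) / b"
  have e: "0 < e" "e < 1" using ab by (auto simp: e_def)
  have ae: "a / b = 1 + (- e)" using ab by (simp add: e_def field_simps)
  have "1 + real k * (- e) \<le> (a / b) ^ k" unfolding ae using e by (intro Bernoulli_inequality) auto
  then have "(1 - a) * (1 + real k * (- e)) \<le> (1 - a) * (a / b) ^ k"
    using ab by (intro mult_left_mono) auto
  moreover have "1 - b \<le> (1 - a) * (1 + real k * (- e))"
  proof -
    have "real k * (1 - a) * e \<le> b * e" using kb e by (intro mult_right_mono) auto
    also have "b * e = b - a" using ab by (simp add: e_def)
    finally show ?thesis by (simp add: algebra_simps)
  qed
  ultimately have "1 - b \<le> (1 - a) * (a / b) ^ k" by linarith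
  then have "b ^ k * (1 - b) \<le> b ^ k * ((1 - a) * (a / b) ^ k)"
    using ab by (intro mult_left_mono) auto
  also have "\<dots> = a ^ k * (1 - a)" using ab by (simp add: power_divide)
  finally have 1: "b ^ k * (1 - b) \<le> a ^ k * (1 - a)" .
  have "b ^ k * (1 - b) * a\<^sup>2 \<le> a ^ k * (1 - a) * a\<^sup>2" using 1 by (rule mult_right_mono) simp
  also have "\<dots> < a ^ k * (1 - a) * b\<^sup>2"
    using ab by (intro mult_strict_left_mono power_strict_mono mult_pos_pos) auto
  finally show ?thesis .
qed

lemma stationary_squared:
  assumes "stationary p k lam m" "p \<ge> 1"
  shows "lam\<^sup>2 * ((m\<^sup>2) ^ k * (1 - m\<^sup>2)) = p * (m\<^sup>2)\<^sup>2"
proof -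
  have m2: "1 - m\<^sup>2 > 0" using assms by (simp add: abs_square_less_1)
  have "lam * m ^ k * sqrt (1 - m\<^sup>2) = m\<^sup>2 * sqrt p"
    using assms m2 by (simp add: field_simps)
  then have "(lam * m ^ k * sqrt (1 - m\<^sup>2))\<^sup>2 = (m\<^sup>2 * sqrt p)\<^sup>2" by simp
  then show ?thesis using m2 by (simp add: power_mult_distrib power_commutes power_mult[symmetric] mult_ac)
qed

lemma stationary_unique:
  assumes k: "k \<ge> 1" and p: "p \<ge> 1" and x: "stationary p k lam x" and y: "stationary p k lam y"
    and m: "1 - 1 / (2 * real k) \<le> x\<^sup>2" "x < y"
  shows False
proof -
  have xy: "0 < x\<^sup>2" "x\<^sup>2 < y\<^sup>2" "y\<^sup>2 < 1"
    using x y m by (auto intro: power_strict_mono simp: abs_square_less_1)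
  have lam: "lam \<noteq> 0"
  proof
    assume "lam = 0"
    with stationary_squared[OF x p] xy p show False by auto
  qed
  have "(y\<^sup>2) ^ k * (1 - y\<^sup>2) * (x\<^sup>2)\<^sup>2 < (x\<^sup>2) ^ k * (1 - x\<^sup>2) * (y\<^sup>2)\<^sup>2"
    by (rule stationary_unique_aux[OF k xy m(1)])
  then have "lam\<^sup>2 * ((y\<^sup>2) ^ k * (1 - y\<^sup>2) * (x\<^sup>2)\<^sup>2) < lam\<^sup>2 * ((x\<^sup>2) ^ k * (1 - x\<^sup>2) * (y\<^sup>2)\<^sup>2)"
    using lam by (intro mult_strict_left_mono) auto
  moreover have "lam\<^sup>2 * ((y\<^sup>2) ^ k * (1 - y\<^sup>2) * (x\<^sup>2)\<^sup>2) = p * (y\<^sup>2)\<^sup>2 * (x\<^sup>2)\<^sup>2"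
    using stationary_squared[OF y p] by (simp only: mult.assoc[symmetric])
  moreover have "lam\<^sup>2 * ((x\<^sup>2) ^ k * (1 - x\<^sup>2) * (y\<^sup>2)\<^sup>2) = p * (x\<^sup>2)\<^sup>2 * (y\<^sup>2)\<^sup>2"
    using stationary_squared[OF x p] by (simp only: mult.assoc[symmetric])
  ultimately show False by (simp only: mult_ac)
qed

text \<open>For large lam every maximiser of the profile lies so close to 1 that the stationarity
  equation has only one solution there; hence it is the largest solution.\<close>

lemma mstar_maximises:
  assumes k: "k \<ge> 1" and p: "p \<ge> 1"
  shows "\<exists>c>0. \<forall>lam>c. 0 < mstar p k lam \<and> mstar p k lam < 1 \<and>
    (\<forall>m. 0 \<le> m \<longrightarrow> m \<le> 1 \<longrightarrow> profile p k lam m \<le> profile p k lam (mstar p k lam)) \<and>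
    (\<forall>x. 0 \<le> x \<longrightarrow> x \<le> 1 \<longrightarrow> (\<forall>m. 0 \<le> m \<longrightarrow> m \<le> 1 \<longrightarrow> profile p k lam m \<le> profile p k lam x) \<longrightarrow> x = mstar p k lam)"
proof -
  define t0 where "t0 = 1 - 1 / (2 * real k)"
  have t0: "0 \<le> t0" "t0 < 1" using k by (auto simp: t0_def field_simps)
  then have st0: "sqrt t0 < 1" by simp
  \<comment> \<open>Beyond this c the value lam / k at m = 1 beats sqrt p + (lam / k) sqrt t0, which
    bounds the profile wherever m^2 \<le> t0.\<close>
  define c where "c = real k * sqrt p / (1 - sqrt t0)"
  have c: "c > 0" using k p st0 by (simp add: c_def)
  have main: "x = mstar p k lam \<and> 0 < x \<and> x < 1"
    if lam: "lam > c" and x: "0 \<le> x" "x \<le> 1" and max: "\<And>m. 0 \<le> m \<Longrightarrow> m \<le> 1 \<Longrightarrow> profile p k lam m \<le> profile p k lam x"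
    for lam x
  proof -
    have lam0: "lam > 0" using lam c by simp
    have one: "profile p k lam 1 = lam / k" by (simp add: profile_def)
    have x1: "x \<noteq> 1"
    proof
      assume "x = 1"
      \<comment> \<open>Lowering m^2 from 1 to 1 - \<tau> gains sqrt(p \<tau>) and loses at most lam
        \<tau>. The bound p / (4 lam^2) makes the loss at most half of the gain.\<close>
      define \<tau> where "\<tau> = min (1 / 2) (p / (4 * lam\<^sup>2))"
      have \<tau>: "0 < \<tau>" "\<tau> \<le> 1/2" "\<tau> \<le> p / (4 * lam\<^sup>2)" using lam0 p by (auto simp: \<tau>_def)
      define m where "m = sqrt (1 - \<tau>)"
      have m: "0 \<le> m" "m \<le> 1" "m\<^sup>2 = 1 - \<tau>" using \<tau> by (auto simp: m_def)
      have "1 - real k * \<tau> \<le> (1 - \<tau>) ^ k" using Bernoulli_inequality[of "-\<tau>" k] \<tau> by simp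
      also have "\<dots> = m ^ (2 * k)" unfolding m(3)[symmetric] by (simp add: power_mult)
      also have "\<dots> \<le> m ^ k" using m by (intro power_decreasing) auto
      finally have "lam / k * (1 - real k * \<tau>) \<le> lam / k * m ^ k" using lam0 by (intro mult_left_mono) auto
      then have "profile p k lam m \<ge> sqrt p * sqrt \<tau> + lam / k - lam * \<tau>"
        using k by (simp add: profile_def m(3) algebra_simps)
      moreover have "lam * \<tau> < sqrt p * sqrt \<tau>"
      proof (rule power2_less_imp_less)
        have "(lam * \<tau>)\<^sup>2 = lam\<^sup>2 * \<tau> * \<tau>" by (simp add: power2_eq_square)
        also have "\<dots> \<le> lam\<^sup>2 * (p / (4 * lam\<^sup>2)) * \<tau>"
          using \<tau> by (intro mult_right_mono mult_left_mono) auto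
        also have "\<dots> = p * \<tau> / 4" using lam0 by simp
        also have "\<dots> < p * \<tau>" using \<tau> p by simp
        also have "\<dots> = (sqrt p * sqrt \<tau>)\<^sup>2" using \<tau> by (simp add: power_mult_distrib)
        finally show "(lam * \<tau>)\<^sup>2 < (sqrt p * sqrt \<tau>)\<^sup>2" .
      qed (use \<tau> in auto)
      ultimately show False using max[OF m(1,2)] \<open>x = 1\<close> one by simp
    qed
    have xt: "t0 < x\<^sup>2"
    proof (rule ccontr)
      assume "\<not> ?thesis"
      then have "x \<le> sqrt t0" by (intro real_le_rsqrt) simp
      have "x ^ k \<le> x" using x k power_decreasing[of 1 k x] by simp
      then have "lam / k * x ^ k \<le> lam / k * sqrt t0"
        using \<open>x \<le> sqrt t0\<close> lam0 by (intro mult_left_mono) auto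
      moreover have "sqrt p * sqrt (1 - x\<^sup>2) \<le> sqrt p * 1" by (intro mult_left_mono) auto
      ultimately have "profile p k lam x \<le> sqrt p + lam / k * sqrt t0" by (simp add: profile_def)
      moreover have "sqrt p < lam / k * (1 - sqrt t0)"
        using lam st0 k by (simp add: c_def field_simps)
      moreover have "lam / k \<le> profile p k lam x" using max[of 1] one by simp
      ultimately show False unfolding right_diff_distrib mult_1_right by linarith
    qed
    have x0: "0 < x" using xt t0 x by (cases "x = 0") auto
    have x1': "x < 1" using x x1 by simp
    have x2: "1 - x\<^sup>2 > 0" using x0 x1' by (simp add: abs_square_less_1)
    have der: "(profile p k lam has_real_derivative (lam * x ^ (k - 1) - sqrt p * x / sqrt (1 - x\<^sup>2))) (at x)"
      unfolding profile_def
      using x2 k by (auto intro!: derivative_eq_intros simp: field_simps)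
    have "lam * x ^ (k - 1) - sqrt p * x / sqrt (1 - x\<^sup>2) = 0"
    proof (rule DERIV_local_max[OF der])
      show "0 < min x (1 - x)" using x0 x1' by simp
      show "\<forall>y. \<bar>x - y\<bar> < min x (1 - x) \<longrightarrow> profile p k lam y \<le> profile p k lam x"
        using max by (auto simp: abs_if split: if_splits)
    qed
    \<comment> \<open>Multiplying the critical equation by x gives the form used in
      \<open>mstar\<close>.\<close>
    then have "lam * x ^ (k - 1) * x = sqrt p * x / sqrt (1 - x\<^sup>2) * x" by simp
    moreover have "x ^ (k - 1) * x = x ^ k" using k by (metis Suc_diff_1 less_le_trans power_Suc2 zero_less_one)
    ultimately have "lam * x ^ k = sqrt p * (x\<^sup>2 / sqrt (1 - x\<^sup>2))"
      by (simp add: power2_eq_square mult.assoc)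
    then have st: "stationary p k lam x" using x0 x1' p by simp
    have "mstar p k lam = x"
      unfolding mstar_def
    proof (rule Greatest_equality)
      fix y assume y: "stationary p k lam y"
      show "y \<le> x"
      proof (rule ccontr)
        assume "\<not> ?thesis"
        then show False using stationary_unique[OF k p st y] xt by (simp add: t0_def)
      qed
    qed (rule st)
    then show ?thesis using x0 x1' by simp
  qed
  show ?thesis
  proof (rule exI[of _ c], rule conjI[OF c], intro allI impI)
    fix lam assume lam: "c < lam"
    obtain x where x: "x \<in> {0..1}" "\<And>m. m \<in> {0..1} \<Longrightarrow> profile p k lam m \<le> profile p k lam x"
      using continuous_attains_sup[OF compact_Icc _ continuous_profile[of p k lam]] by auto
    have "x = mstar p k lam \<and> 0 < x \<and> x < 1" using main[OF lam, of x] x by auto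
    then show "0 < mstar p k lam \<and> mstar p k lam < 1 \<and>
      (\<forall>m. 0 \<le> m \<longrightarrow> m \<le> 1 \<longrightarrow> profile p k lam m \<le> profile p k lam (mstar p k lam)) \<and>
      (\<forall>x. 0 \<le> x \<longrightarrow> x \<le> 1 \<longrightarrow> (\<forall>m. 0 \<le> m \<longrightarrow> m \<le> 1 \<longrightarrow> profile p k lam m \<le> profile p k lam x) \<longrightarrow> x = mstar p k lam)"
      using x main[OF lam] by auto
  qed
qed

text \<open>Away from x the profile loses some \<gamma> > 0, by compactness and uniqueness, whereas
  shifting lam by e changes differences of its values by at most |e|.\<close>

lemma maximiser_continuous:
  assumes k: "k \<ge> 1" and x: "0 \<le> x" "x \<le> 1"
    and max: "\<And>m. 0 \<le> m \<Longrightarrow> m \<le> 1 \<Longrightarrow> profile p k lam m \<le> profile p k lam x"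
    and uniq: "\<And>y. 0 \<le> y \<Longrightarrow> y \<le> 1 \<Longrightarrow> (\<And>m. 0 \<le> m \<Longrightarrow> m \<le> 1 \<Longrightarrow> profile p k lam m \<le> profile p k lam y) \<Longrightarrow> y = x"
    and e: "e \<longlonglongrightarrow> 0" and y: "\<And>n :: nat. 0 \<le> y n" "\<And>n. y n \<le> 1"
    and ymax: "\<And>n m. 0 \<le> m \<Longrightarrow> m \<le> 1 \<Longrightarrow> profile p k (lam + e n) m \<le> profile p k (lam + e n) (y n)"
  shows "y \<longlonglongrightarrow> x"
proof (rule LIMSEQ_I)
  fix \<delta> :: real assume \<delta>: "0 < \<delta>"
  define K where "K = {0..1} - ball x \<delta>"
  have K: "compact K" unfolding K_def by (intro compact_diff) auto
  obtain \<gamma> where \<gamma>: "\<gamma> > 0" "\<And>m. m \<in> K \<Longrightarrow> profile p k lam m \<le> profile p k lam x - \<gamma>"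
  proof (cases "K = {}")
    case True
    then show ?thesis using that[of 1] by simp
  next
    case False
    have "continuous_on K (profile p k lam)"
      by (rule continuous_on_subset[OF continuous_profile]) (auto simp: K_def)
    then obtain z where z: "z \<in> K" "\<And>m. m \<in> K \<Longrightarrow> profile p k lam m \<le> profile p k lam z"
      using continuous_attains_sup[OF K False] by blast
    have z01: "0 \<le> z" "z \<le> 1" "z \<noteq> x" using z \<delta> by (auto simp: K_def)
    have "profile p k lam z < profile p k lam x"
    proof (rule ccontr)
      assume "\<not> ?thesis"
      then have "profile p k lam m \<le> profile p k lam z" if "0 \<le> m" "m \<le> 1" for m
        using max[OF that] by simp
      then show False using uniq[OF z01(1,2)] z01(3) by blast
    qed
    then show ?thesis using that[of "profile p k lam x - profile p k lam z"] z(2) by simp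
  qed
  from LIMSEQ_D[OF e \<gamma>(1)] obtain n0 where n0: "\<And>n. n \<ge> n0 \<Longrightarrow> \<bar>e n\<bar> < \<gamma>" by auto
  have "norm (y n - x) < \<delta>" if n: "n \<ge> n0" for n
  proof (rule ccontr)
    assume "\<not> ?thesis"
    then have "y n \<in> K" using y[of n] by (auto simp: K_def dist_real_def)
    then have 1: "profile p k lam (y n) \<le> profile p k lam x - \<gamma>" by (rule \<gamma>(2))
    have shift: "profile p k (lam + e n) m = profile p k lam m + e n / k * m ^ k" for m
      by (simp add: profile_def add_divide_distrib distrib_right)
    have "profile p k lam x - profile p k lam (y n) \<le> e n / k * (y n ^ k - x ^ k)"
      using ymax[OF x, of n] unfolding shift by (simp add: algebra_simps)
    also have "\<dots> \<le> \<bar>e n / k\<bar> * \<bar>y n ^ k - x ^ k\<bar>" by (metis abs_ge_self abs_mult)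
    also have "\<dots> \<le> \<bar>e n\<bar> * 1"
    proof (intro mult_mono)
      show "\<bar>e n / k\<bar> \<le> \<bar>e n\<bar>" using k by (simp add: abs_divide divide_le_eq mult_le_cancel_left1)
      have "0 \<le> y n ^ k" "y n ^ k \<le> 1" "0 \<le> x ^ k" "x ^ k \<le> 1" using x y by (auto intro: power_le_one)
      then show "\<bar>y n ^ k - x ^ k\<bar> \<le> 1" by linarith
    qed auto
    finally show False using 1 n0[OF n] by simp
  qed
  then show "\<exists>no. \<forall>n\<ge>no. norm (y n - x) < \<delta>" by blast
qed

section \<open>Concentration of the supremum\<close>

text \<open>Laws are compared through tail functions because every step has its own product space.
  Absorbing sqrt p makes s^2 + r^2 = 1 the path of the interpolation.\<close>

definition exceed :: "nat \<Rightarrow> nat \<Rightarrow> nat \<Rightarrow> real \<Rightarrow> fvec \<Rightarrow> real \<Rightarrow> real \<Rightarrow> real \<Rightarrow> real" where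
  "exceed N p k lam v s r a = measure (gaussian (idx p N)) {x \<in> space (gaussian (idx p N)). a < field_sup N p k lam v s (sqrt p * r) x}"

lemma summable_exp_linear:
  assumes "0 < c"
  shows "summable (\<lambda>N. exp (- (c * real N)))"
proof -
  have "(\<lambda>N. exp (- (c * real N))) = (\<lambda>N. exp (- c) ^ N)"
    by (simp add: exp_of_nat_mult[symmetric] mult.commute)
  moreover have "norm (exp (- c)) < 1" using assms by simp
  ultimately show ?thesis by (simp only: summable_geometric)
qed

text \<open>The variance moves from the tensor to the linear field in n equal parts, \<eta>^2 = 1 /
  n. Since n is fixed by Q and \<delta> before N, n times the summable error of one step is
  summable.\<close>

lemma interpolation:
  assumes p: "p \<ge> 2" and k: "k \<ge> 1"
  shows "\<exists>c>0. \<forall>lam\<ge>c. \<forall>\<delta>>0. \<exists>\<beta>. summable \<beta> \<and> (\<forall>N\<ge>1. \<forall>v\<in>Rspace N. \<forall>a. norm v = 1 \<longrightarrow>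
     exceed N p k lam v 1 0 a \<le> exceed N p k lam v 0 1 (a - \<delta>) + \<beta> N \<and>
     exceed N p k lam v 0 1 a \<le> exceed N p k lam v 1 0 (a - \<delta>) + \<beta> N)"
proof -
  obtain c where c: "c > 0" and step: "\<forall>lam\<ge>c. \<exists>Q>0. \<forall>\<eta>. 0 < \<eta> \<longrightarrow> \<eta> \<le> 1 \<longrightarrow> (\<forall>N\<ge>1. \<forall>v\<in>Rspace N. \<forall>s r a. norm v = 1 \<longrightarrow> 0 \<le> s \<longrightarrow> 0 \<le> r \<longrightarrow> s\<^sup>2 + r\<^sup>2 \<le> 1 \<longrightarrow>
     (let P = (\<lambda>s r a. measure (gaussian (idx p N)) {x \<in> space (gaussian (idx p N)). a < field_sup N p k lam v s (sqrt p * r) x});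
          s1 = sqrt (s\<^sup>2 + \<eta>\<^sup>2); r1 = sqrt (r\<^sup>2 + \<eta>\<^sup>2);
          \<beta> = 6 * exp (- real N) + 2 * exp (- (\<eta> ^ 4 * N / 2)) + 2 * exp (- (\<eta> ^ 4 * N / (2 * real p)))
      in P s1 r a \<le> P s r1 (a - Q * \<eta> ^ 3) + \<beta> \<and> P s r1 a \<le> P s1 r (a - Q * \<eta> ^ 3) + \<beta>))"
    using interpolation_step[OF p k] by (elim exE conjE) (rule that)
  show ?thesis
  proof (rule exI[of _ c], rule conjI[OF c], intro allI impI)
    fix lam \<delta> :: real assume lam: "c \<le> lam" and \<delta>: "0 < \<delta>"
    from step[rule_format, OF lam] obtain Q where Q: "Q > 0" and st: "\<forall>\<eta>. 0 < \<eta> \<longrightarrow> \<eta> \<le> 1 \<longrightarrow> (\<forall>N\<ge>1. \<forall>v\<in>Rspace N. \<forall>s r a. norm v = 1 \<longrightarrow> 0 \<le> s \<longrightarrow> 0 \<le> r \<longrightarrow> s\<^sup>2 + r\<^sup>2 \<le> 1 \<longrightarrow>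
     (let P = (\<lambda>s r a. measure (gaussian (idx p N)) {x \<in> space (gaussian (idx p N)). a < field_sup N p k lam v s (sqrt p * r) x});
          s1 = sqrt (s\<^sup>2 + \<eta>\<^sup>2); r1 = sqrt (r\<^sup>2 + \<eta>\<^sup>2);
          \<beta> = 6 * exp (- real N) + 2 * exp (- (\<eta> ^ 4 * N / 2)) + 2 * exp (- (\<eta> ^ 4 * N / (2 * real p)))
      in P s1 r a \<le> P s r1 (a - Q * \<eta> ^ 3) + \<beta> \<and> P s r1 a \<le> P s1 r (a - Q * \<eta> ^ 3) + \<beta>))"
      by (elim exE conjE) (rule that)
    \<comment> \<open>n \<ge> (Q / \<delta>)^2 makes the total drift n Q \<eta>^3 = Q / sqrt n of
      the threshold at most \<delta>.\<close>
    obtain n0 :: nat where n0: "(Q / \<delta>)\<^sup>2 < n0" using reals_Archimedean2 by blast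
    define n where "n = n0 + 1"
    have n: "n \<ge> 1" "(Q / \<delta>)\<^sup>2 \<le> n" using n0 by (auto simp: n_def)
    define \<eta> where "\<eta> = sqrt (1 / n)"
    have \<eta>: "0 < \<eta>" "\<eta> \<le> 1" "\<eta>\<^sup>2 = 1 / n" using n by (auto simp: \<eta>_def)
    have err: "n * (Q * \<eta> ^ 3) \<le> \<delta>"
    proof -
      have "n * (Q * \<eta> ^ 3) = Q * \<eta> * (n * \<eta>\<^sup>2)" by (simp add: power3_eq_cube power2_eq_square)
      also have "\<dots> = Q * \<eta>" using n by (simp add: \<eta>(3))
      also have "\<dots> \<le> \<delta>"
      proof -
        have "Q / \<delta> \<le> sqrt n" using n(2) by (rule real_le_rsqrt)
        then show ?thesis using n \<delta> by (simp add: \<eta>_def real_sqrt_divide field_simps)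
      qed
      finally show ?thesis .
    qed
    define b where "b N = 6 * exp (- real N) + 2 * exp (- (\<eta> ^ 4 * N / 2)) + 2 * exp (- (\<eta> ^ 4 * N / (2 * real p)))" for N :: nat
    have sb: "summable b"
    proof -
      have "summable (\<lambda>N. 6 * exp (- (1 * real N)) + 2 * exp (- ((\<eta> ^ 4 / 2) * real N)) + 2 * exp (- ((\<eta> ^ 4 / (2 * real p)) * real N)))"
        using \<eta>(1) p by (intro summable_add summable_mult summable_exp_linear) auto
      then show ?thesis by (simp add: b_def[abs_def])
    qed
    \<comment> \<open>Squares run linearly in j. Steps j and j + 1 share the amplitudes
      \<open>S (Suc j)\<close> and \<open>R j\<close>, whose squares add up to 1 - \<eta>^2; the
      missing \<eta>^2 is the increment.\<close>
    define S where "S j = sqrt (1 - real j / n)" for j :: nat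
    define R where "R j = sqrt (real j / n)" for j :: nat
    have iter: "exceed N p k lam v (S 0) (R 0) a \<le> exceed N p k lam v (S j) (R j) (a - j * (Q * \<eta> ^ 3)) + j * b N"
      "exceed N p k lam v (S j) (R j) a \<le> exceed N p k lam v (S 0) (R 0) (a - j * (Q * \<eta> ^ 3)) + j * b N"
      if N: "N \<ge> 1" and v: "v \<in> Rspace N" "norm v = 1" and j: "j \<le> n" for N v a j
    proof -
      have one: "exceed N p k lam v (S j) (R j) a \<le> exceed N p k lam v (S (Suc j)) (R (Suc j)) (a - Q * \<eta> ^ 3) + b N \<and>
         exceed N p k lam v (S (Suc j)) (R (Suc j)) a \<le> exceed N p k lam v (S j) (R j) (a - Q * \<eta> ^ 3) + b N"
        if "j < n" for j a
      proof -
        have jn: "real (Suc j) / n \<le> 1" using that by simp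
        have sq: "(S (Suc j))\<^sup>2 = 1 - real (Suc j) / n" "(R j)\<^sup>2 = real j / n"
          using jn by (simp_all add: S_def R_def)
        have "sqrt ((S (Suc j))\<^sup>2 + \<eta>\<^sup>2) = S j" "sqrt ((R j)\<^sup>2 + \<eta>\<^sup>2) = R (Suc j)"
          unfolding sq \<eta>(3) by (simp_all add: S_def R_def add_divide_distrib)
        moreover have "(S (Suc j))\<^sup>2 + (R j)\<^sup>2 \<le> 1" unfolding sq by (simp add: add_divide_distrib)
        moreover have "0 \<le> S (Suc j)" "0 \<le> R j" using jn by (auto simp: S_def R_def)
        ultimately show ?thesis
          using st[rule_format, OF \<eta>(1,2) N v, of "S (Suc j)" "R j" a]
          unfolding Let_def exceed_def b_def by simp
      qed
      show "exceed N p k lam v (S 0) (R 0) a \<le> exceed N p k lam v (S j) (R j) (a - j * (Q * \<eta> ^ 3)) + j * b N"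
        using j
      proof (induction j)
        case (Suc j)
        then have "exceed N p k lam v (S 0) (R 0) a \<le> exceed N p k lam v (S j) (R j) (a - j * (Q * \<eta> ^ 3)) + j * b N"
          by simp
        moreover have "exceed N p k lam v (S j) (R j) (a - j * (Q * \<eta> ^ 3)) \<le> exceed N p k lam v (S (Suc j)) (R (Suc j)) (a - j * (Q * \<eta> ^ 3) - Q * \<eta> ^ 3) + b N"
          using one[of j "a - j * (Q * \<eta> ^ 3)"] Suc.prems by simp
        moreover have "a - j * (Q * \<eta> ^ 3) - Q * \<eta> ^ 3 = a - Suc j * (Q * \<eta> ^ 3)" by (simp add: algebra_simps)
        ultimately show ?case by (simp add: algebra_simps)
      qed simp
      show "exceed N p k lam v (S j) (R j) a \<le> exceed N p k lam v (S 0) (R 0) (a - j * (Q * \<eta> ^ 3)) + j * b N"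
        using j
      proof (induction j arbitrary: a)
        case (Suc j)
        have "exceed N p k lam v (S (Suc j)) (R (Suc j)) a \<le> exceed N p k lam v (S j) (R j) (a - Q * \<eta> ^ 3) + b N"
          using one[of j a] Suc.prems by simp
        moreover have "exceed N p k lam v (S j) (R j) (a - Q * \<eta> ^ 3) \<le> exceed N p k lam v (S 0) (R 0) (a - Q * \<eta> ^ 3 - j * (Q * \<eta> ^ 3)) + j * b N"
          using Suc by simp
        moreover have "a - Q * \<eta> ^ 3 - j * (Q * \<eta> ^ 3) = a - Suc j * (Q * \<eta> ^ 3)" by (simp add: algebra_simps)
        ultimately show ?case by (simp add: algebra_simps)
      qed simp
    qed
    have ends: "S 0 = 1" "R 0 = 0" "S n = 0" "R n = 1" using n by (auto simp: S_def R_def)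
    have mono: "exceed N p k lam v s r (a - n * (Q * \<eta> ^ 3)) \<le> exceed N p k lam v s r (a - \<delta>)"
      if "N \<ge> 1" "v \<in> Rspace N" "norm v = 1" for N v s r a
    proof -
      interpret prob_space "gaussian (idx p N)" by (rule prob_space_gaussian)
      show ?thesis unfolding exceed_def
      proof (rule finite_measure_mono)
        show "{x \<in> space (gaussian (idx p N)). a - n * (Q * \<eta> ^ 3) < field_sup N p k lam v s (sqrt p * r) x}
          \<subseteq> {x \<in> space (gaussian (idx p N)). a - \<delta> < field_sup N p k lam v s (sqrt p * r) x}"
          using err by auto
        show "{x \<in> space (gaussian (idx p N)). a - \<delta> < field_sup N p k lam v s (sqrt p * r) x} \<in> sets (gaussian (idx p N))"
          by (intro borel_measurable_less borel_measurable_const field_sup_measurable that)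
      qed
    qed
    show "\<exists>\<beta>. summable \<beta> \<and> (\<forall>N\<ge>1. \<forall>v\<in>Rspace N. \<forall>a. norm v = 1 \<longrightarrow>
     exceed N p k lam v 1 0 a \<le> exceed N p k lam v 0 1 (a - \<delta>) + \<beta> N \<and>
     exceed N p k lam v 0 1 a \<le> exceed N p k lam v 1 0 (a - \<delta>) + \<beta> N)"
    proof (rule exI[of _ "\<lambda>N. n * b N"], intro conjI allI impI ballI)
      show "summable (\<lambda>N. n * b N)" by (rule summable_mult[OF sb])
      fix N v a assume h: "1 \<le> N" "v \<in> Rspace N" "norm v = 1"
      show "exceed N p k lam v 1 0 a \<le> exceed N p k lam v 0 1 (a - \<delta>) + n * b N"
        using iter(1)[OF h order_refl, of a] mono[OF h, of 0 1 a] unfolding ends by linarith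
      show "exceed N p k lam v 0 1 a \<le> exceed N p k lam v 1 0 (a - \<delta>) + n * b N"
        using iter(2)[OF h order_refl, of a] mono[OF h, of 1 0 a] unfolding ends by linarith
    qed
  qed
qed

lemma card_tidx_1: "card (tidx 1 N) = N"
  unfolding tidx_1 by (subst card_image) (auto simp: inj_on_def)

text \<open>With g the linear coefficients divided by sqrt N, the inner product of g and v is the
  linear field at v and N |g|^2 is chi-square with N degrees of freedom. Once both are near their
  means, \<open>linear_field_sup\<close> is deterministic.\<close>

lemma linear_end:
  assumes mx: "0 \<le> mx" "mx \<le> 1" "\<forall>m. 0 \<le> m \<longrightarrow> m \<le> 1 \<longrightarrow> profile p k lam m \<le> profile p k lam mx"
    and \<delta>: "0 < \<delta>" "\<delta> \<le> 1/2"
  shows "\<exists>\<beta>. summable \<beta> \<and> (\<forall>N\<ge>1. \<forall>v\<in>Rspace N. \<forall>a. norm v = 1 \<longrightarrow>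
     (profile p k lam mx + 3 * sqrt p * \<delta> \<le> a \<longrightarrow> exceed N p k lam v 0 1 a \<le> \<beta> N) \<and>
     (a < profile p k lam mx - 3 * sqrt p * \<delta> \<longrightarrow> 1 - \<beta> N \<le> exceed N p k lam v 0 1 a))"
proof -
  obtain \<rho> where \<rho>: "0 \<le> \<rho>" "\<rho> < 1" and sq: "\<forall>A :: nat list set. finite A \<longrightarrow>
    measure (gaussian A) {x \<in> space (gaussian A). \<delta> * card A \<le> \<bar>(\<Sum>i\<in>A. (x i)\<^sup>2) - card A\<bar>} \<le> 2 * \<rho> ^ card A"
    using gaussian_square_tail[OF \<delta>(1), where 'i="nat list"] by (elim exE conjE) (rule that)
  define \<beta> where "\<beta> N = 2 * exp (- ((\<delta>\<^sup>2 / 2) * real N)) + 2 * \<rho> ^ N" for N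
  have "summable \<beta>"
    unfolding \<beta>_def[abs_def] using \<delta> \<rho> by (intro summable_add summable_mult summable_exp_linear summable_geometric) auto
  moreover have "(profile p k lam mx + 3 * sqrt p * \<delta> \<le> a \<longrightarrow> exceed N p k lam v 0 1 a \<le> \<beta> N) \<and>
     (a < profile p k lam mx - 3 * sqrt p * \<delta> \<longrightarrow> 1 - \<beta> N \<le> exceed N p k lam v 0 1 a)"
    if N: "N \<ge> 1" and v: "v \<in> Rspace N" "norm v = 1" for N v a
  proof -
    let ?I = "idx p N" and ?T = "tidx 1 N" and ?U = "profile p k lam mx"
    interpret I: prob_space "gaussian ?I" by (rule prob_space_gaussian)
    interpret T: prob_space "gaussian ?T" by (rule prob_space_gaussian)
    define A1 where "A1 = {x \<in> space (gaussian ?T). \<delta> \<le> \<bar>pspin N 1 x v\<bar>}"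
    define A2 where "A2 = {x \<in> space (gaussian ?T). \<delta> * card ?T \<le> \<bar>(\<Sum>i\<in>?T. (x i)\<^sup>2) - card ?T\<bar>}"
    have A1: "A1 \<in> sets (gaussian ?T)" "measure (gaussian ?T) A1 \<le> 2 * exp (- ((\<delta>\<^sup>2 / 2) * real N))"
    proof -
      note t = pspin_point_tail[OF N v(2) less_imp_le[OF \<delta>(1)], of 1]
      show "A1 \<in> sets (gaussian ?T)" unfolding A1_def by (rule t(1))
      have "2 * exp (- (\<delta>\<^sup>2 * real N / 2)) = 2 * exp (- ((\<delta>\<^sup>2 / 2) * real N))" by simp
      with t(2) show "measure (gaussian ?T) A1 \<le> 2 * exp (- ((\<delta>\<^sup>2 / 2) * real N))"
        unfolding A1_def by linarith
    qed
    have A2: "A2 \<in> sets (gaussian ?T)"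
      unfolding A2_def
      by (intro borel_measurable_le borel_measurable_const borel_measurable_abs borel_measurable_diff borel_measurable_sum
        borel_measurable_power measurable_gaussian_component)
    have A2': "measure (gaussian ?T) A2 \<le> 2 * \<rho> ^ N"
      using sq[rule_format, of ?T] unfolding A2_def card_tidx_1 by simp
    define B where "B = (\<lambda>x. \<lambda>i\<in>?T. x i) -` (A1 \<union> A2) \<inter> space (gaussian ?I)"
    have m: "(\<lambda>x. \<lambda>i\<in>?T. x i) \<in> measurable (gaussian ?I) (gaussian ?T)"
      by (rule measurable_restrict_gaussian, rule measurable_gaussian_component) blast
    have A12: "A1 \<union> A2 \<in> sets (gaussian ?T)" by (rule sets.Un[OF A1(1) A2])
    have BS: "B \<in> sets (gaussian ?I)" unfolding B_def by (rule measurable_sets[OF m A12])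
    have "measure (gaussian ?I) B = measure (gaussian ?T) (A1 \<union> A2)"
      unfolding B_def by (rule measure_distr_eq[OF gaussian_marginal m A12, symmetric]) simp_all
    also have "\<dots> \<le> \<beta> N"
      using measure_Un_le[OF A1(1) A2] A1(2) A2' unfolding \<beta>_def by linarith
    finally have PB: "measure (gaussian ?I) B \<le> \<beta> N" .
    have dev: "\<bar>field_sup N p k lam v 0 (sqrt p * 1) x - ?U\<bar> \<le> 3 * sqrt p * \<delta>" if x: "x \<in> space (gaussian ?I) - B" for x
    proof -
      define g where "g = vec_of N (\<lambda>i. x [i] / sqrt N)"
      have gR: "g \<in> Rspace N" by (simp add: g_def)
      have gu: "g \<bullet> u = pspin N 1 x u" for u
        unfolding inner_Rspace[OF gR] pspin_1 by (simp add: g_def sum_divide_distrib mult.commute)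
      have "(\<lambda>i\<in>?T. x i) \<in> space (gaussian ?T)" using measurable_space[OF m] x by blast
      then have na: "(\<lambda>i\<in>?T. x i) \<notin> A1" "(\<lambda>i\<in>?T. x i) \<notin> A2" using x by (auto simp: B_def)
      have "pspin N 1 (\<lambda>i\<in>?T. x i) v = pspin N 1 x v" by (rule pspin_cong) simp
      then have g1: "\<bar>g \<bullet> v\<bar> \<le> \<delta>"
        using na(1) \<open>(\<lambda>i\<in>?T. x i) \<in> space (gaussian ?T)\<close> unfolding A1_def gu by auto
      have "\<not> \<delta> * N \<le> \<bar>(\<Sum>i\<in>?T. (x i)\<^sup>2) - N\<bar>"
        using na(2) \<open>(\<lambda>i\<in>?T. x i) \<in> space (gaussian ?T)\<close> unfolding A2_def card_tidx_1 by auto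
      moreover have "(\<Sum>i\<in>?T. (x i)\<^sup>2) = (\<Sum>i<N. (x [i])\<^sup>2)"
        unfolding tidx_1 by (subst sum.reindex) (auto simp: inj_on_def)
      moreover have "(norm g)\<^sup>2 = (\<Sum>i<N. (x [i])\<^sup>2) / N"
        unfolding norm_Rspace[OF gR] by (simp add: g_def power_divide sum_divide_distrib)
      ultimately have "\<bar>(norm g)\<^sup>2 * N - N\<bar> < \<delta> * N" using N by simp
      moreover have "(norm g)\<^sup>2 * N - N = ((norm g)\<^sup>2 - 1) * N" by (simp add: algebra_simps)
      ultimately have "\<bar>(norm g)\<^sup>2 - 1\<bar> * N < \<delta> * N" by (simp add: abs_mult)
      then have g2: "\<bar>(norm g)\<^sup>2 - 1\<bar> \<le> \<delta>" using N by simp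
      have "field_sup N p k lam v 0 (sqrt p * 1) x = (SUP u\<in>halfsphere (Rspace N) v. sqrt p * (g \<bullet> u) + lam / k * (u \<bullet> v) ^ k)"
        unfolding field_sup_def by (intro arg_cong[where f=Sup] image_cong refl) (simp add: field_def gu)
      then show ?thesis
        using linear_field_sup[OF subspace_Rspace v gR \<delta> g1 g2 _ mx(1,2), of "sqrt p" "\<lambda>m. lam / k * m ^ k"] mx(3)
        unfolding profile_def by simp
    qed
    have E: "{x \<in> space (gaussian ?I). a < field_sup N p k lam v 0 (sqrt p * 1) x} \<in> sets (gaussian ?I)"
      by (intro borel_measurable_less borel_measurable_const field_sup_measurable N v)
    show ?thesis
    proof (intro conjI impI)
      assume a: "?U + 3 * sqrt p * \<delta> \<le> a"
      have "{x \<in> space (gaussian ?I). a < field_sup N p k lam v 0 (sqrt p * 1) x} \<subseteq> B"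
      proof
        fix x assume x: "x \<in> {x \<in> space (gaussian ?I). a < field_sup N p k lam v 0 (sqrt p * 1) x}"
        show "x \<in> B"
        proof (rule ccontr)
          assume "x \<notin> B"
          then have "x \<in> space (gaussian ?I) - B" using x by blast
          from dev[OF this] x a show False by auto
        qed
      qed
      from I.finite_measure_mono[OF this BS] PB
      show "exceed N p k lam v 0 1 a \<le> \<beta> N" unfolding exceed_def by linarith
    next
      assume a: "a < ?U - 3 * sqrt p * \<delta>"
      have "space (gaussian ?I) - B \<subseteq> {x \<in> space (gaussian ?I). a < field_sup N p k lam v 0 (sqrt p * 1) x}"
      proof
        fix x assume x: "x \<in> space (gaussian ?I) - B"
        with dev[OF x] a show "x \<in> {x \<in> space (gaussian ?I). a < field_sup N p k lam v 0 (sqrt p * 1) x}"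
          by auto
      qed
      from I.finite_measure_mono[OF this E] I.prob_compl[OF BS] PB
      show "1 - \<beta> N \<le> exceed N p k lam v 0 1 a" unfolding exceed_def by linarith
    qed
  qed
  ultimately show ?thesis by (intro exI[of _ \<beta>] conjI allI impI ballI) simp_all
qed

text \<open>The two directions of \<open>interpolation\<close> carry the two tails from the linear
  end to the p-spin end.\<close>

lemma field_sup_concentration:
  assumes p: "p \<ge> 2" and k: "k \<ge> 1"
  shows "\<exists>c>0. \<forall>lam\<ge>c. \<forall>mx. 0 \<le> mx \<longrightarrow> mx \<le> 1 \<longrightarrow> (\<forall>m. 0 \<le> m \<longrightarrow> m \<le> 1 \<longrightarrow> profile p k lam m \<le> profile p k lam mx) \<longrightarrow>
    (\<forall>\<delta>>0. \<exists>\<beta>. summable \<beta> \<and> (\<forall>N\<ge>1. \<forall>v\<in>Rspace N. norm v = 1 \<longrightarrow>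
     measure (gaussian (idx p N)) {x \<in> space (gaussian (idx p N)). \<delta> < \<bar>field_sup N p k lam v 1 0 x - profile p k lam mx\<bar>} \<le> \<beta> N))"
proof -
  obtain c where c: "c > 0" and ip: "\<forall>lam\<ge>c. \<forall>\<delta>>0. \<exists>\<beta>. summable \<beta> \<and> (\<forall>N\<ge>1. \<forall>v\<in>Rspace N. \<forall>a. norm v = 1 \<longrightarrow>
     exceed N p k lam v 1 0 a \<le> exceed N p k lam v 0 1 (a - \<delta>) + \<beta> N \<and>
     exceed N p k lam v 0 1 a \<le> exceed N p k lam v 1 0 (a - \<delta>) + \<beta> N)"
    using interpolation[OF p k] by (elim exE conjE) (rule that)
  show ?thesis
  proof (rule exI[of _ c], rule conjI[OF c], intro allI impI)
    fix lam mx \<delta> :: real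
    assume lam: "c \<le> lam" and mx: "0 \<le> mx" "mx \<le> 1" and max: "\<forall>m. 0 \<le> m \<longrightarrow> m \<le> 1 \<longrightarrow> profile p k lam m \<le> profile p k lam mx"
      and \<delta>: "0 < \<delta>"
    let ?U = "profile p k lam mx"
    \<comment> \<open>Half of \<delta> is spent on the interpolation; 3 sqrt p d \<le> \<delta> / 4
      fits strictly into the other half.\<close>
    define d where "d = min (1/2) (\<delta> / (12 * sqrt p))"
    have sp: "sqrt p > 0" using p by simp
    have d: "0 < d" "d \<le> 1/2" using \<delta> sp by (auto simp: d_def)
    have d3: "3 * sqrt p * d \<le> \<delta> / 4"
    proof -
      have "3 * sqrt p * d \<le> 3 * sqrt p * (\<delta> / (12 * sqrt p))"
        using sp by (intro mult_left_mono) (auto simp: d_def)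
      then show ?thesis using sp by simp
    qed
    have \<delta>2: "0 < \<delta> / 2" using \<delta> by simp
    from ip[rule_format, OF lam \<delta>2] obtain b1 where b1: "summable b1" "\<forall>N\<ge>1. \<forall>v\<in>Rspace N. \<forall>a. norm v = 1 \<longrightarrow>
     exceed N p k lam v 1 0 a \<le> exceed N p k lam v 0 1 (a - \<delta> / 2) + b1 N \<and>
     exceed N p k lam v 0 1 a \<le> exceed N p k lam v 1 0 (a - \<delta> / 2) + b1 N"
      by (elim exE conjE) (rule that)
    from linear_end[OF mx max d] obtain b2 where b2: "summable b2" "\<forall>N\<ge>1. \<forall>v\<in>Rspace N. \<forall>a. norm v = 1 \<longrightarrow>
     (?U + 3 * sqrt p * d \<le> a \<longrightarrow> exceed N p k lam v 0 1 a \<le> b2 N) \<and>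
     (a < ?U - 3 * sqrt p * d \<longrightarrow> 1 - b2 N \<le> exceed N p k lam v 0 1 a)"
      by (elim exE conjE) (rule that)
    have "measure (gaussian (idx p N)) {x \<in> space (gaussian (idx p N)). \<delta> < \<bar>field_sup N p k lam v 1 0 x - ?U\<bar>} \<le> 2 * (b1 N + b2 N)"
      if N: "N \<ge> 1" and v: "v \<in> Rspace N" "norm v = 1" for N v
    proof -
      let ?I = "idx p N" and ?S = "field_sup N p k lam v 1 0"
      interpret prob_space "gaussian ?I" by (rule prob_space_gaussian)
      define E where "E a = {x \<in> space (gaussian ?I). a < ?S x}" for a
      have E: "E a \<in> sets (gaussian ?I)" for a
        unfolding E_def by (intro borel_measurable_less borel_measurable_const field_sup_measurable N v)
      have ex: "exceed N p k lam v 1 0 a = measure (gaussian ?I) (E a)" for a by (simp add: exceed_def E_def)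
      have up: "measure (gaussian ?I) (E (?U + \<delta>)) \<le> b1 N + b2 N"
      proof -
        have "exceed N p k lam v 1 0 (?U + \<delta>) \<le> exceed N p k lam v 0 1 (?U + \<delta> - \<delta> / 2) + b1 N"
          using b1(2)[rule_format, OF N v] by blast
        moreover have "exceed N p k lam v 0 1 (?U + \<delta> - \<delta> / 2) \<le> b2 N"
          using b2(2)[rule_format, OF N v, of "?U + \<delta> - \<delta> / 2"] d3 \<delta> by simp
        ultimately show ?thesis unfolding ex by linarith
      qed
      have lo: "1 - measure (gaussian ?I) (E (?U - \<delta>)) \<le> b1 N + b2 N"
      proof -
        have "exceed N p k lam v 0 1 (?U - \<delta> / 2) \<le> exceed N p k lam v 1 0 (?U - \<delta> / 2 - \<delta> / 2) + b1 N"
          using b1(2)[rule_format, OF N v] by blast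
        moreover have "1 - b2 N \<le> exceed N p k lam v 0 1 (?U - \<delta> / 2)"
          using b2(2)[rule_format, OF N v, of "?U - \<delta> / 2"] d3 \<delta> by simp
        moreover have "?U - \<delta> / 2 - \<delta> / 2 = ?U - \<delta>" by simp
        ultimately show ?thesis unfolding ex by simp
      qed
      have "measure (gaussian ?I) {x \<in> space (gaussian ?I). \<delta> < \<bar>?S x - ?U\<bar>} \<le> measure (gaussian ?I) (E (?U + \<delta>) \<union> (space (gaussian ?I) - E (?U - \<delta>)))"
        by (rule finite_measure_mono[OF _ sets.Un[OF E sets.compl_sets[OF E]]]) (auto simp: E_def)
      also have "\<dots> \<le> measure (gaussian ?I) (E (?U + \<delta>)) + measure (gaussian ?I) (space (gaussian ?I) - E (?U - \<delta>))"
        by (rule measure_Un_le[OF E sets.compl_sets[OF E]])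
      also have "measure (gaussian ?I) (space (gaussian ?I) - E (?U - \<delta>)) = 1 - measure (gaussian ?I) (E (?U - \<delta>))"
        by (rule prob_compl[OF E])
      finally show ?thesis using up lo by simp
    qed
    moreover have "summable (\<lambda>N. 2 * (b1 N + b2 N))" by (intro summable_mult summable_add b1(1) b2(1))
    ultimately show "\<exists>\<beta>. summable \<beta> \<and> (\<forall>N\<ge>1. \<forall>v\<in>Rspace N. norm v = 1 \<longrightarrow>
     measure (gaussian (idx p N)) {x \<in> space (gaussian (idx p N)). \<delta> < \<bar>field_sup N p k lam v 1 0 x - ?U\<bar>} \<le> \<beta> N)"
      by (intro exI[of _ "\<lambda>N. 2 * (b1 N + b2 N)"]) blast
  qed
qed

section \<open>Passage to the random tensor and almost sure convergence\<close>

lemma pspin_measurable_restrict: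
  "(\<lambda>x. \<lambda>i\<in>idx p N. if i \<in> tidx p N then x i else 0) \<in> measurable (gaussian (tidx p N)) (gaussian (idx p N))"
proof (rule measurable_restrict_gaussian)
  fix i
  show "(\<lambda>x. if i \<in> tidx p N then x i else 0) \<in> borel_measurable (gaussian (tidx p N))"
  proof (cases "i \<in> tidx p N")
    case True
    show ?thesis unfolding if_P[OF True] by (rule measurable_gaussian_component[OF True])
  next
    case False
    show ?thesis unfolding if_not_P[OF False] by (rule borel_measurable_const)
  qed
qed

lemma field_sup_cong:
  assumes "\<And>is. is \<in> tidx p N \<Longrightarrow> x is = y is"
  shows "field_sup N p k lam v s 0 x = field_sup N p k lam v s 0 y"
  using pspin_cong[OF assms, of p N] unfolding field_sup_def field_def by simp

lemma field_sup_deviation_measure: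
  fixes N p k :: nat and lam \<delta> U :: real
  assumes N: "N \<ge> 1" and v: "v \<in> Rspace N" "norm v = 1"
  defines "E \<equiv> {x \<in> space (gaussian (tidx p N)). \<delta> < \<bar>field_sup N p k lam v 1 0 x - U\<bar>}"
  shows "E \<in> sets (gaussian (tidx p N))"
    "measure (gaussian (tidx p N)) E = measure (gaussian (idx p N)) {x \<in> space (gaussian (idx p N)). \<delta> < \<bar>field_sup N p k lam v 1 0 x - U\<bar>}"
proof -
  let ?I = "idx p N" and ?T = "tidx p N"
  define F where "F = {x \<in> space (gaussian ?I). \<delta> < \<bar>field_sup N p k lam v 1 0 x - U\<bar>}"
  have F: "F \<in> sets (gaussian ?I)"
    unfolding F_def by (intro borel_measurable_less borel_measurable_const borel_measurable_abs borel_measurable_diff field_sup_measurable N v)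
  define e where "e x = (\<lambda>i\<in>?I. if i \<in> ?T then x i else 0)" for x :: "nat list \<Rightarrow> real"
  have e: "e \<in> measurable (gaussian ?T) (gaussian ?I)"
    unfolding e_def[abs_def] by (rule pspin_measurable_restrict)
  have fe: "field_sup N p k lam v 1 0 (e x) = field_sup N p k lam v 1 0 x" for x
    by (rule field_sup_cong) (simp add: e_def)
  have EF: "E = e -` F \<inter> space (gaussian ?T)"
    using measurable_space[OF e] by (auto simp: E_def F_def fe)
  show E: "E \<in> sets (gaussian ?T)" unfolding EF by (rule measurable_sets[OF e F])
  have m: "(\<lambda>x. \<lambda>i\<in>?T. x i) \<in> measurable (gaussian ?I) (gaussian ?T)"
    by (rule measurable_restrict_gaussian, rule measurable_gaussian_component) blast
  have "finite ?I" "?T \<subseteq> ?I" by simp_all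
  from measure_distr_eq[OF gaussian_marginal[OF this] m E]
  have "measure (gaussian ?T) E = measure (gaussian ?I) ((\<lambda>x. \<lambda>i\<in>?T. x i) -` E \<inter> space (gaussian ?I))" .
  also have "(\<lambda>x. \<lambda>i\<in>?T. x i) -` E \<inter> space (gaussian ?I) = F"
  proof -
    have "field_sup N p k lam v 1 0 (\<lambda>i\<in>?T. x i) = field_sup N p k lam v 1 0 x" for x
      by (rule field_sup_cong) simp
    then show ?thesis using measurable_space[OF m] by (auto simp: E_def F_def)
  qed
  finally show "measure (gaussian ?T) E = measure (gaussian ?I) F" .
qed

text \<open>The sign appears because -H is maximised; symmetry of the normal law absorbs it.\<close>

lemma (in prob_space) tensor_law:
  fixes J :: "'a \<Rightarrow> nat list \<Rightarrow> real"
  assumes d: "\<And>is. length is = p \<Longrightarrow> distributed M lborel (\<lambda>\<omega>. J \<omega> is) std_normal_density"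
    and ind: "indep_vars (\<lambda>_. borel) (\<lambda>is \<omega>. J \<omega> is) {is. length is = p}" and N: "N \<ge> 1"
  shows "(\<lambda>\<omega>. \<lambda>is\<in>tidx p N. - J \<omega> is) \<in> measurable M (gaussian (tidx p N))"
    "distr M (gaussian (tidx p N)) (\<lambda>\<omega>. \<lambda>is\<in>tidx p N. - J \<omega> is) = gaussian (tidx p N)"
proof -
  let ?T = "tidx p N"
  have sub: "?T \<subseteq> {is. length is = p}" by (auto simp: tidx_def)
  have rv: "(\<lambda>\<omega>. J \<omega> is) \<in> borel_measurable M" if "is \<in> ?T" for "is"
    using distributed_measurable[OF d, of "is"] sub that by auto
  have dist: "distr M borel (\<lambda>\<omega>. J \<omega> is) = std_normal_distribution" if "is \<in> ?T" for "is"
  proof -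
    have "length is = p" using sub that by auto
    from distributed_distr_eq_density[OF d[OF this]]
    have "distr M lborel (\<lambda>\<omega>. J \<omega> is) = std_normal_distribution" .
    moreover have "distr M lborel (\<lambda>\<omega>. J \<omega> is) = distr M borel (\<lambda>\<omega>. J \<omega> is)"
      by (rule distr_cong) auto
    ultimately show ?thesis by simp
  qed
  \<comment> \<open>The product characterisation of independence applied below is for nonempty index
    sets.\<close>
  have "replicate p 0 \<in> ?T" using N by (auto simp: tidx_def)
  then have ne: "?T \<noteq> {}" by blast
  have "indep_vars (\<lambda>_. borel) (\<lambda>is \<omega>. J \<omega> is) ?T" by (rule indep_vars_subset[OF ind sub])
  then have "distr M (PiM ?T (\<lambda>_. borel)) (\<lambda>\<omega>. \<lambda>is\<in>?T. J \<omega> is) = (\<Pi>\<^sub>M is\<in>?T. distr M borel (\<lambda>\<omega>. J \<omega> is))"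
    using indep_vars_iff_distr_eq_PiM'[where I="?T" and X="\<lambda>is \<omega>. J \<omega> is" and M'="\<lambda>_. borel", OF ne rv] by blast
  also have "\<dots> = gaussian ?T"
    unfolding gaussian_def by (rule PiM_cong) (simp_all add: dist)
  finally have "distr M (gaussian ?T) (\<lambda>\<omega>. \<lambda>is\<in>?T. J \<omega> is) = gaussian ?T"
    by (subst distr_cong[OF refl sets_gaussian refl])
  have mJ: "(\<lambda>\<omega>. \<lambda>is\<in>?T. J \<omega> is) \<in> measurable M (gaussian ?T)"
    by (rule measurable_restrict_gaussian[OF rv])
  have mm: "(\<lambda>x. \<lambda>is\<in>?T. - x is) \<in> measurable (gaussian ?T) (gaussian ?T)"
    by (rule measurable_restrict_gaussian, rule borel_measurable_uminus, rule measurable_gaussian_component)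
  have comp: "(\<lambda>x. \<lambda>is\<in>?T. - x is) \<circ> (\<lambda>\<omega>. \<lambda>is\<in>?T. J \<omega> is) = (\<lambda>\<omega>. \<lambda>is\<in>?T. - J \<omega> is)"
    by (auto simp: fun_eq_iff)
  show "(\<lambda>\<omega>. \<lambda>is\<in>?T. - J \<omega> is) \<in> measurable M (gaussian ?T)"
    unfolding comp[symmetric] by (rule measurable_comp[OF mJ mm])
  have "distr M (gaussian ?T) (\<lambda>\<omega>. \<lambda>is\<in>?T. - J \<omega> is) = distr (distr M (gaussian ?T) (\<lambda>\<omega>. \<lambda>is\<in>?T. J \<omega> is)) (gaussian ?T) (\<lambda>x. \<lambda>is\<in>?T. - x is)"
    unfolding comp[symmetric] by (rule distr_distr[OF mm mJ, symmetric])
  also have "\<dots> = gaussian ?T"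
    unfolding \<open>distr M (gaussian ?T) (\<lambda>\<omega>. \<lambda>is\<in>?T. J \<omega> is) = gaussian ?T\<close> by (rule gaussian_uminus) simp
  finally show "distr M (gaussian ?T) (\<lambda>\<omega>. \<lambda>is\<in>?T. - J \<omega> is) = gaussian ?T" .
qed

text \<open>Borel-Cantelli for each deviation 1 / (n + 1), then a countable intersection. The
  tensors of different N share entries of J, which the convergence half of Borel-Cantelli
  permits.\<close>

lemma (in prob_space) AE_field_sup_tendsto:
  fixes J :: "'a \<Rightarrow> nat list \<Rightarrow> real" and v :: "nat \<Rightarrow> fvec"
  assumes d: "\<And>is. length is = p \<Longrightarrow> distributed M lborel (\<lambda>\<omega>. J \<omega> is) std_normal_density"
    and ind: "indep_vars (\<lambda>_. borel) (\<lambda>is \<omega>. J \<omega> is) {is. length is = p}"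
    and v: "\<And>N. N \<ge> 1 \<Longrightarrow> v N \<in> Rspace N" "\<And>N. N \<ge> 1 \<Longrightarrow> norm (v N) = 1"
    and conc: "\<forall>\<delta>>0. \<exists>\<beta>. summable \<beta> \<and> (\<forall>N\<ge>1. \<forall>v\<in>Rspace N. norm v = 1 \<longrightarrow>
     measure (gaussian (idx p N)) {x \<in> space (gaussian (idx p N)). \<delta> < \<bar>field_sup N p k lam v 1 0 x - U\<bar>} \<le> \<beta> N)"
  shows "AE \<omega> in M. (\<lambda>N. field_sup N p k lam (v N) 1 0 (\<lambda>is. - J \<omega> is)) \<longlonglongrightarrow> U"
proof -
  let ?S = "\<lambda>\<omega> N. field_sup N p k lam (v N) 1 0 (\<lambda>is. - J \<omega> is)"
  have ev: "AE \<omega> in M. eventually (\<lambda>N. \<bar>?S \<omega> N - U\<bar> \<le> \<delta>) sequentially" if \<delta>: "\<delta> > 0" for \<delta>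
  proof -
    from conc[rule_format, OF \<delta>] obtain \<beta> where \<beta>: "summable \<beta>" "\<forall>N\<ge>1. \<forall>v\<in>Rspace N. norm v = 1 \<longrightarrow>
     measure (gaussian (idx p N)) {x \<in> space (gaussian (idx p N)). \<delta> < \<bar>field_sup N p k lam v 1 0 x - U\<bar>} \<le> \<beta> N"
      by (elim exE conjE) (rule that)
    \<comment> \<open>Shifted by one so that each event has N \<ge> 1.\<close>
    define A where "A n = {\<omega> \<in> space M. \<delta> < \<bar>?S \<omega> (Suc n) - U\<bar>}" for n
    have A: "A n \<in> sets M" "measure M (A n) \<le> \<beta> (Suc n)" for n
    proof -
      let ?N = "Suc n"
      have N: "1 \<le> ?N" by simp
      define E where "E = {x \<in> space (gaussian (tidx p ?N)). \<delta> < \<bar>field_sup ?N p k lam (v ?N) 1 0 x - U\<bar>}"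
      note dm = field_sup_deviation_measure[OF N v(1)[OF N] v(2)[OF N], where p=p and \<delta>=\<delta> and k=k and lam=lam and U=U, folded E_def]
      note tl = tensor_law[OF d ind N]
      have "field_sup ?N p k lam (v ?N) 1 0 (\<lambda>is\<in>tidx p ?N. - J \<omega> is) = ?S \<omega> ?N" for \<omega>
        by (rule field_sup_cong) simp
      then have AE: "A n = (\<lambda>\<omega>. \<lambda>is\<in>tidx p ?N. - J \<omega> is) -` E \<inter> space M"
        using measurable_space[OF tl(1)] by (auto simp: A_def E_def)
      show "A n \<in> sets M" unfolding AE by (rule measurable_sets[OF tl(1) dm(1)])
      have "measure M (A n) = measure (gaussian (tidx p ?N)) E"
        unfolding AE by (rule measure_distr_eq[OF tl(2,1) dm(1), symmetric])
      also have "\<dots> \<le> \<beta> ?N"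
        unfolding dm(2) using \<beta>(2) v[OF N] N by blast
      finally show "measure M (A n) \<le> \<beta> (Suc n)" .
    qed
    have "summable (\<lambda>n. measure M (A n))"
    proof (rule summable_comparison_test')
      show "summable (\<lambda>n. \<beta> (Suc n))" using \<beta>(1) by (simp only: summable_Suc_iff)
      show "norm (measure M (A n)) \<le> \<beta> (Suc n)" for n using A(2)[of n] by simp
    qed
    then have "AE \<omega> in M. eventually (\<lambda>n. \<omega> \<in> space M - A n) sequentially"
      by (intro borel_cantelli_AE1 A) (simp_all add: emeasure_eq_measure)
    then show ?thesis
    proof (rule AE_mp, intro AE_I2 impI)
      fix \<omega> assume "\<omega> \<in> space M" and e: "eventually (\<lambda>n. \<omega> \<in> space M - A n) sequentially"
      then have "eventually (\<lambda>n. \<bar>?S \<omega> (Suc n) - U\<bar> \<le> \<delta>) sequentially"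
        by (elim eventually_mono) (auto simp: A_def)
      then show "eventually (\<lambda>N. \<bar>?S \<omega> N - U\<bar> \<le> \<delta>) sequentially"
        by (rule eventually_sequentially_Suc[where P="\<lambda>N. \<bar>?S \<omega> N - U\<bar> \<le> \<delta>", THEN iffD1])
    qed
  qed
  have "AE \<omega> in M. \<forall>n. eventually (\<lambda>N. \<bar>?S \<omega> N - U\<bar> \<le> 1 / real (Suc n)) sequentially"
    unfolding AE_all_countable by (intro allI ev) simp
  then show ?thesis
  proof (rule AE_mp, intro AE_I2 impI)
    fix \<omega> assume h: "\<forall>n. eventually (\<lambda>N. \<bar>?S \<omega> N - U\<bar> \<le> 1 / real (Suc n)) sequentially"
    show "?S \<omega> \<longlonglongrightarrow> U"
    proof (rule tendstoI)
      fix \<epsilon> :: real assume "0 < \<epsilon>"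
      then obtain n where n: "1 / real (Suc n) < \<epsilon>" using nat_approx_posE by blast
      show "eventually (\<lambda>N. dist (?S \<omega> N) U < \<epsilon>) sequentially"
        using h[rule_format, of n] by (rule eventually_mono) (use n in \<open>simp add: dist_real_def\<close>)
    qed
  qed
qed

section \<open>Ground state energy and overlap\<close>

definition unit_vec :: "nat \<Rightarrow> (nat \<Rightarrow> real) \<Rightarrow> fvec" where
  "unit_vec N \<sigma> = vec_of N (\<lambda>i. \<sigma> i / sqrt N)"

lemma unit_vec_Rspace [simp]: "unit_vec N \<sigma> \<in> Rspace N"
  by (simp add: unit_vec_def)

lemma norm_unit_vec:
  assumes "N \<ge> 1" "\<sigma> \<in> sphereN N"
  shows "norm (unit_vec N \<sigma>) = 1"
proof -
  have "(norm (unit_vec N \<sigma>))\<^sup>2 = (\<Sum>i<N. (\<sigma> i)\<^sup>2) / N"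
    unfolding norm_Rspace[OF unit_vec_Rspace] by (simp add: unit_vec_def power_divide sum_divide_distrib)
  then have "(norm (unit_vec N \<sigma>))\<^sup>2 = 1" using assms by (simp add: sphereN_def)
  then show ?thesis using norm_ge_zero[of "unit_vec N \<sigma>"] by (simp add: power2_eq_1_iff)
qed

lemma inner_unit_vec: "N \<ge> 1 \<Longrightarrow> unit_vec N \<sigma> \<bullet> unit_vec N \<tau> = dotN N \<sigma> \<tau> / N"
  unfolding inner_Rspace[OF unit_vec_Rspace]
  by (simp add: unit_vec_def dotN_def sum_divide_distrib)

lemma unit_vec_surj:
  assumes "N \<ge> 1" "u \<in> Rspace N" "norm u = 1"
  shows "\<exists>\<sigma>\<in>sphereN N. unit_vec N \<sigma> = u"
proof (rule bexI[of _ "\<lambda>i. sqrt N * coord u i"])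
  show "unit_vec N (\<lambda>i. sqrt N * coord u i) = u"
    using assms by (auto simp: coord_inject[symmetric] fun_eq_iff unit_vec_def Rspace_def)
  have "(\<Sum>i<N. (sqrt N * coord u i)\<^sup>2) = N * (norm u)\<^sup>2"
    unfolding norm_Rspace[OF assms(2)] by (simp add: power_mult_distrib sum_distrib_left)
  then show "(\<lambda>i. sqrt N * coord u i) \<in> sphereN N"
    using assms by (auto simp: sphereN_def Rspace_def)
qed

text \<open>Rescaling p coordinates produces sqrt N^p; together with N^(-(p - 1) / 2) this is sqrt
  N, exactly N times the normalisation of \<open>pspin\<close>.\<close>

lemma Ham_eq_field:
  assumes N: "N \<ge> 1" and p: "p \<ge> 1"
  shows "Ham p k lam N v0 J \<sigma> = - (N * field N p k lam (unit_vec N v0) 1 0 (\<lambda>is. - J is) (unit_vec N \<sigma>))"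
proof -
  let ?u = "unit_vec N \<sigma>"
  have sN: "sqrt N > 0" using N by simp
  have prod: "prod_list (map \<sigma> is) = sqrt N ^ p * (\<Prod>j<p. coord ?u (is ! j))" if "is": "is \<in> tidx p N" for "is"
  proof -
    have l: "length is = p" "\<And>j. j < p \<Longrightarrow> is ! j < N"
      using "is" by (auto simp: tidx_def) (meson lessThan_iff nth_mem subsetD)
    have "prod_list (map \<sigma> is) = (\<Prod>j<p. \<sigma> (is ! j))"
      by (simp add: prod.list_conv_set_nth l(1) atLeast0LessThan)
    also have "\<dots> = (\<Prod>j<p. sqrt N * coord ?u (is ! j))"
      using l(2) sN by (intro prod.cong refl) (simp add: unit_vec_def)
    finally show ?thesis by (simp add: prod.distrib)
  qed
  have "(\<Sum>is\<in>tidx p N. J is * prod_list (map \<sigma> is)) = (\<Sum>is\<in>tidx p N. - (sqrt N ^ p * ((\<Prod>j<p. coord ?u (is ! j)) * (- J is))))"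
    by (intro sum.cong refl) (simp add: prod)
  also have "\<dots> = - (sqrt N ^ p * mform N p (\<lambda>is. - J is) (\<lambda>_. ?u))"
    by (simp only: mform_def sum_negf sum_distrib_left)
  finally have 1: "(\<Sum>is\<in>tidx p N. J is * prod_list (map \<sigma> is)) = - (sqrt N ^ p * mform N p (\<lambda>is. - J is) (\<lambda>_. ?u))" .
  have "sqrt N ^ p = real N powr (p / 2)"
    using N by (simp add: powr_half_sqrt[symmetric] powr_powr powr_realpow[symmetric])
  then have "real N powr (- (real p - 1) / 2) * sqrt N ^ p = real N powr (- (real p - 1) / 2 + p / 2)"
    by (simp add: powr_add)
  also have "- (real p - 1) / 2 + p / 2 = 1 / 2" by (simp add: field_simps)
  also have "real N powr (1 / 2) = sqrt N" by (simp add: powr_half_sqrt)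
  finally have 2: "real N powr (- (real p - 1) / 2) * sqrt N ^ p = sqrt N" .
  have 3: "N * pspin N p (\<lambda>is. - J is) ?u = sqrt N * mform N p (\<lambda>is. - J is) (\<lambda>_. ?u)"
  proof -
    have "(sqrt N * sqrt N) * (a / sqrt N) = sqrt N * a" for a
      using sN by (simp add: mult.assoc del: real_sqrt_mult_self)
    then show ?thesis by (simp add: pspin_def)
  qed
  have "Ham p k lam N v0 J \<sigma> = - (real N powr (- (real p - 1) / 2) * sqrt N ^ p) * mform N p (\<lambda>is. - J is) (\<lambda>_. ?u)
      - lam * N / k * (?u \<bullet> unit_vec N v0) ^ k"
    unfolding Ham_def 1 inner_unit_vec[OF N] by (simp add: mult.assoc)
  also have "\<dots> = - (N * pspin N p (\<lambda>is. - J is) ?u) - lam * N / k * (?u \<bullet> unit_vec N v0) ^ k"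
    unfolding 2 3 by simp
  finally show ?thesis by (simp add: field_def algebra_simps)
qed

lemma ground_variational:
  fixes lam :: real and k :: nat and J :: "nat list \<Rightarrow> real"
  assumes N: "N \<ge> 1" and p: "p \<ge> 1" and v0: "v0 \<in> sphereN N"
  defines "E \<equiv> field N p k lam (unit_vec N v0) 1 0 (\<lambda>is. - J is)"
  defines "B \<equiv> - ground p k lam N v0 J / N"
  shows "\<And>u. u \<in> Rspace N \<Longrightarrow> norm u = 1 \<Longrightarrow> E u \<le> B"
    and "\<And>b. (\<And>u. u \<in> Rspace N \<Longrightarrow> norm u = 1 \<Longrightarrow> E u \<le> b) \<Longrightarrow> B \<le> b"
proof -
  have nv: "norm (unit_vec N v0) = 1" by (rule norm_unit_vec[OF N v0])
  obtain C where C: "\<And>u. norm u = 1 \<Longrightarrow> E u \<le> C"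
    using field_le[OF N _ nv] unfolding E_def by blast
  have H: "Ham p k lam N v0 J \<sigma> = - (N * E (unit_vec N \<sigma>))" for \<sigma>
    unfolding E_def by (rule Ham_eq_field[OF N p])
  have bdd: "bdd_below (Ham p k lam N v0 J ` sphereN N)"
  proof (rule bdd_belowI2)
    fix \<sigma> assume "\<sigma> \<in> sphereN N"
    then show "- (N * C) \<le> Ham p k lam N v0 J \<sigma>"
      unfolding H using C[OF norm_unit_vec[OF N]] by (simp add: mult_left_mono)
  qed
  show "E u \<le> B" if u: "u \<in> Rspace N" "norm u = 1" for u
  proof -
    obtain \<sigma> where \<sigma>: "\<sigma> \<in> sphereN N" "unit_vec N \<sigma> = u" using unit_vec_surj[OF N u] by blast
    have "ground p k lam N v0 J \<le> - (N * E u)"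
      unfolding ground_def using cINF_lower[OF bdd \<sigma>(1)] unfolding H \<sigma>(2) .
    then show ?thesis using N unfolding B_def by (simp add: field_simps)
  qed
  show "B \<le> b" if b: "\<And>u. u \<in> Rspace N \<Longrightarrow> norm u = 1 \<Longrightarrow> E u \<le> b" for b
  proof -
    have "- (N * b) \<le> ground p k lam N v0 J"
      unfolding ground_def
    proof (rule cINF_greatest)
      show "sphereN N \<noteq> {}" using v0 by blast
      fix \<sigma> assume "\<sigma> \<in> sphereN N"
      then have "E (unit_vec N \<sigma>) \<le> b" by (intro b unit_vec_Rspace norm_unit_vec[OF N])
      then show "- (N * b) \<le> Ham p k lam N v0 J \<sigma>" unfolding H by (simp add: mult_left_mono)
    qed
    then show ?thesis using N unfolding B_def by (simp add: field_simps)
  qed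
qed

text \<open>On the hemisphere around -v the signal is at most that of the field with v replaced by -v,
  whatever the parity of k; so both hemispheres obey the same bound.\<close>

lemma ground_tendsto:
  assumes p: "p \<ge> 1" and lam: "lam \<ge> 0" and v0: "\<And>N. v0 N \<in> sphereN N"
    and plus: "(\<lambda>N. field_sup N p k lam (unit_vec N (v0 N)) 1 0 (\<lambda>is. - J is)) \<longlonglongrightarrow> U"
    and minus: "(\<lambda>N. field_sup N p k lam (- unit_vec N (v0 N)) 1 0 (\<lambda>is. - J is)) \<longlonglongrightarrow> U"
  shows "(\<lambda>N. - ground p k lam N (v0 N) J / N) \<longlonglongrightarrow> U"
proof -
  have max: "(\<lambda>N. max (field_sup N p k lam (unit_vec N (v0 N)) 1 0 (\<lambda>is. - J is))
    (field_sup N p k lam (- unit_vec N (v0 N)) 1 0 (\<lambda>is. - J is))) \<longlonglongrightarrow> U"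
    using tendsto_max[OF plus minus] by simp
  have main: "field_sup N p k lam (unit_vec N (v0 N)) 1 0 (\<lambda>is. - J is) \<le> - ground p k lam N (v0 N) J / N \<and>
    - ground p k lam N (v0 N) J / N \<le> max (field_sup N p k lam (unit_vec N (v0 N)) 1 0 (\<lambda>is. - J is))
    (field_sup N p k lam (- unit_vec N (v0 N)) 1 0 (\<lambda>is. - J is))" if N: "N \<ge> 1" for N
  proof
    let ?w = "unit_vec N (v0 N)" and ?x = "\<lambda>is. - J is"
    have w: "?w \<in> Rspace N" "norm ?w = 1" using norm_unit_vec[OF N v0] by simp_all
    have w': "- ?w \<in> Rspace N" "norm (- ?w) = 1" using w subspace_Rspace by (auto intro: subspace_neg)
    note gv = ground_variational[OF N p v0, where k=k and lam=lam and J=J]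
    show "field_sup N p k lam ?w 1 0 ?x \<le> - ground p k lam N (v0 N) J / N"
      unfolding field_sup_def
    proof (rule cSUP_least)
      show "halfsphere (Rspace N) ?w \<noteq> {}" using halfsphere_self[OF w] by blast
      fix u assume "u \<in> halfsphere (Rspace N) ?w"
      then show "field N p k lam ?w 1 0 ?x u \<le> - ground p k lam N (v0 N) J / N"
        by (intro gv(1)) (auto simp: halfsphere_def)
    qed
    show "- ground p k lam N (v0 N) J / N \<le> max (field_sup N p k lam ?w 1 0 ?x) (field_sup N p k lam (- ?w) 1 0 ?x)"
    proof (rule gv(2))
      fix u assume u: "u \<in> Rspace N" "norm u = 1"
      show "field N p k lam ?w 1 0 ?x u \<le> max (field_sup N p k lam ?w 1 0 ?x) (field_sup N p k lam (- ?w) 1 0 ?x)"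
      proof (cases "0 \<le> u \<bullet> ?w")
        case True
        then have "u \<in> halfsphere (Rspace N) ?w" using u by (simp add: halfsphere_def)
        from cSUP_upper[OF this bdd_field[OF N w(2)]]
        have "field N p k lam ?w 1 0 ?x u \<le> field_sup N p k lam ?w 1 0 ?x" unfolding field_sup_def .
        then show ?thesis by simp
      next
        case False
        then have "u \<in> halfsphere (Rspace N) (- ?w)" using u by (simp add: halfsphere_def)
        from cSUP_upper[OF this bdd_field[OF N w'(2)]]
        have 1: "field N p k lam (- ?w) 1 0 ?x u \<le> field_sup N p k lam (- ?w) 1 0 ?x" unfolding field_sup_def .
        have "(u \<bullet> ?w) ^ k \<le> \<bar>(u \<bullet> ?w) ^ k\<bar>" by simp
        also have "\<dots> = (u \<bullet> (- ?w)) ^ k" using False by (simp add: power_abs)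
        finally have "lam / k * (u \<bullet> ?w) ^ k \<le> lam / k * (u \<bullet> (- ?w)) ^ k"
          using lam by (intro mult_left_mono) auto
        then have "field N p k lam ?w 1 0 ?x u \<le> field N p k lam (- ?w) 1 0 ?x u" by (simp add: field_def)
        with 1 show ?thesis by simp
      qed
    qed
  qed
  show ?thesis
    by (rule tendsto_sandwich[OF eventually_sequentiallyI[of 1] eventually_sequentiallyI[of 1] plus max])
      (use main in blast)+
qed

text \<open>The ground state energy is concave in lam, and the k-th power of the overlap of a minimiser is
  a supergradient; so its limit is squeezed between difference quotients of the limiting energy.\<close>

lemma overlap_power_tendsto:
  fixes e :: "nat \<Rightarrow> real"
  assumes p: "p \<ge> 1" and k: "k \<ge> 1" and v0: "\<And>N. v0 N \<in> sphereN N"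
    and \<sigma>: "\<And>N. \<sigma> N \<in> sphereN N" "\<And>N. Ham p k lam N (v0 N) J (\<sigma> N) = ground p k lam N (v0 N) J"
    and e: "\<And>n. 0 < e n"
    and lim0: "(\<lambda>N. - ground p k lam N (v0 N) J / N) \<longlonglongrightarrow> profile p k lam x"
    and limp: "\<And>n. (\<lambda>N. - ground p k (lam + e n) N (v0 N) J / N) \<longlonglongrightarrow> profile p k (lam + e n) (y n)"
    and limm: "\<And>n. (\<lambda>N. - ground p k (lam - e n) N (v0 N) J / N) \<longlonglongrightarrow> profile p k (lam - e n) (z n)"
    and max: "\<And>n. profile p k lam (y n) \<le> profile p k lam x" "\<And>n. profile p k lam (z n) \<le> profile p k lam x"
    and yz: "y \<longlonglongrightarrow> x" "z \<longlonglongrightarrow> x"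
  shows "(\<lambda>N. (dotN N (\<sigma> N) (v0 N) / N) ^ k) \<longlonglongrightarrow> x ^ k"
proof -
  define B where "B l N = - ground p k l N (v0 N) J / N" for l and N :: nat
  define q where "q N = (dotN N (\<sigma> N) (v0 N) / N) ^ k" for N
  \<comment> \<open>The minimiser for \<open>lam\<close> serves as a trial point for
    \<open>l\<close>; at a fixed point the energy is affine in the parameter, with slope read off
    from \<open>q\<close>.\<close>
  have sub: "B lam N + (l - lam) / k * q N \<le> B l N" if N: "N \<ge> 1" for l N
  proof -
    let ?u = "unit_vec N (\<sigma> N)" and ?w = "unit_vec N (v0 N)" and ?x = "\<lambda>is. - J is"
    have "field N p k l ?w 1 0 ?x ?u \<le> B l N"
      unfolding B_def by (rule ground_variational(1)[OF N p v0 unit_vec_Rspace norm_unit_vec[OF N \<sigma>(1)]])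
    moreover have "B lam N = field N p k lam ?w 1 0 ?x ?u"
      unfolding B_def \<sigma>(2)[symmetric] Ham_eq_field[OF N p] using N by simp
    moreover have "field N p k l ?w 1 0 ?x ?u = field N p k lam ?w 1 0 ?x ?u + (l - lam) / k * q N"
      unfolding field_def q_def inner_unit_vec[OF N] by (simp add: algebra_simps diff_divide_distrib)
    ultimately show ?thesis by simp
  qed
  have k0: "real k > 0" using k by simp
  have shift: "profile p k (lam + t) m = profile p k lam m + t / k * m ^ k" for t m
    by (simp add: profile_def add_divide_distrib distrib_right)
  show ?thesis
    unfolding q_def[symmetric]
  proof (rule order_tendstoI)
    fix a assume a: "x ^ k < a"
    have "(\<lambda>n. y n ^ k) \<longlonglongrightarrow> x ^ k" by (rule tendsto_power[OF yz(1)])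
    from eventually_happens'[OF sequentially_bot order_tendstoD(2)[OF this a]]
    obtain n where n: "y n ^ k < a" by (rule exE)
    have lim: "(\<lambda>N. real k * (B (lam + e n) N - B lam N) / e n) \<longlonglongrightarrow> k * (profile p k (lam + e n) (y n) - profile p k lam x) / e n"
      unfolding B_def using e[of n] by (intro tendsto_intros limp lim0) auto
    \<comment> \<open>At \<open>lam\<close> the point \<open>y n\<close> does no better than x, so
      the limiting difference quotient is at most \<open>y n ^ k\<close>.\<close>
    have "k * (profile p k (lam + e n) (y n) - profile p k lam x) / e n \<le> k * (e n / k * y n ^ k) / e n"
      using max(1)[of n] e[of n] unfolding shift by (intro divide_right_mono mult_left_mono) auto
    also have "\<dots> = y n ^ k" using e[of n] k0 by simp
    finally have "k * (profile p k (lam + e n) (y n) - profile p k lam x) / e n < a" using n by simp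
    from order_tendstoD(2)[OF lim this] eventually_ge_at_top[of 1]
    show "\<forall>\<^sub>F N in sequentially. q N < a"
    proof eventually_elim
      case (elim N)
      have "e n / k * q N \<le> B (lam + e n) N - B lam N" using sub[OF elim(2), of "lam + e n"] by simp
      then have "q N \<le> real k * (B (lam + e n) N - B lam N) / e n"
        using e[of n] k0 by (simp add: field_simps)
      then show ?case using elim(1) by simp
    qed
  next
    fix a assume a: "a < x ^ k"
    have "(\<lambda>n. z n ^ k) \<longlonglongrightarrow> x ^ k" by (rule tendsto_power[OF yz(2)])
    from eventually_happens'[OF sequentially_bot order_tendstoD(1)[OF this a]]
    obtain n where n: "a < z n ^ k" by (rule exE)
    have lim: "(\<lambda>N. real k * (B lam N - B (lam - e n) N) / e n) \<longlonglongrightarrow> k * (profile p k lam x - profile p k (lam - e n) (z n)) / e n"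
      unfolding B_def using e[of n] by (intro tendsto_intros limm lim0) auto
    have sh: "profile p k (lam - e n) (z n) = profile p k lam (z n) - e n / k * z n ^ k"
      using shift[of "- e n" "z n"] by simp
    have "z n ^ k = k * (e n / k * z n ^ k) / e n" using e[of n] k0 by simp
    also have "\<dots> \<le> k * (profile p k lam x - profile p k (lam - e n) (z n)) / e n"
      using max(2)[of n] e[of n] unfolding sh by (intro divide_right_mono mult_left_mono) auto
    finally have "a < k * (profile p k lam x - profile p k (lam - e n) (z n)) / e n" using n by simp
    from order_tendstoD(1)[OF lim this] eventually_ge_at_top[of 1]
    show "\<forall>\<^sub>F N in sequentially. a < q N"
    proof eventually_elim
      case (elim N)
      have "B lam N - B (lam - e n) N \<le> e n / k * q N" using sub[OF elim(2), of "lam - e n"] by simp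
      then have "real k * (B lam N - B (lam - e n) N) / e n \<le> q N"
        using e[of n] k0 by (simp add: field_simps)
      then show ?case using elim(1) by simp
    qed
  qed
qed

text \<open>An even power does not see the sign, so for even k it is the modulus that
  converges.\<close>

lemma tendsto_from_power:
  fixes t :: "nat \<Rightarrow> real"
  assumes k: "k \<ge> 1" and x: "0 \<le> x" and lim: "(\<lambda>N. t N ^ k) \<longlonglongrightarrow> x ^ k"
  shows "(\<lambda>N. if even k then \<bar>t N\<bar> else t N) \<longlonglongrightarrow> x"
proof -
  have "root k (t N ^ k) = (if even k then \<bar>t N\<bar> else t N)" for N
  proof (cases "even k")
    case True
    then have "root k (t N ^ k) = root k (\<bar>t N\<bar> ^ k)" by (simp add: power_even_abs)
    then show ?thesis using True k by (simp add: real_root_power_cancel)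
  next
    case False
    then show ?thesis by (simp add: odd_real_root_power_cancel)
  qed
  moreover have "root k (x ^ k) = x" using k x by (simp add: real_root_power_cancel)
  ultimately show ?thesis using tendsto_real_root[OF lim, of k] by simp
qed

text \<open>The constant precedes M, J and v0, and one almost sure event serves every sequence of
  minimisers. For even k the signal does not distinguish v0 from its negative, hence the absolute
  value of the overlap.\<close>

theorem theorem1p7:
  fixes p k :: nat
  assumes "p \<ge> 3" and "k \<ge> 1"
  shows "\<exists>c>0. \<forall>lam>c. \<forall>(M :: 'a measure) (J :: 'a \<Rightarrow> nat list \<Rightarrow> real) (v0 :: nat \<Rightarrow> nat \<Rightarrow> real).
    prob_space M
    \<and> (\<forall>is. length is = p \<longrightarrow> distributed M lborel (\<lambda>\<omega>. J \<omega> is) std_normal_density)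
    \<and> prob_space.indep_vars M (\<lambda>_. borel) (\<lambda>is \<omega>. J \<omega> is) {is. length is = p}
    \<and> (\<forall>N. v0 N \<in> sphereN N)
    \<longrightarrow> (AE \<omega> in M.
          ((\<lambda>N. ground p k lam N (v0 N) (J \<omega>) / real N) \<longlonglongrightarrow>
              - lam * mstar p k lam ^ k / real k - sqrt (real p * (1 - (mstar p k lam)\<^sup>2)))
        \<and> (\<forall>\<sigma>s :: nat \<Rightarrow> nat \<Rightarrow> real.
             (\<forall>N. \<sigma>s N \<in> sphereN N \<and>
                  Ham p k lam N (v0 N) (J \<omega>) (\<sigma>s N) = ground p k lam N (v0 N) (J \<omega>))
             \<longrightarrow> ((\<lambda>N. (if even k then \<bar>dotN N (\<sigma>s N) (v0 N)\<bar> else dotN N (\<sigma>s N) (v0 N)) / real N)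
                   \<longlonglongrightarrow> mstar p k lam)))"
proof -
  have p1: "p \<ge> 1" and p2: "p \<ge> 2" using assms by auto
  note k = assms(2)
  obtain c1 where c1: "c1 > 0" and conc: "\<forall>lam\<ge>c1. \<forall>mx. 0 \<le> mx \<longrightarrow> mx \<le> 1 \<longrightarrow> (\<forall>m. 0 \<le> m \<longrightarrow> m \<le> 1 \<longrightarrow> profile p k lam m \<le> profile p k lam mx) \<longrightarrow>
    (\<forall>\<delta>>0. \<exists>\<beta>. summable \<beta> \<and> (\<forall>N\<ge>1. \<forall>v\<in>Rspace N. norm v = 1 \<longrightarrow>
     measure (gaussian (idx p N)) {x \<in> space (gaussian (idx p N)). \<delta> < \<bar>field_sup N p k lam v 1 0 x - profile p k lam mx\<bar>} \<le> \<beta> N))"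
    using field_sup_concentration[OF p2 k] by (elim exE conjE) (rule that)
  obtain c2 where c2: "c2 > 0" and ms: "\<forall>lam>c2. 0 < mstar p k lam \<and> mstar p k lam < 1 \<and>
    (\<forall>m. 0 \<le> m \<longrightarrow> m \<le> 1 \<longrightarrow> profile p k lam m \<le> profile p k lam (mstar p k lam)) \<and>
    (\<forall>x. 0 \<le> x \<longrightarrow> x \<le> 1 \<longrightarrow> (\<forall>m. 0 \<le> m \<longrightarrow> m \<le> 1 \<longrightarrow> profile p k lam m \<le> profile p k lam x) \<longrightarrow> x = mstar p k lam)"
    using mstar_maximises[OF k p1] by (elim exE conjE) (rule that)
  define c where "c = max c1 c2"
  have c: "c > 0" using c1 by (simp add: c_def)
  let ?m = "mstar p k"
  have m01: "0 \<le> ?m l" "?m l \<le> 1" and mmax: "\<forall>m. 0 \<le> m \<longrightarrow> m \<le> 1 \<longrightarrow> profile p k l m \<le> profile p k l (?m l)"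
    and muniq: "\<forall>x. 0 \<le> x \<longrightarrow> x \<le> 1 \<longrightarrow> (\<forall>m. 0 \<le> m \<longrightarrow> m \<le> 1 \<longrightarrow> profile p k l m \<le> profile p k l x) \<longrightarrow> x = ?m l"
    if "l > c" for l
  proof -
    have "l > c2" using that by (simp add: c_def)
    note h = ms[rule_format, OF this]
    show "0 \<le> ?m l" "?m l \<le> 1" using h by auto
    show "\<forall>m. 0 \<le> m \<longrightarrow> m \<le> 1 \<longrightarrow> profile p k l m \<le> profile p k l (?m l)" using h by (elim conjE)
    show "\<forall>x. 0 \<le> x \<longrightarrow> x \<le> 1 \<longrightarrow> (\<forall>m. 0 \<le> m \<longrightarrow> m \<le> 1 \<longrightarrow> profile p k l m \<le> profile p k l x) \<longrightarrow> x = ?m l"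
      using h by (elim conjE)
  qed
  show ?thesis
  proof (rule exI[of _ c], rule conjI[OF c], intro allI impI)
    fix lam and M :: "'a measure" and J :: "'a \<Rightarrow> nat list \<Rightarrow> real" and v0 :: "nat \<Rightarrow> nat \<Rightarrow> real"
    assume lam: "lam > c"
      and A: "prob_space M
    \<and> (\<forall>is. length is = p \<longrightarrow> distributed M lborel (\<lambda>\<omega>. J \<omega> is) std_normal_density)
    \<and> prob_space.indep_vars M (\<lambda>_. borel) (\<lambda>is \<omega>. J \<omega> is) {is. length is = p}
    \<and> (\<forall>N. v0 N \<in> sphereN N)"
    note M = A[THEN conjunct1]
      and d = A[THEN conjunct2, THEN conjunct1, THEN spec, THEN mp]
      and ind = A[THEN conjunct2, THEN conjunct2, THEN conjunct1]
      and v0 = A[THEN conjunct2, THEN conjunct2, THEN conjunct2, THEN spec]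
    interpret prob_space M by (rule M)
    have gl: "AE \<omega> in M. (\<lambda>N. - ground p k l N (v0 N) (J \<omega>) / N) \<longlonglongrightarrow> profile p k l (?m l)" if l: "l > c" for l
    proof -
      have "c1 \<le> l" using l by (simp add: c_def)
      have cc': "\<forall>\<delta>>0. \<exists>\<beta>. summable \<beta> \<and> (\<forall>N\<ge>1. \<forall>v\<in>Rspace N. norm v = 1 \<longrightarrow>
         measure (gaussian (idx p N)) {x \<in> space (gaussian (idx p N)). \<delta> < \<bar>field_sup N p k l v 1 0 x - profile p k l (?m l)\<bar>} \<le> \<beta> N)"
        by (rule conc[THEN spec[of _ l], THEN mp, OF \<open>c1 \<le> l\<close>, THEN spec[of _ "?m l"], THEN mp, OF m01(1)[OF l], THEN mp, OF m01(2)[OF l], THEN mp, OF mmax[OF l]])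
      have vp: "unit_vec N (v0 N) \<in> Rspace N" "- unit_vec N (v0 N) \<in> Rspace N" for N
        using subspace_neg[OF subspace_Rspace, of "unit_vec N (v0 N)" N] by simp_all
      have np: "norm (unit_vec N (v0 N)) = 1" "norm (- unit_vec N (v0 N)) = 1" if "N \<ge> 1" for N
        using norm_unit_vec[OF that v0] by simp_all
      have "AE \<omega> in M. (\<lambda>N. field_sup N p k l (unit_vec N (v0 N)) 1 0 (\<lambda>is. - J \<omega> is)) \<longlonglongrightarrow> profile p k l (?m l)"
        by (rule AE_field_sup_tendsto[OF d ind vp(1) np(1) cc'])
      moreover have "AE \<omega> in M. (\<lambda>N. field_sup N p k l (- unit_vec N (v0 N)) 1 0 (\<lambda>is. - J \<omega> is)) \<longlonglongrightarrow> profile p k l (?m l)"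
        by (rule AE_field_sup_tendsto[OF d ind vp(2) np(2) cc'])
      ultimately show ?thesis
      proof eventually_elim
        case (elim \<omega>)
        have "0 \<le> l" using l c by simp
        from ground_tendsto[OF p1 this v0 elim] show ?case .
      qed
    qed
    \<comment> \<open>The offset 2 keeps \<open>lam - e n\<close> strictly above c already at n =
      0.\<close>
    define e where "e n = (lam - c) / (real n + 2)" for n :: nat
    have e: "0 < e n" "c < lam - e n" "c < lam + e n" for n
    proof -
      show e0: "0 < e n" using lam by (simp add: e_def)
      have "(lam - c) * 1 < (lam - c) * (real n + 2)" using lam by (intro mult_strict_left_mono) auto
      then have "e n < lam - c" unfolding e_def by (simp add: divide_less_eq)
      then show "c < lam - e n" by (simp add: less_diff_eq add.commute)
      show "c < lam + e n" using less_trans[OF lam] e0 by simp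
    qed
    have e_lim: "e \<longlonglongrightarrow> 0"
      using LIMSEQ_ignore_initial_segment[OF lim_const_over_n[of "lam - c"], of 2]
      unfolding e_def[abs_def] by (simp add: add.commute)
    have me: "(\<lambda>n. - e n) \<longlonglongrightarrow> 0" using tendsto_minus[OF e_lim] by simp
    have max0: "profile p k lam m \<le> profile p k lam (?m lam)" if "0 \<le> m" "m \<le> 1" for m
      by (rule mmax[OF lam, THEN spec, THEN mp, THEN mp, OF that])
    have cont: "(\<lambda>n. ?m (lam + e' n)) \<longlonglongrightarrow> ?m lam" if e': "e' \<longlonglongrightarrow> 0" "\<And>n. c < lam + e' n" for e' :: "nat \<Rightarrow> real"
    proof (rule maximiser_continuous[OF k m01[OF lam]])
      show "profile p k lam m \<le> profile p k lam (?m lam)" if "0 \<le> m" "m \<le> 1" for m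
        by (rule max0[OF that])
      show "y = ?m lam" if "0 \<le> y" "y \<le> 1" "\<And>m. 0 \<le> m \<Longrightarrow> m \<le> 1 \<Longrightarrow> profile p k lam m \<le> profile p k lam y" for y
        by (rule muniq[OF lam, THEN spec, THEN mp, THEN mp, THEN mp, OF that(1,2)]) (intro allI impI that(3))
      show "e' \<longlonglongrightarrow> 0" by (rule e'(1))
      show "0 \<le> ?m (lam + e' n)" "?m (lam + e' n) \<le> 1" for n by (rule m01[OF e'(2)])+
      show "profile p k (lam + e' n) m \<le> profile p k (lam + e' n) (?m (lam + e' n))" if "0 \<le> m" "m \<le> 1" for n m
        by (rule mmax[OF e'(2)[of n], THEN spec, THEN mp, THEN mp, OF that])
    qed
    note ylim = cont[OF e_lim e(3)]
    have zlim: "(\<lambda>n. ?m (lam + - e n)) \<longlonglongrightarrow> ?m lam"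
      by (rule cont[OF me]) (use e(2) in simp)
    \<comment> \<open>The parameters around \<open>lam\<close> are countably many, so a single null
      set serves all difference quotients.\<close>
    have "AE \<omega> in M. \<forall>n. (\<lambda>N. - ground p k (lam + e n) N (v0 N) (J \<omega>) / N) \<longlonglongrightarrow> profile p k (lam + e n) (?m (lam + e n))"
      unfolding AE_all_countable by (intro allI gl e)
    moreover have "AE \<omega> in M. \<forall>n. (\<lambda>N. - ground p k (lam - e n) N (v0 N) (J \<omega>) / N) \<longlonglongrightarrow> profile p k (lam - e n) (?m (lam - e n))"
      unfolding AE_all_countable by (intro allI gl e)
    moreover note gl[OF lam]
    ultimately show "AE \<omega> in M.
          ((\<lambda>N. ground p k lam N (v0 N) (J \<omega>) / real N) \<longlonglongrightarrow>
              - lam * mstar p k lam ^ k / real k - sqrt (real p * (1 - (mstar p k lam)\<^sup>2)))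
        \<and> (\<forall>\<sigma>s :: nat \<Rightarrow> nat \<Rightarrow> real.
             (\<forall>N. \<sigma>s N \<in> sphereN N \<and>
                  Ham p k lam N (v0 N) (J \<omega>) (\<sigma>s N) = ground p k lam N (v0 N) (J \<omega>))
             \<longrightarrow> ((\<lambda>N. (if even k then \<bar>dotN N (\<sigma>s N) (v0 N)\<bar> else dotN N (\<sigma>s N) (v0 N)) / real N)
                   \<longlonglongrightarrow> mstar p k lam))"
    proof eventually_elim
      case (elim \<omega>)
      have "- profile p k lam (?m lam) = - lam * mstar p k lam ^ k / real k - sqrt (real p * (1 - (mstar p k lam)\<^sup>2))"
        by (simp add: profile_def real_sqrt_mult)
      moreover have "(\<lambda>N. - (- ground p k lam N (v0 N) (J \<omega>) / N)) \<longlonglongrightarrow> - profile p k lam (?m lam)"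
        by (rule tendsto_minus[OF elim(3)])
      ultimately have L: "(\<lambda>N. ground p k lam N (v0 N) (J \<omega>) / real N) \<longlonglongrightarrow>
              - lam * mstar p k lam ^ k / real k - sqrt (real p * (1 - (mstar p k lam)\<^sup>2))"
        by (simp only: minus_divide_left minus_minus)
      have "(\<lambda>N. (if even k then \<bar>dotN N (\<sigma>s N) (v0 N)\<bar> else dotN N (\<sigma>s N) (v0 N)) / real N) \<longlonglongrightarrow> ?m lam"
        if \<sigma>: "\<forall>N. \<sigma>s N \<in> sphereN N \<and> Ham p k lam N (v0 N) (J \<omega>) (\<sigma>s N) = ground p k lam N (v0 N) (J \<omega>)" for \<sigma>s
      proof -
        have s1: "\<sigma>s N \<in> sphereN N" and s2: "Ham p k lam N (v0 N) (J \<omega>) (\<sigma>s N) = ground p k lam N (v0 N) (J \<omega>)" for N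
          by (rule \<sigma>[THEN spec, THEN conjunct1], rule \<sigma>[THEN spec, THEN conjunct2])
        have "(\<lambda>N. (dotN N (\<sigma>s N) (v0 N) / N) ^ k) \<longlonglongrightarrow> ?m lam ^ k"
        proof (rule overlap_power_tendsto[where e=e and y="\<lambda>n. ?m (lam + e n)" and z="\<lambda>n. ?m (lam - e n)", OF p1 k v0 s1 s2 e(1) elim(3)])
          fix n
          show "(\<lambda>N. - ground p k (lam + e n) N (v0 N) (J \<omega>) / N) \<longlonglongrightarrow> profile p k (lam + e n) (?m (lam + e n))"
            "(\<lambda>N. - ground p k (lam - e n) N (v0 N) (J \<omega>) / N) \<longlonglongrightarrow> profile p k (lam - e n) (?m (lam - e n))"
            by (rule elim(1)[THEN spec], rule elim(2)[THEN spec])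
          show "profile p k lam (?m (lam + e n)) \<le> profile p k lam (?m lam)" by (rule max0[OF m01[OF e(3)]])
          show "profile p k lam (?m (lam - e n)) \<le> profile p k lam (?m lam)" by (rule max0[OF m01[OF e(2)]])
        next
          show "(\<lambda>n. ?m (lam + e n)) \<longlonglongrightarrow> ?m lam" by (rule ylim)
          show "(\<lambda>n. ?m (lam - e n)) \<longlonglongrightarrow> ?m lam" using zlim by simp
        qed
        from tendsto_from_power[OF k m01(1)[OF lam] this]
        have "(\<lambda>N. if even k then \<bar>dotN N (\<sigma>s N) (v0 N) / real N\<bar> else dotN N (\<sigma>s N) (v0 N) / real N) \<longlonglongrightarrow> ?m lam" .
        moreover have "(\<lambda>N. if even k then \<bar>dotN N (\<sigma>s N) (v0 N) / real N\<bar> else dotN N (\<sigma>s N) (v0 N) / real N) =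
          (\<lambda>N. (if even k then \<bar>dotN N (\<sigma>s N) (v0 N)\<bar> else dotN N (\<sigma>s N) (v0 N)) / real N)"
          by (intro ext) (simp add: abs_divide)
        ultimately show ?thesis by (simp only:)
      qed
      with L show ?case by (intro conjI allI impI)
    qed
  qed
qed

end
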